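(* Let $A$ be a quadri-biserial algebra, and let $M$ be an indecomposable module of length four in $\mathrm{mod}\,A$. Then exactly one of the following cases occurs: (1) $M$ is an N-shaped module; (2) $M$ is an astride biserial projective module; (3) $M$ is a co-astride biserial injective module; (4) $M$ is a projective-injective module, which is uniserial or lozenge.
   Context: $A$ is an artin $R$-algebra, where $R$ is a commutative artinian ring; $\mathrm{mod}\,A$ is the category of finitely generated left $A$-modules; $A^\circ$ is the opposite algebra, and $\mathrm{mod}\,A^\circ$ is identified with the category of finitely generated right $A$-modules. Length means composition length. For a module $M$, $\mathrm{top}\,M=M/\mathrm{rad}\,M$, and $I_M$ denotes an injective envelope of $M$ (in the category $\mathrm{mod}\,A$ or $\mathrm{mod}\,A^\circ$ in which $M$ lies). A module is local if its top is simple, colocal if its socle is simple, and projective-injective if it is both projective and injective. A module is uniserial if any two of its submodules are comparable under inclusion. An indecomposable module $M$ is biserial if it has two non-comparable uniserial submodules $M_1,M_2$ such that (i) $M_1+M_2$ is $M$ or the largest proper submodule of $M$, and (ii) $M_1\cap M_2$ is zero or the smallest nonzero submodule of $M$. A biserial module is astride biserial if it is local and not colocal; co-astride biserial if it is colocal and not local; diamond biserial if it is both local and colocal. A lozenge module is a diamond biserial module of length four. An indecomposable module $M$ is N-shaped if $M=M_1+M_2$ for submodules $M_1,M_2$ with $M_1$ astride biserial of length three and $M_2$ uniserial of length two. An artin algebra $A$ is biserial if every indecomposable non-uniserial projective module in $\mathrm{mod}\,A$ or $\mathrm{mod}\,A^\circ$ is biserial. A biserial artin algebra $A$ is quadri-biserial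 if every indecomposable projective module $P$ in $\mathrm{mod}\,A$ and in $\mathrm{mod}\,A^\circ$ satisfies: (a) the length of $P$ is at most four; (b) if $\mathrm{top}(\mathrm{rad}\,P)=S_1\oplus S_2$ with $S_1,S_2$ simple, then $I_{S_1}$ or $I_{S_2}$ is uniserial; (c) if $\mathrm{rad}\,P=S\oplus U$ with $S$ simple and $U$ uniserial of length two, then $I_S$ and $I_{\mathrm{soc}\,U}$ are uniserial. *)

theory Defs
  imports "HOL-Algebra.Module" "HOL-Algebra.Ideal"
begin

section \<open>Modules over a not necessarily commutative ring\<close>

text \<open>The library locale \<^locale>\<open>module\<close> requires a commutative ring of scalars. The record type
  of modules and the locale \<^locale>\<open>submodule\<close> do not and are reused. The fields \<^const>\<open>mult\<close> and
  \<^const>\<open>one\<close> of a module record play no role. A submodule \<open>N\<close> of \<open>M\<close>, seen as a module, is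
  \<open>M\<lparr>carrier := N\<rparr>\<close>.\<close>

locale left_module = A?: ring A + M?: abelian_group M
  for A :: "('a, 'x) ring_scheme" (structure) and M :: "('a, 'c, 'y) module_scheme" (structure) +
  assumes smult_closed [simp, intro]:
      "\<lbrakk>a \<in> carrier A; x \<in> carrier M\<rbrakk> \<Longrightarrow> a \<odot>\<^bsub>M\<^esub> x \<in> carrier M"
    and smult_l_distr:
      "\<lbrakk>a \<in> carrier A; b \<in> carrier A; x \<in> carrier M\<rbrakk> \<Longrightarrow>
        (a \<oplus>\<^bsub>A\<^esub> b) \<odot>\<^bsub>M\<^esub> x = a \<odot>\<^bsub>M\<^esub> x \<oplus>\<^bsub>M\<^esub> b \<odot>\<^bsub>M\<^esub> x"
    and smult_r_distr:
      "\<lbrakk>a \<in> carrier A; x \<in> carrier M; y \<in> carrier M\<rbrakk> \<Longrightarrow>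
        a \<odot>\<^bsub>M\<^esub> (x \<oplus>\<^bsub>M\<^esub> y) = a \<odot>\<^bsub>M\<^esub> x \<oplus>\<^bsub>M\<^esub> a \<odot>\<^bsub>M\<^esub> y"
    and smult_assoc1:
      "\<lbrakk>a \<in> carrier A; b \<in> carrier A; x \<in> carrier M\<rbrakk> \<Longrightarrow>
        (a \<otimes>\<^bsub>A\<^esub> b) \<odot>\<^bsub>M\<^esub> x = a \<odot>\<^bsub>M\<^esub> (b \<odot>\<^bsub>M\<^esub> x)"
    and smult_one [simp]: "x \<in> carrier M \<Longrightarrow> \<one>\<^bsub>A\<^esub> \<odot>\<^bsub>M\<^esub> x = x"

definition submodule_span ::
    "('a, 'x) ring_scheme \<Rightarrow> ('a, 'm, 'y) module_scheme \<Rightarrow> 'm set \<Rightarrow> 'm set" where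
  "submodule_span A M X = \<Inter> {N. submodule N A M \<and> X \<subseteq> N}"

definition finitely_generated ::
    "('a, 'x) ring_scheme \<Rightarrow> ('a, 'm, 'y) module_scheme \<Rightarrow> bool" where
  "finitely_generated A M \<longleftrightarrow>
    (\<exists>X. finite X \<and> X \<subseteq> carrier M \<and> submodule_span A M X = carrier M)"

text \<open>The objects of \<open>mod A\<close>.\<close>

definition fg_module :: "('a, 'x) ring_scheme \<Rightarrow> ('a, 'm) module \<Rightarrow> bool" where
  "fg_module A M \<longleftrightarrow> left_module A M \<and> finitely_generated A M"

definition module_hom ::
    "('a, 'x) ring_scheme \<Rightarrow> ('a, 'm) module \<Rightarrow> ('a, 'n) module \<Rightarrow> ('m \<Rightarrow> 'n) set" where
  "module_hom A M N = {f \<in> carrier M \<rightarrow> carrier N.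
     (\<forall>x\<in>carrier M. \<forall>y\<in>carrier M. f (x \<oplus>\<^bsub>M\<^esub> y) = f x \<oplus>\<^bsub>N\<^esub> f y) \<and>
     (\<forall>a\<in>carrier A. \<forall>x\<in>carrier M. f (a \<odot>\<^bsub>M\<^esub> x) = a \<odot>\<^bsub>N\<^esub> f x)}"

definition module_iso ::
    "('a, 'x) ring_scheme \<Rightarrow> ('a, 'm) module \<Rightarrow> ('a, 'n) module \<Rightarrow> ('m \<Rightarrow> 'n) set" where
  "module_iso A M N = {f \<in> module_hom A M N. bij_betw f (carrier M) (carrier N)}"

definition quot_module :: "('a, 'm) module \<Rightarrow> 'm set \<Rightarrow> ('a, 'm set) module" where
  "quot_module M N =
    \<lparr>carrier = a_rcosets\<^bsub>M\<^esub> N, mult = (\<lambda>_ _. N), one = N, zero = N, add = (<+>\<^bsub>M\<^esub>),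
     smult = (\<lambda>a X. \<Union>x\<in>X. N +>\<^bsub>M\<^esub> (a \<odot>\<^bsub>M\<^esub> x))\<rparr>"

definition internal_direct_sum ::
    "('a, 'x) ring_scheme \<Rightarrow> ('a, 'm) module \<Rightarrow> 'm set \<Rightarrow> 'm set \<Rightarrow> bool" where
  "internal_direct_sum A M N N' \<longleftrightarrow> submodule N A M \<and> submodule N' A M \<and>
     N <+>\<^bsub>M\<^esub> N' = carrier M \<and> N \<inter> N' = {\<zero>\<^bsub>M\<^esub>}"

definition indecomposable :: "('a, 'x) ring_scheme \<Rightarrow> ('a, 'm) module \<Rightarrow> bool" where
  "indecomposable A M \<longleftrightarrow> carrier M \<noteq> {\<zero>\<^bsub>M\<^esub>} \<and>
     (\<forall>N N'. internal_direct_sum A M N N' \<longrightarrow> N = {\<zero>\<^bsub>M\<^esub>} \<or> N' = {\<zero>\<^bsub>M\<^esub>})"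

definition simple_module :: "('a, 'x) ring_scheme \<Rightarrow> ('a, 'm) module \<Rightarrow> bool" where
  "simple_module A M \<longleftrightarrow> carrier M \<noteq> {\<zero>\<^bsub>M\<^esub>} \<and>
     (\<forall>N. submodule N A M \<longrightarrow> N = {\<zero>\<^bsub>M\<^esub>} \<or> N = carrier M)"

definition uniserial :: "('a, 'x) ring_scheme \<Rightarrow> ('a, 'm) module \<Rightarrow> bool" where
  "uniserial A M \<longleftrightarrow>
     (\<forall>N N'. submodule N A M \<and> submodule N' A M \<longrightarrow> N \<subseteq> N' \<or> N' \<subseteq> N)"

text \<open>The length is a relation rather than a function: \<open>M\<close> has length \<open>n\<close> if it has a composition
  series with \<open>n\<close> factors.\<close>

definition has_length :: "('a, 'x) ring_scheme \<Rightarrow> ('a, 'm) module \<Rightarrow> nat \<Rightarrow> bool" where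
  "has_length A M n \<longleftrightarrow> (\<exists>N. N 0 = {\<zero>\<^bsub>M\<^esub>} \<and> N n = carrier M \<and>
     (\<forall>i\<le>n. submodule (N i) A M) \<and>
     (\<forall>i<n. N i \<subseteq> N (Suc i) \<and>
        simple_module A (quot_module (M\<lparr>carrier := N (Suc i)\<rparr>) (N i))))"

definition maximal_submodule ::
    "('a, 'x) ring_scheme \<Rightarrow> ('a, 'm) module \<Rightarrow> 'm set \<Rightarrow> bool" where
  "maximal_submodule A M N \<longleftrightarrow> submodule N A M \<and> N \<noteq> carrier M \<and>
     (\<forall>N'. submodule N' A M \<and> N \<subseteq> N' \<longrightarrow> N' = N \<or> N' = carrier M)"

definition rad :: "('a, 'x) ring_scheme \<Rightarrow> ('a, 'm) module \<Rightarrow> 'm set" where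
  "rad A M = carrier M \<inter> \<Inter> {N. maximal_submodule A M N}"

definition top_module :: "('a, 'x) ring_scheme \<Rightarrow> ('a, 'm) module \<Rightarrow> ('a, 'm set) module" where
  "top_module A M = quot_module M (rad A M)"

definition soc :: "('a, 'x) ring_scheme \<Rightarrow> ('a, 'm) module \<Rightarrow> 'm set" where
  "soc A M = submodule_span A M
     (\<Union> {S. submodule S A M \<and> simple_module A (M\<lparr>carrier := S\<rparr>)})"

definition local_module :: "('a, 'x) ring_scheme \<Rightarrow> ('a, 'm) module \<Rightarrow> bool" where
  "local_module A M \<longleftrightarrow> simple_module A (top_module A M)"

definition colocal_module :: "('a, 'x) ring_scheme \<Rightarrow> ('a, 'm) module \<Rightarrow> bool" where
  "colocal_module A M \<longleftrightarrow> simple_module A (M\<lparr>carrier := soc A M\<rparr>)"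


section \<open>Projective and injective modules\<close>

text \<open>A quantifier inside a definition ranges over modules with elements in one fixed type. For
  \<open>mod A\<close> we take the type \<open>(nat \<Rightarrow> 'a) set\<close>. It is large enough: a module generated by \<open>n\<close> elements
  is a quotient of \<open>A\<^sup>n\<close>, so its elements are cosets of coefficient vectors. The lemma
  \<open>ex_isomorphic_fg_object\<close> below makes this precise.\<close>

type_synonym 'a fg_object = "('a, (nat \<Rightarrow> 'a) set) module"

definition projective :: "('a, 'x) ring_scheme \<Rightarrow> ('a, 'm) module \<Rightarrow> bool" where
  "projective A P \<longleftrightarrow> fg_module A P \<and>
     (\<forall>(X :: 'a fg_object) (Y :: 'a fg_object). \<forall>p\<in>module_hom A X Y. \<forall>f\<in>module_hom A P Y.
        fg_module A X \<and> fg_module A Y \<and> p ` carrier X = carrier Y \<longrightarrow>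
        (\<exists>g\<in>module_hom A P X. \<forall>x\<in>carrier P. p (g x) = f x))"

definition injective :: "('a, 'x) ring_scheme \<Rightarrow> ('a, 'm) module \<Rightarrow> bool" where
  "injective A E \<longleftrightarrow> fg_module A E \<and>
     (\<forall>(X :: 'a fg_object) (Y :: 'a fg_object). \<forall>i\<in>module_hom A X Y. \<forall>f\<in>module_hom A X E.
        fg_module A X \<and> fg_module A Y \<and> inj_on i (carrier X) \<longrightarrow>
        (\<exists>g\<in>module_hom A Y E. \<forall>x\<in>carrier X. g (i x) = f x))"

definition injective_envelope ::
    "('a, 'x) ring_scheme \<Rightarrow> ('a, 'm) module \<Rightarrow> ('a, 'n) module \<Rightarrow> ('m \<Rightarrow> 'n) \<Rightarrow> bool" where
  "injective_envelope A M E i \<longleftrightarrow> injective A E \<and>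
     i \<in> module_hom A M E \<and> inj_on i (carrier M) \<and>
     (\<forall>N. submodule N A E \<and> N \<inter> i ` carrier M = {\<zero>\<^bsub>E\<^esub>} \<longrightarrow> N = {\<zero>\<^bsub>E\<^esub>})"

text \<open>\<open>I\<^sub>M\<close> is uniserial. Injective envelopes are unique up to isomorphism, so it does not matter
  which one is chosen.\<close>

definition uniserial_envelope :: "('a, 'x) ring_scheme \<Rightarrow> ('a, 'm) module \<Rightarrow> bool" where
  "uniserial_envelope A M \<longleftrightarrow>
     (\<exists>(E :: 'a fg_object) i. injective_envelope A M E i \<and> uniserial A E)"


section \<open>Biserial modules\<close>

definition largest_proper_submodule ::
    "('a, 'x) ring_scheme \<Rightarrow> ('a, 'm) module \<Rightarrow> 'm set \<Rightarrow> bool" where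
  "largest_proper_submodule A M N \<longleftrightarrow> submodule N A M \<and> N \<noteq> carrier M \<and>
     (\<forall>N'. submodule N' A M \<and> N' \<noteq> carrier M \<longrightarrow> N' \<subseteq> N)"

definition smallest_nonzero_submodule ::
    "('a, 'x) ring_scheme \<Rightarrow> ('a, 'm) module \<Rightarrow> 'm set \<Rightarrow> bool" where
  "smallest_nonzero_submodule A M N \<longleftrightarrow> submodule N A M \<and> N \<noteq> {\<zero>\<^bsub>M\<^esub>} \<and>
     (\<forall>N'. submodule N' A M \<and> N' \<noteq> {\<zero>\<^bsub>M\<^esub>} \<longrightarrow> N \<subseteq> N')"

definition biserial_module :: "('a, 'x) ring_scheme \<Rightarrow> ('a, 'm) module \<Rightarrow> bool" where
  "biserial_module A M \<longleftrightarrow> indecomposable A M \<and>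
     (\<exists>N N'. submodule N A M \<and> submodule N' A M \<and>
        uniserial A (M\<lparr>carrier := N\<rparr>) \<and> uniserial A (M\<lparr>carrier := N'\<rparr>) \<and>
        \<not> N \<subseteq> N' \<and> \<not> N' \<subseteq> N \<and>
        (N <+>\<^bsub>M\<^esub> N' = carrier M \<or> largest_proper_submodule A M (N <+>\<^bsub>M\<^esub> N')) \<and>
        (N \<inter> N' = {\<zero>\<^bsub>M\<^esub>} \<or> smallest_nonzero_submodule A M (N \<inter> N')))"

definition astride_biserial :: "('a, 'x) ring_scheme \<Rightarrow> ('a, 'm) module \<Rightarrow> bool" where
  "astride_biserial A M \<longleftrightarrow> biserial_module A M \<and> local_module A M \<and> \<not> colocal_module A M"

definition coastride_biserial :: "('a, 'x) ring_scheme \<Rightarrow> ('a, 'm) module \<Rightarrow> bool" where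
  "coastride_biserial A M \<longleftrightarrow> biserial_module A M \<and> colocal_module A M \<and> \<not> local_module A M"

definition diamond_biserial :: "('a, 'x) ring_scheme \<Rightarrow> ('a, 'm) module \<Rightarrow> bool" where
  "diamond_biserial A M \<longleftrightarrow> biserial_module A M \<and> local_module A M \<and> colocal_module A M"

definition lozenge :: "('a, 'x) ring_scheme \<Rightarrow> ('a, 'm) module \<Rightarrow> bool" where
  "lozenge A M \<longleftrightarrow> diamond_biserial A M \<and> has_length A M 4"

definition N_shaped :: "('a, 'x) ring_scheme \<Rightarrow> ('a, 'm) module \<Rightarrow> bool" where
  "N_shaped A M \<longleftrightarrow> indecomposable A M \<and>
     (\<exists>N N'. submodule N A M \<and> submodule N' A M \<and> carrier M = N <+>\<^bsub>M\<^esub> N' \<and>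
        astride_biserial A (M\<lparr>carrier := N\<rparr>) \<and> has_length A (M\<lparr>carrier := N\<rparr>) 3 \<and>
        uniserial A (M\<lparr>carrier := N'\<rparr>) \<and> has_length A (M\<lparr>carrier := N'\<rparr>) 2)"


section \<open>Artin algebras\<close>

definition artinian :: "('r, 'x) ring_scheme \<Rightarrow> bool" where
  "artinian R \<longleftrightarrow> (\<forall>I :: nat \<Rightarrow> 'r set.
     (\<forall>n. ideal (I n) R) \<and> (\<forall>n. I (Suc n) \<subseteq> I n) \<longrightarrow> (\<exists>m. \<forall>n\<ge>m. I n = I m))"

text \<open>The record \<open>A\<close> carries the ring structure and, through \<^const>\<open>smult\<close>, the \<open>R\<close>-action. The
  library locale \<^locale>\<open>algebra\<close> cannot be used, because it requires \<open>A\<close> to be commutative.\<close>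

locale artin_algebra = module R A + ring A
  for R :: "('r, 'x) ring_scheme" (structure) and A :: "('r, 'a, 'y) module_scheme" (structure) +
  assumes artinian_base: "artinian R"
    and smult_mult_left:
      "\<lbrakk>r \<in> carrier R; x \<in> carrier A; y \<in> carrier A\<rbrakk> \<Longrightarrow>
        (r \<odot>\<^bsub>A\<^esub> x) \<otimes>\<^bsub>A\<^esub> y = r \<odot>\<^bsub>A\<^esub> (x \<otimes>\<^bsub>A\<^esub> y)"
    and smult_mult_right:
      "\<lbrakk>r \<in> carrier R; x \<in> carrier A; y \<in> carrier A\<rbrakk> \<Longrightarrow>
        x \<otimes>\<^bsub>A\<^esub> (r \<odot>\<^bsub>A\<^esub> y) = r \<odot>\<^bsub>A\<^esub> (x \<otimes>\<^bsub>A\<^esub> y)"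
    and finitely_generated_base: "finitely_generated R A"

text \<open>Right \<open>A\<close>-modules are treated as left modules over the opposite algebra.\<close>

definition opposite :: "('a, 'x) ring_scheme \<Rightarrow> ('a, 'x) ring_scheme" where
  "opposite A = A\<lparr>mult := (\<lambda>x y. y \<otimes>\<^bsub>A\<^esub> x)\<rparr>"

definition projectives_biserial :: "('a, 'x) ring_scheme \<Rightarrow> bool" where
  "projectives_biserial A \<longleftrightarrow> (\<forall>P :: 'a fg_object.
     projective A P \<and> indecomposable A P \<and> \<not> uniserial A P \<longrightarrow> biserial_module A P)"

definition biserial_algebra :: "('r, 'x) ring_scheme \<Rightarrow> ('r, 'a, 'y) module_scheme \<Rightarrow> bool" where
  "biserial_algebra R A \<longleftrightarrow> artin_algebra R A \<and>
     projectives_biserial A \<and> projectives_biserial (opposite A)"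

definition quadri_condition :: "('a, 'x) ring_scheme \<Rightarrow> ('a, 'm) module \<Rightarrow> bool" where
  "quadri_condition A P \<longleftrightarrow>
     (let Q = P\<lparr>carrier := rad A P\<rparr>; T = top_module A Q in
       (\<exists>n\<le>4. has_length A P n) \<and>
       (\<forall>S S'. internal_direct_sum A T S S' \<and>
          simple_module A (T\<lparr>carrier := S\<rparr>) \<and> simple_module A (T\<lparr>carrier := S'\<rparr>) \<longrightarrow>
          uniserial_envelope A (T\<lparr>carrier := S\<rparr>) \<or> uniserial_envelope A (T\<lparr>carrier := S'\<rparr>)) \<and>
       (\<forall>S U. internal_direct_sum A Q S U \<and>
          simple_module A (Q\<lparr>carrier := S\<rparr>) \<and>
          uniserial A (Q\<lparr>carrier := U\<rparr>) \<and> has_length A (Q\<lparr>carrier := U\<rparr>) 2 \<longrightarrow>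
          uniserial_envelope A (Q\<lparr>carrier := S\<rparr>) \<and>
          uniserial_envelope A (Q\<lparr>carrier := soc A (Q\<lparr>carrier := U\<rparr>)\<rparr>)))"

definition projectives_quadri :: "('a, 'x) ring_scheme \<Rightarrow> bool" where
  "projectives_quadri A \<longleftrightarrow> (\<forall>P :: 'a fg_object.
     projective A P \<and> indecomposable A P \<longrightarrow> quadri_condition A P)"

definition quadri_biserial_algebra ::
    "('r, 'x) ring_scheme \<Rightarrow> ('r, 'a, 'y) module_scheme \<Rightarrow> bool" where
  "quadri_biserial_algebra R A \<longleftrightarrow> biserial_algebra R A \<and>
     projectives_quadri A \<and> projectives_quadri (opposite A)"


section \<open>Consistency of the encodings\<close>

lemma ring_opposite:
  assumes "ring A" shows "ring (opposite A)"
proof -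
  interpret ring A by fact
  show ?thesis
    by (rule ringI)
      (auto simp: opposite_def l_distr r_distr m_assoc a_ac
        intro!: abelian_groupI monoidI add.l_inv_ex)
qed

lemma artin_algebra_opposite:
  assumes "artin_algebra R A" shows "artin_algebra R (opposite A)"
proof -
  interpret artin_algebra R A by fact
  have "module R (opposite A)"
    by (rule moduleI)
      (auto simp: opposite_def smult_l_distr smult_r_distr smult_assoc1 R.cring_axioms
        M.a_ac intro!: abelian_groupI M.add.l_inv_ex)
  moreover have "submodule N R (opposite A) = submodule N R A" for N
    by (simp add: submodule_def submodule_axioms_def opposite_def subgroup_def m_inv_def)
  then have "finitely_generated R (opposite A)"
    using finitely_generated_base
    by (simp add: finitely_generated_def submodule_span_def) (simp add: opposite_def)
  ultimately show ?thesis
    using artinian_base smult_mult_left smult_mult_right ring_opposite[OF ring_axioms]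
    by (intro artin_algebra.intro artin_algebra_axioms.intro) (auto simp: opposite_def)
qed

context left_module
begin

lemma smult_zero_right: "a \<in> carrier A \<Longrightarrow> a \<odot>\<^bsub>M\<^esub> \<zero>\<^bsub>M\<^esub> = \<zero>\<^bsub>M\<^esub>"
  by (metis M.add.r_cancel_one' M.l_zero M.zero_closed smult_closed smult_r_distr)

lemma smult_zero_left: "x \<in> carrier M \<Longrightarrow> \<zero>\<^bsub>A\<^esub> \<odot>\<^bsub>M\<^esub> x = \<zero>\<^bsub>M\<^esub>"
  by (metis A.l_zero A.zero_closed M.add.r_cancel_one' smult_closed smult_l_distr)

lemma smult_minus_one: "x \<in> carrier M \<Longrightarrow> (\<ominus>\<^bsub>A\<^esub> \<one>\<^bsub>A\<^esub>) \<odot>\<^bsub>M\<^esub> x = \<ominus>\<^bsub>M\<^esub> x"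
  by (metis A.a_inv_closed A.l_neg A.one_closed M.minus_equality smult_closed smult_l_distr
      smult_one smult_zero_left)

lemma finsum_smult:
  assumes "finite I" "a \<in> carrier A" "f \<in> I \<rightarrow> carrier M"
  shows "a \<odot>\<^bsub>M\<^esub> (\<Oplus>\<^bsub>M\<^esub>i\<in>I. f i) = (\<Oplus>\<^bsub>M\<^esub>i\<in>I. a \<odot>\<^bsub>M\<^esub> f i)"
  using assms by (induct set: finite) (auto simp: smult_zero_right smult_r_distr Pi_def)

lemma left_submoduleI:
  assumes "N \<subseteq> carrier M" "\<zero>\<^bsub>M\<^esub> \<in> N"
    and "\<And>x y. x \<in> N \<Longrightarrow> y \<in> N \<Longrightarrow> x \<oplus>\<^bsub>M\<^esub> y \<in> N"
    and "\<And>a x. a \<in> carrier A \<Longrightarrow> x \<in> N \<Longrightarrow> a \<odot>\<^bsub>M\<^esub> x \<in> N"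
  shows "submodule N A M"
proof -
  have "\<ominus>\<^bsub>M\<^esub> x \<in> N" if "x \<in> N" for x
    using assms(4)[of "\<ominus>\<^bsub>A\<^esub> \<one>\<^bsub>A\<^esub>" x] that assms(1) smult_minus_one[of x] by auto
  then show ?thesis
    using assms by (auto intro!: submodule.intro subgroup.intro submodule_axioms.intro
        simp: a_inv_def[symmetric])
qed

lemma submodule_closed:
  assumes "submodule N A M"
  shows "N \<subseteq> carrier M" "\<zero>\<^bsub>M\<^esub> \<in> N"
    and "\<And>x y. x \<in> N \<Longrightarrow> y \<in> N \<Longrightarrow> x \<oplus>\<^bsub>M\<^esub> y \<in> N"
    and "\<And>a x. a \<in> carrier A \<Longrightarrow> x \<in> N \<Longrightarrow> a \<odot>\<^bsub>M\<^esub> x \<in> N"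
proof -
  interpret N: submodule N A M by fact
  show "N \<subseteq> carrier M" "\<zero>\<^bsub>M\<^esub> \<in> N"
    and "\<And>x y. x \<in> N \<Longrightarrow> y \<in> N \<Longrightarrow> x \<oplus>\<^bsub>M\<^esub> y \<in> N"
    and "\<And>a x. a \<in> carrier A \<Longrightarrow> x \<in> N \<Longrightarrow> a \<odot>\<^bsub>M\<^esub> x \<in> N"
    using N.subset N.one_closed N.m_closed N.smult_closed by auto
qed

lemma ex_inj_into_coefficients:
  assumes "finitely_generated A M"
  shows "\<exists>\<phi> :: 'c \<Rightarrow> (nat \<Rightarrow> 'a) set. inj_on \<phi> (carrier M)"
proof -
  obtain X where X: "finite X" "X \<subseteq> carrier M" "submodule_span A M X = carrier M"
    using assms by (auto simp: finitely_generated_def)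
  obtain n and g :: "nat \<Rightarrow> 'c" where g: "X = g ` {i. i < n}"
    using X(1) by (metis finite_imp_nat_seg_image_inj_on)
  let ?I = "{i. i < n}"
  define \<sigma> where "\<sigma> c = (\<Oplus>\<^bsub>M\<^esub>i\<in>?I. c i \<odot>\<^bsub>M\<^esub> g i)" for c
  let ?C = "?I \<rightarrow> carrier A"
  have gM: "g i \<in> carrier M" if "i < n" for i
    using that X(2) g by auto
  have "submodule (\<sigma> ` ?C) A M"
  proof (rule left_submoduleI)
    show "\<sigma> ` ?C \<subseteq> carrier M"
      using gM by (auto simp: \<sigma>_def intro!: M.finsum_closed)
    have "\<sigma> (\<lambda>_. \<zero>\<^bsub>A\<^esub>) = \<zero>\<^bsub>M\<^esub>"
      unfolding \<sigma>_def by (rule M.add.finprod_one_eqI) (auto simp: smult_zero_left gM)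
    then show "\<zero>\<^bsub>M\<^esub> \<in> \<sigma> ` ?C"
      by (metis (no_types, lifting) A.zero_closed Pi_I image_eqI)
  next
    fix x y assume "x \<in> \<sigma> ` ?C" "y \<in> \<sigma> ` ?C"
    then obtain c d where c: "c \<in> ?C" "x = \<sigma> c" and d: "d \<in> ?C" "y = \<sigma> d" by auto
    have "x \<oplus>\<^bsub>M\<^esub> y = (\<Oplus>\<^bsub>M\<^esub>i\<in>?I. c i \<odot>\<^bsub>M\<^esub> g i \<oplus>\<^bsub>M\<^esub> d i \<odot>\<^bsub>M\<^esub> g i)"
      unfolding c d \<sigma>_def using c(1) d(1) gM by (subst M.finsum_addf) auto
    also have "\<dots> = \<sigma> (\<lambda>i. c i \<oplus>\<^bsub>A\<^esub> d i)"
      unfolding \<sigma>_def using c(1) d(1) gM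
      by (intro M.finsum_cong') (auto simp: smult_l_distr Pi_def)
    finally show "x \<oplus>\<^bsub>M\<^esub> y \<in> \<sigma> ` ?C"
      using c(1) d(1) by auto
  next
    fix a x assume a: "a \<in> carrier A" and "x \<in> \<sigma> ` ?C"
    then obtain c where c: "c \<in> ?C" "x = \<sigma> c" by auto
    have "a \<odot>\<^bsub>M\<^esub> x = (\<Oplus>\<^bsub>M\<^esub>i\<in>?I. a \<odot>\<^bsub>M\<^esub> (c i \<odot>\<^bsub>M\<^esub> g i))"
      unfolding c \<sigma>_def using a c(1) gM by (subst finsum_smult) auto
    also have "\<dots> = \<sigma> (\<lambda>i. a \<otimes>\<^bsub>A\<^esub> c i)"
      unfolding \<sigma>_def using a c(1) gM
      by (intro M.finsum_cong') (auto simp: smult_assoc1 Pi_def)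
    finally show "a \<odot>\<^bsub>M\<^esub> x \<in> \<sigma> ` ?C"
      using a c(1) by auto
  qed
  moreover have "X \<subseteq> \<sigma> ` ?C"
  proof
    fix x assume "x \<in> X"
    then obtain j where j: "j < n" "x = g j" using g by auto
    define c where "c = (\<lambda>i. if j = i then \<one>\<^bsub>A\<^esub> else \<zero>\<^bsub>A\<^esub>)"
    have "\<sigma> c = (\<Oplus>\<^bsub>M\<^esub>i\<in>?I. if j = i then g i else \<zero>\<^bsub>M\<^esub>)"
      unfolding \<sigma>_def c_def using gM by (intro M.finsum_cong') (auto simp: smult_zero_left)
    also have "\<dots> = g j"
      using j gM by (intro M.finsum_singleton) auto
    finally show "x \<in> \<sigma> ` ?C"
      using j by (auto simp: c_def intro!: image_eqI[of _ _ c])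
  qed
  ultimately have sub: "carrier M \<subseteq> \<sigma> ` ?C"
    using X(3) unfolding submodule_span_def by blast
  have "inj_on (\<lambda>x. {c \<in> ?C. \<sigma> c = x}) (carrier M)"
    by (rule inj_onI) (use sub in blast)
  then show ?thesis by blast
qed

lemma ex_transported_module:
  fixes \<phi> :: "'c \<Rightarrow> 'u"
  assumes inj: "inj_on \<phi> (carrier M)" and fg: "finitely_generated A M"
  shows "\<exists>N :: ('a, 'u) module. fg_module A N \<and>
    \<phi> \<in> carrier M \<rightarrow> carrier N \<and> bij_betw \<phi> (carrier M) (carrier N) \<and>
    (\<forall>x\<in>carrier M. \<forall>y\<in>carrier M. \<phi> (x \<oplus>\<^bsub>M\<^esub> y) = \<phi> x \<oplus>\<^bsub>N\<^esub> \<phi> y) \<and>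
    (\<forall>a\<in>carrier A. \<forall>x\<in>carrier M. \<phi> (a \<odot>\<^bsub>M\<^esub> x) = a \<odot>\<^bsub>N\<^esub> \<phi> x)"
proof -
  define \<psi> where "\<psi> = inv_into (carrier M) \<phi>"
  have \<psi>: "\<psi> (\<phi> x) = x" if "x \<in> carrier M" for x
    using that inj by (simp add: \<psi>_def)
  define N :: "('a, 'u) module" where
    "N = \<lparr>carrier = \<phi> ` carrier M, mult = (\<lambda>_ _. \<phi> \<zero>\<^bsub>M\<^esub>), one = \<phi> \<zero>\<^bsub>M\<^esub>, zero = \<phi> \<zero>\<^bsub>M\<^esub>,
      add = (\<lambda>u v. \<phi> (\<psi> u \<oplus>\<^bsub>M\<^esub> \<psi> v)), smult = (\<lambda>a u. \<phi> (a \<odot>\<^bsub>M\<^esub> \<psi> u))\<rparr>"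
  have carr: "carrier N = \<phi> ` carrier M" and zero: "\<zero>\<^bsub>N\<^esub> = \<phi> \<zero>\<^bsub>M\<^esub>"
    by (simp_all add: N_def)
  have add: "\<phi> x \<oplus>\<^bsub>N\<^esub> \<phi> y = \<phi> (x \<oplus>\<^bsub>M\<^esub> y)" if "x \<in> carrier M" "y \<in> carrier M" for x y
    using that by (simp add: N_def \<psi>)
  have smul: "a \<odot>\<^bsub>N\<^esub> \<phi> x = \<phi> (a \<odot>\<^bsub>M\<^esub> x)" if "x \<in> carrier M" for a x
    using that by (simp add: N_def \<psi>)
  have "abelian_group N"
  proof (rule abelian_groupI)
    fix u assume "u \<in> carrier N"
    then obtain x where x: "x \<in> carrier M" "u = \<phi> x" by (auto simp: carr)
    then have "\<phi> (\<ominus>\<^bsub>M\<^esub> x) \<oplus>\<^bsub>N\<^esub> u = \<zero>\<^bsub>N\<^esub>"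
      by (simp add: add zero M.l_neg)
    then show "\<exists>v\<in>carrier N. v \<oplus>\<^bsub>N\<^esub> u = \<zero>\<^bsub>N\<^esub>"
      using x by (auto simp: carr)
  qed (auto simp: carr add zero M.a_ac)
  then have lm: "left_module A N"
    by (intro left_module.intro left_module_axioms.intro A.ring_axioms)
      (auto simp: carr add smul smult_l_distr smult_r_distr smult_assoc1)
  interpret N: left_module A N by (rule lm)
  obtain X where X: "finite X" "X \<subseteq> carrier M" "submodule_span A M X = carrier M"
    using fg by (auto simp: finitely_generated_def)
  have "carrier N \<subseteq> L" if L: "submodule L A N" "\<phi> ` X \<subseteq> L" for L
  proof -
    note cl = N.submodule_closed[OF L(1)]
    have "submodule {x \<in> carrier M. \<phi> x \<in> L} A M"
      by (rule left_submoduleI)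
        (use cl in \<open>auto simp: zero[symmetric] add[symmetric] smul[symmetric]\<close>)
    moreover have "X \<subseteq> {x \<in> carrier M. \<phi> x \<in> L}" using X L by auto
    ultimately have "carrier M \<subseteq> {x \<in> carrier M. \<phi> x \<in> L}"
      using X(3) unfolding submodule_span_def by blast
    then show ?thesis by (auto simp: carr)
  qed
  moreover have "submodule (carrier N) A N"
    by (rule N.left_submoduleI) auto
  moreover have "\<phi> ` X \<subseteq> carrier N"
    using X(2) by (auto simp: carr)
  ultimately have "submodule_span A N (\<phi> ` X) = carrier N"
    unfolding submodule_span_def by blast
  then have "finitely_generated A N"
    using X unfolding finitely_generated_def
    by (intro exI[of _ "\<phi> ` X"]) (auto simp: carr)
  then show ?thesis
    using lm inj by (intro exI[of _ N]) (auto simp: fg_module_def carr add smul bij_betw_def)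
qed

end

lemma left_module_quot_module:
  fixes A :: "('a, 'x) ring_scheme" and M :: "('a, 'm) module"
  assumes "left_module A M" and N: "submodule N A M"
  shows "left_module A (quot_module M N)"
proof -
  interpret left_module A M by fact
  note cl = submodule_closed[OF N]
  interpret N: abelian_subgroup N M
    using N by (intro abelian_subgroupI3 M.abelian_group_axioms additive_subgroupI)
      (auto simp: submodule_def)
  let ?q = "\<lambda>x. N +>\<^bsub>M\<^esub> x"
  let ?Q = "quot_module M N"
  have carr: "carrier ?Q = ?q ` carrier M" and zero: "\<zero>\<^bsub>?Q\<^esub> = ?q \<zero>\<^bsub>M\<^esub>"
    using cl(1) by (auto simp: quot_module_def A_RCOSETS_def')
  have add: "?q x \<oplus>\<^bsub>?Q\<^esub> ?q y = ?q (x \<oplus>\<^bsub>M\<^esub> y)" if "x \<in> carrier M" "y \<in> carrier M" for x y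
    using that by (simp add: quot_module_def N.a_rcos_sum)
  have smul: "a \<odot>\<^bsub>?Q\<^esub> ?q x = ?q (a \<odot>\<^bsub>M\<^esub> x)" if a: "a \<in> carrier A" and x: "x \<in> carrier M" for a x
  proof -
    have "?q (a \<odot>\<^bsub>M\<^esub> y) = ?q (a \<odot>\<^bsub>M\<^esub> x)" if y: "y \<in> ?q x" for y
    proof -
      obtain n where n: "n \<in> N" "y = n \<oplus>\<^bsub>M\<^esub> x"
        using y unfolding a_r_coset_defs by auto
      then have nM: "n \<in> carrier M" using cl(1) by auto
      have "a \<odot>\<^bsub>M\<^esub> y = a \<odot>\<^bsub>M\<^esub> n \<oplus>\<^bsub>M\<^esub> a \<odot>\<^bsub>M\<^esub> x"
        using n nM a x by (simp add: smult_r_distr)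
      then have "a \<odot>\<^bsub>M\<^esub> y \<in> ?q (a \<odot>\<^bsub>M\<^esub> x)"
        using cl(4)[OF a n(1)] unfolding a_r_coset_defs by auto
      then show ?thesis
        using N.a_repr_independence'[of "a \<odot>\<^bsub>M\<^esub> y" "a \<odot>\<^bsub>M\<^esub> x"] a x by simp
    qed
    moreover have "x \<in> ?q x"
      using cl(2) x unfolding a_r_coset_defs by (auto intro!: bexI[of _ "\<zero>\<^bsub>M\<^esub>"])
    ultimately have "(\<Union>y\<in>?q x. ?q (a \<odot>\<^bsub>M\<^esub> y)) = ?q (a \<odot>\<^bsub>M\<^esub> x)"
      by blast
    then show ?thesis
      by (simp add: quot_module_def)
  qed
  have "abelian_group ?Q"
  proof (rule abelian_groupI)
    fix u assume "u \<in> carrier ?Q"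
    then obtain x where x: "x \<in> carrier M" "u = ?q x" by (auto simp: carr)
    then have "?q (\<ominus>\<^bsub>M\<^esub> x) \<oplus>\<^bsub>?Q\<^esub> u = \<zero>\<^bsub>?Q\<^esub>"
      by (simp add: add zero M.l_neg)
    then show "\<exists>v\<in>carrier ?Q. v \<oplus>\<^bsub>?Q\<^esub> u = \<zero>\<^bsub>?Q\<^esub>"
      using x by (auto simp: carr)
  qed (auto simp: carr add zero M.a_ac)
  then show ?thesis
    by (intro left_module.intro left_module_axioms.intro A.ring_axioms)
      (auto simp: carr add smul smult_l_distr smult_r_distr smult_assoc1)
qed

lemma ex_isomorphic_fg_object:
  fixes A :: "('a, 'x) ring_scheme" and M :: "('a, 'm) module"
  assumes "fg_module A M"
  shows "\<exists>(N :: 'a fg_object) f. fg_module A N \<and> f \<in> module_iso A M N"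
proof -
  interpret left_module A M using assms by (simp add: fg_module_def)
  have fg: "finitely_generated A M" using assms by (simp add: fg_module_def)
  obtain \<phi> :: "'m \<Rightarrow> (nat \<Rightarrow> 'a) set" where "inj_on \<phi> (carrier M)"
    using ex_inj_into_coefficients[OF fg] by blast
  from ex_transported_module[OF this fg] show ?thesis
    unfolding module_iso_def module_hom_def mem_Collect_eq by metis
qed

end

theory Submission
  imports Defs
begin

text \<open>If \<open>M\<close> is local, it is a quotient of an indecomposable projective module, whose length is at most
  four, so \<open>M\<close> is itself projective. If \<open>M\<close> is colocal with socle \<open>S\<close>, choose a primitive idempotent \<open>e\<close>
  with \<open>e S \<noteq> 0\<close>. The pairing \<open>eA \<times> M \<rightarrow> M\<close>, read modulo a maximal \<open>R\<close>-submodule \<open>Z\<close> that avoids a given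
  element of \<open>e S\<close>, replaces the duality of an artin algebra: it makes the submodule lattice of \<open>M\<close>
  anti-isomorphic to an interval of submodules of the right module \<open>eA\<close>. Hence every colocal module has
  length at most four, \<open>M\<close> is injective, and it is biserial because \<open>eA\<close> is. If \<open>M\<close> is neither local
  nor colocal, its radical and its socle coincide and are a sum of two simple modules, and \<open>M\<close> has a
  local submodule \<open>L\<close> of length three. By condition (b) one of the simple summands has a uniserial
  injective envelope \<open>E\<close>; extending the projection of the socle onto this summand to \<open>M \<rightarrow> E\<close>, the kernel is
  uniserial of length two and completes \<open>L\<close> to \<open>M\<close>.\<close>

section \<open>Submodules\<close>

text \<open>A module of length four is local or not and colocal or not, and the four combinations
  turn out to be the four cases; so exclusiveness needs no separate argument. The obstacle is the
  colocal half: it speaks about injective modules, while the assumptions on \<open>A\<close> bound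
  projective ones. The classical bridge is the functor Hom into the injective envelope of
  \<open>R\<close> modulo its radical. Here only the submodules of one module at a time have to be
  turned upside down, so no dual module is built: perpendiculars for a pairing of eA with that
  module suffice, and the module itself, modulo \<open>Z\<close>, is the target of the pairing. The
  number four then acts as a counting bound: a module of length four leaves no room for a kernel in
  Ae, nor for a fifth step in a chain dual to one in eA. A further obstacle is that
  \<open>projective\<close> and \<open>injective\<close> test modules with elements in one fixed
  type, whereas \<open>M\<close> has an arbitrary one, so maps have to be carried to isomorphic
  copies.\<close>

context left_module
begin

lemma submodule_minus:
  assumes "submodule N A M" "x \<in> N" "y \<in> N"
  shows "x \<ominus>\<^bsub>M\<^esub> y \<in> N"
proof -
  note cl = submodule_closed[OF assms(1)]
  have "\<ominus>\<^bsub>M\<^esub> y \<in> N"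
    using cl(4)[of "\<ominus>\<^bsub>A\<^esub> \<one>\<^bsub>A\<^esub>" y] assms(3) cl(1) smult_minus_one[of y] by auto
  then show ?thesis using cl(3) assms(2) by (simp add: a_minus_def)
qed

lemma minus_add_cancel: "x \<in> carrier M \<Longrightarrow> y \<in> carrier M \<Longrightarrow> (x \<ominus>\<^bsub>M\<^esub> y) \<oplus>\<^bsub>M\<^esub> y = x"
  by (simp add: a_minus_def M.a_assoc M.l_neg)

lemma add_minus_cancel: "x \<in> carrier M \<Longrightarrow> y \<in> carrier M \<Longrightarrow> y \<oplus>\<^bsub>M\<^esub> (x \<ominus>\<^bsub>M\<^esub> y) = x"
  using minus_add_cancel by (simp add: M.a_comm)

lemma add_diff_cancel: "x \<in> carrier M \<Longrightarrow> y \<in> carrier M \<Longrightarrow> (x \<oplus>\<^bsub>M\<^esub> y) \<ominus>\<^bsub>M\<^esub> y = x"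
  by (simp add: a_minus_def M.a_assoc M.r_neg)

lemma minus_zero: "x \<in> carrier M \<Longrightarrow> x \<ominus>\<^bsub>M\<^esub> \<zero>\<^bsub>M\<^esub> = x"
  by (metis M.r_zero M.zero_closed add_diff_cancel)

lemma smult_minus_right:
  "a \<in> carrier A \<Longrightarrow> x \<in> carrier M \<Longrightarrow> y \<in> carrier M \<Longrightarrow>
    a \<odot>\<^bsub>M\<^esub> (x \<ominus>\<^bsub>M\<^esub> y) = a \<odot>\<^bsub>M\<^esub> x \<ominus>\<^bsub>M\<^esub> a \<odot>\<^bsub>M\<^esub> y"
  by (metis M.minus_closed add_diff_cancel minus_add_cancel smult_closed smult_r_distr)

lemma minus_minus_self: "x \<in> carrier M \<Longrightarrow> y \<in> carrier M \<Longrightarrow> x \<ominus>\<^bsub>M\<^esub> (x \<ominus>\<^bsub>M\<^esub> y) = y"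
  by (metis M.minus_closed add_diff_cancel add_minus_cancel)

lemma minus_eq_zero_iff: "x \<in> carrier M \<Longrightarrow> y \<in> carrier M \<Longrightarrow> x \<ominus>\<^bsub>M\<^esub> y = \<zero>\<^bsub>M\<^esub> \<longleftrightarrow> x = y"
  by (metis M.l_zero M.r_neg a_minus_def minus_add_cancel)

lemma submodule_mem_cancel:
  assumes "submodule N A M" "x \<in> carrier M" "y \<in> N" "x \<ominus>\<^bsub>M\<^esub> y \<in> N"
  shows "x \<in> N"
  using submodule_closed[OF assms(1)] assms minus_add_cancel[of x y] by (metis subsetD)

lemma left_module_submodule:
  assumes "submodule N A M"
  shows "left_module A (M\<lparr>carrier := N\<rparr>)"
proof -
  note cl = submodule_closed[OF assms]
  have "abelian_group (M\<lparr>carrier := N\<rparr>)"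
  proof (rule abelian_groupI; simp)
    fix x assume x: "x \<in> N"
    have "\<zero>\<^bsub>M\<^esub> \<ominus>\<^bsub>M\<^esub> x \<in> N" using submodule_minus[OF assms] cl(2) x by simp
    then show "\<exists>y\<in>N. y \<oplus>\<^bsub>M\<^esub> x = \<zero>\<^bsub>M\<^esub>" using x cl(1) minus_add_cancel by blast
  qed (use cl in \<open>auto intro: M.a_assoc M.a_comm simp: subset_iff\<close>)
  then show ?thesis
    using cl by (intro left_module.intro left_module_axioms.intro A.ring_axioms)
      (auto simp: smult_l_distr smult_r_distr smult_assoc1 subset_iff)
qed

text \<open>Lets every later argument about a submodule \<open>N\<close>, as a module in its own
  right, take place in the lattice of submodules of \<open>M\<close>.\<close>

lemma submodule_restrict_iff:
  assumes "submodule N A M"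
  shows "submodule X A (M\<lparr>carrier := N\<rparr>) \<longleftrightarrow> submodule X A M \<and> X \<subseteq> N"
proof
  interpret N: left_module A "M\<lparr>carrier := N\<rparr>" by (rule left_module_submodule[OF assms])
  assume X: "submodule X A (M\<lparr>carrier := N\<rparr>)"
  show "submodule X A M \<and> X \<subseteq> N"
    using N.submodule_closed[OF X] submodule_closed[OF assms]
    by (auto intro!: left_submoduleI)
next
  interpret N: left_module A "M\<lparr>carrier := N\<rparr>" by (rule left_module_submodule[OF assms])
  assume X: "submodule X A M \<and> X \<subseteq> N"
  then show "submodule X A (M\<lparr>carrier := N\<rparr>)"
    using submodule_closed[of X] by (auto intro!: N.left_submoduleI)
qed

lemma submodule_carrier [simp]: "submodule (carrier M) A M"
  by (rule left_submoduleI) auto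

lemma submodule_zero [simp]: "submodule {\<zero>\<^bsub>M\<^esub>} A M"
  by (rule left_submoduleI) (auto simp: smult_zero_right)

lemma submodule_Int: "submodule X A M \<Longrightarrow> submodule Y A M \<Longrightarrow> submodule (X \<inter> Y) A M"
  by (rule left_submoduleI) (auto dest: submodule_closed)

lemma submodule_Inter:
  assumes "\<And>X. X \<in> F \<Longrightarrow> submodule X A M"
  shows "submodule (carrier M \<inter> \<Inter>F) A M"
proof (rule left_submoduleI)
  fix x y assume "x \<in> carrier M \<inter> \<Inter>F" "y \<in> carrier M \<inter> \<Inter>F"
  then show "x \<oplus>\<^bsub>M\<^esub> y \<in> carrier M \<inter> \<Inter>F" using submodule_closed(3)[OF assms] by auto
next
  fix a x assume "a \<in> carrier A" "x \<in> carrier M \<inter> \<Inter>F"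
  then show "a \<odot>\<^bsub>M\<^esub> x \<in> carrier M \<inter> \<Inter>F" using submodule_closed(4)[OF assms] by auto
qed (use submodule_closed(2)[OF assms] in auto)

lemma mem_set_add: "z \<in> X <+>\<^bsub>M\<^esub> Y \<longleftrightarrow> (\<exists>x\<in>X. \<exists>y\<in>Y. z = x \<oplus>\<^bsub>M\<^esub> y)"
  by (simp add: set_add_def')

lemma submodule_set_add:
  assumes X: "submodule X A M" and Y: "submodule Y A M"
  shows "submodule (X <+>\<^bsub>M\<^esub> Y) A M"
proof (rule left_submoduleI)
  note clX = submodule_closed[OF X] and clY = submodule_closed[OF Y]
  show "X <+>\<^bsub>M\<^esub> Y \<subseteq> carrier M" using clX(1) clY(1) by (auto simp: mem_set_add subset_iff)
  show "\<zero>\<^bsub>M\<^esub> \<in> X <+>\<^bsub>M\<^esub> Y" unfolding mem_set_add using clX(2) clY(2) by (metis M.l_zero M.zero_closed)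
  fix u v assume "u \<in> X <+>\<^bsub>M\<^esub> Y" "v \<in> X <+>\<^bsub>M\<^esub> Y"
  then obtain x y x' y' where *: "x \<in> X" "y \<in> Y" "u = x \<oplus>\<^bsub>M\<^esub> y" "x' \<in> X" "y' \<in> Y" "v = x' \<oplus>\<^bsub>M\<^esub> y'"
    by (auto simp: mem_set_add)
  then have "u \<oplus>\<^bsub>M\<^esub> v = (x \<oplus>\<^bsub>M\<^esub> x') \<oplus>\<^bsub>M\<^esub> (y \<oplus>\<^bsub>M\<^esub> y')"
    using clX(1) clY(1) by (simp add: M.a_ac subset_iff)
  then show "u \<oplus>\<^bsub>M\<^esub> v \<in> X <+>\<^bsub>M\<^esub> Y" unfolding mem_set_add using * clX(3) clY(3) by blast
next
  note clX = submodule_closed[OF X] and clY = submodule_closed[OF Y]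
  fix a u assume "a \<in> carrier A" "u \<in> X <+>\<^bsub>M\<^esub> Y"
  then obtain x y where *: "a \<in> carrier A" "x \<in> X" "y \<in> Y" "u = x \<oplus>\<^bsub>M\<^esub> y" by (auto simp: mem_set_add)
  then have "a \<odot>\<^bsub>M\<^esub> u = a \<odot>\<^bsub>M\<^esub> x \<oplus>\<^bsub>M\<^esub> a \<odot>\<^bsub>M\<^esub> y"
    using clX(1) clY(1) by (simp add: smult_r_distr subset_iff)
  then show "a \<odot>\<^bsub>M\<^esub> u \<in> X <+>\<^bsub>M\<^esub> Y" unfolding mem_set_add
    using clX(4)[OF *(1,2)] clY(4)[OF *(1,3)] by blast
qed

lemma set_add_upper:
  assumes "submodule X A M" "submodule Y A M"
  shows "X \<subseteq> X <+>\<^bsub>M\<^esub> Y" "Y \<subseteq> X <+>\<^bsub>M\<^esub> Y"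
proof -
  note clX = submodule_closed[OF assms(1)] and clY = submodule_closed[OF assms(2)]
  show "X \<subseteq> X <+>\<^bsub>M\<^esub> Y"
  proof
    fix x assume "x \<in> X"
    moreover from this have "x = x \<oplus>\<^bsub>M\<^esub> \<zero>\<^bsub>M\<^esub>" using clX(1) by auto
    ultimately show "x \<in> X <+>\<^bsub>M\<^esub> Y" unfolding mem_set_add using clY(2) by blast
  qed
  show "Y \<subseteq> X <+>\<^bsub>M\<^esub> Y"
  proof
    fix y assume "y \<in> Y"
    moreover from this have "y = \<zero>\<^bsub>M\<^esub> \<oplus>\<^bsub>M\<^esub> y" using clY(1) by auto
    ultimately show "y \<in> X <+>\<^bsub>M\<^esub> Y" unfolding mem_set_add using clX(2) by blast
  qed
qed

lemma set_add_least:
  assumes "submodule Z A M" "X \<subseteq> Z" "Y \<subseteq> Z"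
  shows "X <+>\<^bsub>M\<^esub> Y \<subseteq> Z"
proof
  fix z assume "z \<in> X <+>\<^bsub>M\<^esub> Y"
  then obtain x y where "x \<in> Z" "y \<in> Z" "z = x \<oplus>\<^bsub>M\<^esub> y" using assms(2,3) by (auto simp: mem_set_add)
  then show "z \<in> Z" using submodule_closed(3)[OF assms(1)] by simp
qed

lemma set_add_commute:
  assumes "submodule X A M" "submodule Y A M"
  shows "X <+>\<^bsub>M\<^esub> Y = Y <+>\<^bsub>M\<^esub> X"
  using set_add_upper[OF assms] set_add_upper[OF assms(2,1)] submodule_set_add[OF assms]
    submodule_set_add[OF assms(2,1)] by (intro subset_antisym set_add_least)

text \<open>Dedekind's law: if \<open>z = x + y\<close> with \<open>z\<close> in \<open>Z\<close>
  and \<open>x\<close> in \<open>X \<subseteq> Z\<close>, then \<open>y = z - x\<close> lies in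
  \<open>Z\<close> as well.\<close>

lemma modular_law:
  assumes "submodule X A M" "submodule Y A M" "submodule Z A M" "X \<subseteq> Z"
  shows "Z \<inter> (X <+>\<^bsub>M\<^esub> Y) = X <+>\<^bsub>M\<^esub> (Z \<inter> Y)"
proof
  note cl = submodule_closed(1)[OF assms(1)] submodule_closed(1)[OF assms(2)]
  show "Z \<inter> (X <+>\<^bsub>M\<^esub> Y) \<subseteq> X <+>\<^bsub>M\<^esub> (Z \<inter> Y)"
  proof
    fix z assume "z \<in> Z \<inter> (X <+>\<^bsub>M\<^esub> Y)"
    then obtain x y where *: "z \<in> Z" "x \<in> X" "y \<in> Y" "z = x \<oplus>\<^bsub>M\<^esub> y" by (auto simp: mem_set_add)
    then have "x \<in> carrier M" "y \<in> carrier M" "x \<in> Z"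
      using cl assms(4) by auto
    moreover from this have "y \<oplus>\<^bsub>M\<^esub> x \<in> Z" using * by (simp add: M.a_comm)
    ultimately have "y \<in> Z" using submodule_minus[OF assms(3), of "y \<oplus>\<^bsub>M\<^esub> x" x] by (simp add: add_diff_cancel)
    then show "z \<in> X <+>\<^bsub>M\<^esub> (Z \<inter> Y)" using * by (auto simp: mem_set_add)
  qed
  show "X <+>\<^bsub>M\<^esub> (Z \<inter> Y) \<subseteq> Z \<inter> (X <+>\<^bsub>M\<^esub> Y)"
  proof -
    note ZY = submodule_Int[OF assms(3,2)]
    have "X <+>\<^bsub>M\<^esub> (Z \<inter> Y) \<subseteq> Z" using assms by (intro set_add_least) auto
    moreover have "X <+>\<^bsub>M\<^esub> (Z \<inter> Y) \<subseteq> X <+>\<^bsub>M\<^esub> Y"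
      using set_add_upper[OF assms(1,2)] assms by (intro set_add_least submodule_set_add) auto
    ultimately show ?thesis by simp
  qed
qed

lemma submodule_Union_chain:
  assumes "\<C> \<noteq> {}" "\<And>X. X \<in> \<C> \<Longrightarrow> submodule X A M"
    and "\<And>X Y. X \<in> \<C> \<Longrightarrow> Y \<in> \<C> \<Longrightarrow> X \<subseteq> Y \<or> Y \<subseteq> X"
  shows "submodule (\<Union>\<C>) A M"
proof (rule left_submoduleI)
  fix x y assume "x \<in> \<Union>\<C>" "y \<in> \<Union>\<C>"
  then obtain X where "X \<in> \<C>" "x \<in> X" "y \<in> X" using assms(3) by blast
  then show "x \<oplus>\<^bsub>M\<^esub> y \<in> \<Union>\<C>" using submodule_closed(3)[OF assms(2)] by blast
next
  fix a x assume "a \<in> carrier A" "x \<in> \<Union>\<C>"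
  then show "a \<odot>\<^bsub>M\<^esub> x \<in> \<Union>\<C>" using submodule_closed(4)[OF assms(2)] by blast
qed (use assms submodule_closed[OF assms(2)] in blast)+

text \<open>Zorn's lemma, applicable because the union of a chain avoids \<open>t\<close> as well.
  Every nonzero submodule of the quotient by \<open>K\<close> contains the image of
  \<open>t\<close>, so this quotient has a smallest nonzero submodule: colocal quotients of
  arbitrary modules arise in this way.\<close>

lemma ex_maximal_avoiding:
  assumes "submodule G A M" "t \<notin> G"
  shows "\<exists>K. submodule K A M \<and> G \<subseteq> K \<and> t \<notin> K \<and>
    (\<forall>X. submodule X A M \<and> K \<subset> X \<longrightarrow> t \<in> X)"
proof -
  let ?F = "{X. submodule X A M \<and> G \<subseteq> X \<and> t \<notin> X}"
  have "\<exists>K\<in>?F. \<forall>X\<in>?F. K \<subseteq> X \<longrightarrow> X = K"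
  proof (rule subset_Zorn_nonempty)
    show "?F \<noteq> {}" using assms by blast
    fix \<C> assume "\<C> \<noteq> {}" and ch: "subset.chain ?F \<C>"
    moreover have "\<And>X. X \<in> \<C> \<Longrightarrow> X \<in> ?F" "\<And>X Y. X \<in> \<C> \<Longrightarrow> Y \<in> \<C> \<Longrightarrow> X \<subseteq> Y \<or> Y \<subseteq> X"
      using ch by (auto simp: subset_chain_def)
    ultimately have "submodule (\<Union>\<C>) A M" "G \<subseteq> \<Union>\<C>" "t \<notin> \<Union>\<C>"
      using submodule_Union_chain[of \<C>] by (simp_all, blast+)
    then show "\<Union>\<C> \<in> ?F" by simp
  qed
  then obtain K where "K \<in> ?F" and K: "\<forall>X\<in>?F. K \<subseteq> X \<longrightarrow> X = K" by (elim bexE)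
  moreover have "t \<in> X" if "submodule X A M" "K \<subset> X" for X
    using K \<open>K \<in> ?F\<close> that by auto
  ultimately show ?thesis by (intro exI[of _ K]) auto
qed

definition cyclic :: "'c \<Rightarrow> 'c set" where
  "cyclic x = (\<lambda>a. a \<odot>\<^bsub>M\<^esub> x) ` carrier A"

lemma submodule_cyclic:
  assumes "x \<in> carrier M"
  shows "submodule (cyclic x) A M"
proof (rule left_submoduleI)
  show "\<zero>\<^bsub>M\<^esub> \<in> cyclic x" unfolding cyclic_def using smult_zero_left[OF assms] by (metis A.zero_closed image_eqI)
  fix u v assume "u \<in> cyclic x" "v \<in> cyclic x"
  then obtain a b where "a \<in> carrier A" "b \<in> carrier A" "u = a \<odot>\<^bsub>M\<^esub> x" "v = b \<odot>\<^bsub>M\<^esub> x"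
    unfolding cyclic_def by blast
  then show "u \<oplus>\<^bsub>M\<^esub> v \<in> cyclic x" unfolding cyclic_def
    by (metis A.add.m_closed assms image_eqI smult_l_distr)
next
  fix a u assume "a \<in> carrier A" "u \<in> cyclic x"
  then obtain b where "b \<in> carrier A" "u = b \<odot>\<^bsub>M\<^esub> x" unfolding cyclic_def by blast
  then show "a \<odot>\<^bsub>M\<^esub> u \<in> cyclic x" unfolding cyclic_def
    by (metis A.m_closed \<open>a \<in> carrier A\<close> assms image_eqI smult_assoc1)
next
  show "cyclic x \<subseteq> carrier M" using assms unfolding cyclic_def by blast
qed

lemma mem_cyclic: "x \<in> carrier M \<Longrightarrow> x \<in> cyclic x"
  unfolding cyclic_def using A.one_closed by (intro image_eqI[of _ _ "\<one>\<^bsub>A\<^esub>"]) auto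

lemma cyclic_subset: "submodule N A M \<Longrightarrow> x \<in> N \<Longrightarrow> cyclic x \<subseteq> N"
  unfolding cyclic_def by (auto dest: submodule_closed(4))

end

section \<open>Covers, lengths and heights\<close>

text \<open>Encodes that \<open>N'/N\<close> is simple, but by subsets of one carrier: chains of
  covers can then be compared, intersected and pulled back without forming quotients.\<close>

definition covers :: "('a, 'x) ring_scheme \<Rightarrow> ('a, 'm, 'y) module_scheme \<Rightarrow> 'm set \<Rightarrow> 'm set \<Rightarrow> bool" where
  "covers A M N N' \<longleftrightarrow> submodule N A M \<and> submodule N' A M \<and> N \<subset> N' \<and>
     (\<forall>Z. submodule Z A M \<and> N \<subseteq> Z \<and> Z \<subseteq> N' \<longrightarrow> Z = N \<or> Z = N')"

lemma (in left_module) covers_restrict: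
  assumes "submodule Q A M"
  shows "covers A (M\<lparr>carrier := Q\<rparr>) N N' \<longleftrightarrow> covers A M N N' \<and> N' \<subseteq> Q"
  unfolding covers_def submodule_restrict_iff[OF assms] by blast

text \<open>The sum of \<open>N\<close> and \<open>X \<inter> N'\<close> lies between
  \<open>N\<close> and \<open>N'\<close>, and \<open>x\<close> keeps it away from
  \<open>N\<close>.\<close>

lemma (in left_module) covers_split:
  assumes "covers A M N N'" "submodule X A M" "x \<in> X \<inter> N'" "x \<notin> N"
  shows "N' = N <+>\<^bsub>M\<^esub> (X \<inter> N')"
proof -
  have s: "submodule N A M" "submodule (X \<inter> N') A M" "submodule N' A M"
    using assms submodule_Int by (auto simp: covers_def)
  have "N <+>\<^bsub>M\<^esub> (X \<inter> N') \<subseteq> N'" using assms s by (intro set_add_least) (auto simp: covers_def)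
  moreover have "N <+>\<^bsub>M\<^esub> (X \<inter> N') \<noteq> N" using set_add_upper[OF s(1,2)] assms by blast
  ultimately show ?thesis
    using assms(1) set_add_upper[OF s(1,2)] submodule_set_add[OF s(1,2)] unfolding covers_def by metis
qed

section \<open>Homomorphisms\<close>

locale module_morphism = M: left_module A M + N: left_module A N
  for A :: "('a, 'x) ring_scheme" and M :: "('a, 'm) module" and N :: "('a, 'n) module" +
  fixes f :: "'m \<Rightarrow> 'n"
  assumes hom: "f \<in> module_hom A M N"
begin

lemma hom_closed [simp]: "x \<in> carrier M \<Longrightarrow> f x \<in> carrier N"
  and hom_add: "x \<in> carrier M \<Longrightarrow> y \<in> carrier M \<Longrightarrow> f (x \<oplus>\<^bsub>M\<^esub> y) = f x \<oplus>\<^bsub>N\<^esub> f y"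
  and hom_smult: "a \<in> carrier A \<Longrightarrow> x \<in> carrier M \<Longrightarrow> f (a \<odot>\<^bsub>M\<^esub> x) = a \<odot>\<^bsub>N\<^esub> f x"
  using hom by (auto simp: module_hom_def)

lemma hom_zero: "f \<zero>\<^bsub>M\<^esub> = \<zero>\<^bsub>N\<^esub>"
  by (metis M.M.l_zero M.M.zero_closed N.M.add.r_cancel_one' hom_add hom_closed)

lemma hom_minus: "x \<in> carrier M \<Longrightarrow> y \<in> carrier M \<Longrightarrow> f (x \<ominus>\<^bsub>M\<^esub> y) = f x \<ominus>\<^bsub>N\<^esub> f y"
  by (metis M.M.minus_closed M.minus_add_cancel N.add_diff_cancel hom_add hom_closed)

definition kern :: "'m set" where "kern = {x \<in> carrier M. f x = \<zero>\<^bsub>N\<^esub>}"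

definition pre :: "'n set \<Rightarrow> 'm set" where "pre Y = {x \<in> carrier M. f x \<in> Y}"

lemma submodule_pre: "submodule Y A N \<Longrightarrow> submodule (pre Y) A M"
  unfolding pre_def
  by (rule M.left_submoduleI) (auto simp: hom_zero hom_add hom_smult dest: N.submodule_closed)

lemma kern_eq: "kern = pre {\<zero>\<^bsub>N\<^esub>}" by (simp add: kern_def pre_def)

lemma submodule_kern: "submodule kern A M"
  unfolding kern_eq by (rule submodule_pre) simp

lemma submodule_image:
  assumes "submodule X A M" shows "submodule (f ` X) A N"
proof (rule N.left_submoduleI)
  note cl = M.submodule_closed[OF assms]
  show "f ` X \<subseteq> carrier N" using cl(1) by auto
  show "\<zero>\<^bsub>N\<^esub> \<in> f ` X" using cl(2) hom_zero by (metis image_eqI)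
  fix u v assume "u \<in> f ` X" "v \<in> f ` X"
  then obtain x y where "x \<in> X" "y \<in> X" "u = f x" "v = f y" by auto
  then show "u \<oplus>\<^bsub>N\<^esub> v \<in> f ` X" using cl(1,3) hom_add[of x y] by (metis image_eqI subsetD)
next
  note cl = M.submodule_closed[OF assms]
  fix a u assume "a \<in> carrier A" "u \<in> f ` X"
  then obtain x where "x \<in> X" "u = f x" by auto
  then show "a \<odot>\<^bsub>N\<^esub> u \<in> f ` X" using cl(1,4) hom_smult[of a x] \<open>a \<in> carrier A\<close>
    by (metis image_eqI subsetD)
qed

lemma mem_kern_minus: "x \<in> carrier M \<Longrightarrow> y \<in> carrier M \<Longrightarrow> f x = f y \<Longrightarrow> x \<ominus>\<^bsub>M\<^esub> y \<in> kern"
  unfolding kern_def using hom_minus N.minus_eq_zero_iff by auto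

lemma pre_image:
  assumes "submodule X A M" "kern \<subseteq> X"
  shows "pre (f ` X) = X"
proof
  show "pre (f ` X) \<subseteq> X"
  proof
    fix z assume "z \<in> pre (f ` X)"
    then obtain x where x: "x \<in> X" "z \<in> carrier M" "f z = f x" by (auto simp: pre_def)
    then have "x \<in> carrier M" using M.submodule_closed(1)[OF assms(1)] by auto
    then show "z \<in> X" using mem_kern_minus[of z x] x assms M.submodule_mem_cancel by blast
  qed
  show "X \<subseteq> pre (f ` X)" using M.submodule_closed(1)[OF assms(1)] by (auto simp: pre_def)
qed

lemma image_pre: "Y \<subseteq> f ` carrier M \<Longrightarrow> f ` pre Y = Y"
  by (auto simp: pre_def)

lemma image_set_add:
  assumes "X \<subseteq> carrier M" "Y \<subseteq> carrier M"
  shows "f ` (X <+>\<^bsub>M\<^esub> Y) = f ` X <+>\<^bsub>N\<^esub> f ` Y"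
proof -
  have *: "f (x \<oplus>\<^bsub>M\<^esub> y) = f x \<oplus>\<^bsub>N\<^esub> f y" if "x \<in> X" "y \<in> Y" for x y
    using hom_add assms that by auto
  show ?thesis
  proof (rule Set.set_eqI)
    fix z show "(z \<in> f ` (X <+>\<^bsub>M\<^esub> Y)) = (z \<in> f ` X <+>\<^bsub>N\<^esub> f ` Y)"
      unfolding N.mem_set_add image_iff M.mem_set_add Bex_def using * by metis
  qed
qed

text \<open>If \<open>x\<close> in \<open>X\<close> has its image in that of \<open>Y\<close>, then
  \<open>x\<close> lies in the preimage of the image of \<open>Y\<close>, and this is
  \<open>Y\<close> because \<open>Y\<close> contains the kernel.\<close>

lemma image_Int:
  assumes X: "submodule X A M" and Y: "submodule Y A M" "kern \<subseteq> Y"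
  shows "f ` X \<inter> f ` Y = f ` (X \<inter> Y)"
proof
  show "f ` X \<inter> f ` Y \<subseteq> f ` (X \<inter> Y)"
  proof
    fix z assume "z \<in> f ` X \<inter> f ` Y"
    then obtain x where "x \<in> X" "z = f x" "f x \<in> f ` Y" by auto
    then have "x \<in> pre (f ` Y)" using M.submodule_closed(1)[OF X] by (auto simp: pre_def)
    then show "z \<in> f ` (X \<inter> Y)" using \<open>x \<in> X\<close> \<open>z = f x\<close> pre_image[OF Y] by auto
  qed
qed auto

lemma kern_subset_pre: "submodule Y A N \<Longrightarrow> kern \<subseteq> pre Y"
  unfolding kern_def pre_def using N.submodule_closed(2) by auto

lemma inj_onI_kern: "kern = {\<zero>\<^bsub>M\<^esub>} \<Longrightarrow> inj_on f (carrier M)"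
  by (rule inj_onI) (metis M.minus_eq_zero_iff mem_kern_minus singletonD)

text \<open>Correspondence theorem: taking preimages is an isomorphism of lattices from the
  submodules of \<open>N\<close> onto the submodules of \<open>M\<close> above the kernel, with
  images as its inverse, so intervals and hence covers agree.\<close>

lemma covers_pre:
  assumes surj: "f ` carrier M = carrier N" and Y: "submodule Y A N" "submodule Y' A N"
  shows "covers A M (pre Y) (pre Y') \<longleftrightarrow> covers A N Y Y'"
proof -
  have sub: "Y \<subseteq> f ` carrier M" if "submodule Y A N" for Y
    using that surj N.submodule_closed(1) by blast
  have le: "pre Y \<subseteq> pre Y' \<longleftrightarrow> Y \<subseteq> Y'" if "submodule Y A N" "submodule Y' A N" for Y Y'
    using image_mono[of "pre Y" "pre Y'" f] image_pre[OF sub[OF that(1)]] image_pre[OF sub[OF that(2)]]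
    by (auto simp: pre_def)
  have *: "Z = pre (f ` Z)" "submodule (f ` Z) A N" if "submodule Z A M" "pre Y \<subseteq> Z" for Z
    using that pre_image kern_subset_pre[OF Y(1)] submodule_image by blast+
  note le1 = le[OF Y] le[OF Y(2,1)]
  show ?thesis
  proof
    assume c: "covers A M (pre Y) (pre Y')"
    show "covers A N Y Y'"
      unfolding covers_def
    proof (intro conjI allI impI Y)
      show "Y \<subset> Y'" using c le1 unfolding covers_def by auto
      fix Z assume Z: "submodule Z A N \<and> Y \<subseteq> Z \<and> Z \<subseteq> Y'"
      then have sZ: "submodule Z A N" by simp
      have "pre Y \<subseteq> pre Z" "pre Z \<subseteq> pre Y'" using Z le Y by simp_all
      then have "pre Z = pre Y \<or> pre Z = pre Y'"
        using c submodule_pre[OF sZ] unfolding covers_def by simp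
      then have "f ` pre Z = f ` pre Y \<or> f ` pre Z = f ` pre Y'" by (elim disj_forward) simp_all
      then show "Z = Y \<or> Z = Y'"
        by (simp add: image_pre sub sZ Y)
    qed
  next
    assume c: "covers A N Y Y'"
    show "covers A M (pre Y) (pre Y')"
      unfolding covers_def
    proof (intro conjI allI impI submodule_pre Y)
      show "pre Y \<subset> pre Y'" using c le1 unfolding covers_def by auto
      fix Z assume Z: "submodule Z A M \<and> pre Y \<subseteq> Z \<and> Z \<subseteq> pre Y'"
      then have fZ: "Z = pre (f ` Z)" "submodule (f ` Z) A N" using * by blast+
      have "Y \<subseteq> f ` Z" "f ` Z \<subseteq> Y'"
        using Z fZ(1) le[OF Y(1) fZ(2)] le[OF fZ(2) Y(2)] by auto
      then have "f ` Z = Y \<or> f ` Z = Y'"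
        using c fZ(2) unfolding covers_def by simp
      then show "Z = pre Y \<or> Z = pre Y'" using fZ(1) by auto
    qed
  qed
qed

end

lemma module_homI:
  assumes "\<And>x. x \<in> carrier M \<Longrightarrow> f x \<in> carrier N"
    and "\<And>x y. x \<in> carrier M \<Longrightarrow> y \<in> carrier M \<Longrightarrow> f (x \<oplus>\<^bsub>M\<^esub> y) = f x \<oplus>\<^bsub>N\<^esub> f y"
    and "\<And>a x. a \<in> carrier A \<Longrightarrow> x \<in> carrier M \<Longrightarrow> f (a \<odot>\<^bsub>M\<^esub> x) = a \<odot>\<^bsub>N\<^esub> f x"
  shows "f \<in> module_hom A M N"
  using assms by (auto simp: module_hom_def)

lemma module_morphismI:
  "left_module A M \<Longrightarrow> left_module A N \<Longrightarrow> f \<in> module_hom A M N \<Longrightarrow> module_morphism A M N f"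
  by (simp add: module_morphism_def module_morphism_axioms_def)

section \<open>The canonical projection onto a quotient\<close>

locale quotient_projection = left_module A M
  for A :: "('a, 'x) ring_scheme" and M :: "('a, 'm) module" +
  fixes N assumes N: "submodule N A M"
begin

definition q :: "'m \<Rightarrow> 'm set" where "q x = N +>\<^bsub>M\<^esub> x"

lemma q_eq_iff:
  assumes "x \<in> carrier M" "y \<in> carrier M"
  shows "q x = q y \<longleftrightarrow> x \<ominus>\<^bsub>M\<^esub> y \<in> N"
proof -
  note cl = submodule_closed[OF N]
  interpret N: abelian_subgroup N M
    using N by (intro abelian_subgroupI3 M.abelian_group_axioms additive_subgroupI)
      (auto simp: submodule_def)
  have "x \<ominus>\<^bsub>M\<^esub> y \<in> N \<longleftrightarrow> x \<in> N +>\<^bsub>M\<^esub> y"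
    unfolding a_r_coset_defs using assms cl(1) by (auto simp: subset_iff add_diff_cancel)
      (metis minus_add_cancel)
  then show ?thesis unfolding q_def
    by (metis N.a_repr_independence' assms(1,2) minus_minus_self N.a_rcos_self)
qed

sublocale q: module_morphism A M "quot_module M N" q
proof (intro module_morphismI left_module_axioms left_module_quot_module N module_homI)
  note cl = submodule_closed[OF N]
  interpret N: abelian_subgroup N M
    using N by (intro abelian_subgroupI3 M.abelian_group_axioms additive_subgroupI)
      (auto simp: submodule_def)
  show "\<And>x. x \<in> carrier M \<Longrightarrow> q x \<in> carrier (quot_module M N)"
    by (auto simp: q_def quot_module_def A_RCOSETS_def')
  show "\<And>x y. x \<in> carrier M \<Longrightarrow> y \<in> carrier M \<Longrightarrow>
      q (x \<oplus>\<^bsub>M\<^esub> y) = q x \<oplus>\<^bsub>quot_module M N\<^esub> q y"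
    by (simp add: quot_module_def q_def N.a_rcos_sum)
  fix a x assume a: "a \<in> carrier A" and x: "x \<in> carrier M"
  have "q (a \<odot>\<^bsub>M\<^esub> y) = q (a \<odot>\<^bsub>M\<^esub> x)" if y: "y \<in> q x" for y
  proof -
    have y': "y \<in> carrier M" using y x cl(1) unfolding q_def a_r_coset_defs by auto
    then have "q y = q x" using y x N.a_repr_independence' by (metis q_def)
    then show ?thesis using a x y' cl(4)[OF a] by (simp add: q_eq_iff smult_minus_right[symmetric])
  qed
  moreover have "x \<in> q x" using x N.a_rcos_self by (simp add: q_def)
  ultimately have "(\<Union>y\<in>q x. q (a \<odot>\<^bsub>M\<^esub> y)) = q (a \<odot>\<^bsub>M\<^esub> x)" by blast
  then show "q (a \<odot>\<^bsub>M\<^esub> x) = a \<odot>\<^bsub>quot_module M N\<^esub> q x"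
    by (simp add: quot_module_def q_def)
qed

lemma q_surj: "q ` carrier M = carrier (quot_module M N)"
  by (auto simp: q_def quot_module_def A_RCOSETS_def')

lemma q_kern: "q.kern = N"
proof -
  have "q x = \<zero>\<^bsub>quot_module M N\<^esub> \<longleftrightarrow> x \<in> N" if "x \<in> carrier M" for x
    using that q_eq_iff[of x "\<zero>\<^bsub>M\<^esub>"] by (simp add: q.hom_zero minus_zero)
  then show ?thesis using submodule_closed(1)[OF N] by (auto simp: q.kern_def)
qed

end

locale lmod = left_module A M
  for A :: "('a, 'x) ring_scheme" and M :: "('a, 'm) module"
begin

lemma simple_module_iff_covers:
  "simple_module A M \<longleftrightarrow> covers A M {\<zero>\<^bsub>M\<^esub>} (carrier M)"
proof -
  have 1: "{\<zero>\<^bsub>M\<^esub>} \<subset> carrier M \<longleftrightarrow> carrier M \<noteq> {\<zero>\<^bsub>M\<^esub>}" by auto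
  have 2: "submodule Z A M \<and> {\<zero>\<^bsub>M\<^esub>} \<subseteq> Z \<and> Z \<subseteq> carrier M \<longleftrightarrow> submodule Z A M" for Z
    using submodule_closed[of Z] by blast
  show ?thesis unfolding simple_module_def covers_def 1 2 by simp
qed

end

lemma (in quotient_projection) simple_quot_module_iff:
  "simple_module A (quot_module M N) \<longleftrightarrow> covers A M N (carrier M)"
proof -
  have "q.pre (carrier (quot_module M N)) = carrier M" by (auto simp: q.pre_def)
  then show ?thesis
    using q.covers_pre[OF q_surj q.N.submodule_zero q.N.submodule_carrier]
    by (simp add: lmod.simple_module_iff_covers[OF lmod.intro, OF q.N.left_module_axioms]
        q.kern_eq[symmetric] q_kern)
qed

context lmod
begin

lemma lmod_submodule: "submodule Q A M \<Longrightarrow> lmod A (M\<lparr>carrier := Q\<rparr>)"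
  unfolding lmod_def by (rule left_module_submodule)

lemma simple_submodule_iff:
  assumes "submodule S A M"
  shows "simple_module A (M\<lparr>carrier := S\<rparr>) \<longleftrightarrow> covers A M {\<zero>\<^bsub>M\<^esub>} S"
proof -
  interpret S: lmod A "M\<lparr>carrier := S\<rparr>" by (rule lmod_submodule[OF assms])
  show ?thesis using S.simple_module_iff_covers covers_restrict[OF assms] by simp
qed

lemma simple_subquotient_iff:
  assumes "submodule N A M" "submodule N' A M" "N \<subseteq> N'"
  shows "simple_module A (quot_module (M\<lparr>carrier := N'\<rparr>) N) \<longleftrightarrow> covers A M N N'"
proof -
  interpret N': quotient_projection A "M\<lparr>carrier := N'\<rparr>" N
    using assms by (intro quotient_projection.intro left_module_submodule
        quotient_projection_axioms.intro) (simp_all add: submodule_restrict_iff)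
  show ?thesis using N'.simple_quot_module_iff covers_restrict[OF assms(2)] by simp
qed

text \<open>Trades the simple factors in quotient records for covers in the ambient
  \<open>M\<close>, the form in which composition series are used below.\<close>

lemma has_length_iff:
  assumes "submodule Q A M"
  shows "has_length A (M\<lparr>carrier := Q\<rparr>) n \<longleftrightarrow>
    (\<exists>N. N 0 = {\<zero>\<^bsub>M\<^esub>} \<and> N n = Q \<and> (\<forall>i<n. covers A M (N i) (N (Suc i))))"
    (is "?l \<longleftrightarrow> ?r")
proof
  assume ?l
  then obtain N where N: "N 0 = {\<zero>\<^bsub>M\<^esub>}" "N n = Q" "\<And>i. i \<le> n \<Longrightarrow> submodule (N i) A M"
    "\<And>i. i < n \<Longrightarrow> N i \<subseteq> N (Suc i)"
    "\<And>i. i < n \<Longrightarrow> simple_module A (quot_module (M\<lparr>carrier := N (Suc i)\<rparr>) (N i))"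
    unfolding has_length_def by (auto simp: submodule_restrict_iff[OF assms])
  then have "covers A M (N i) (N (Suc i))" if "i < n" for i
    using simple_subquotient_iff[of "N i" "N (Suc i)"] that by simp
  then show ?r using N by blast
next
  assume ?r
  then obtain N where N: "N 0 = {\<zero>\<^bsub>M\<^esub>}" "N n = Q" "\<And>i. i < n \<Longrightarrow> covers A M (N i) (N (Suc i))"
    by blast
  \<comment> \<open>Downwards from \<open>N n = Q\<close>, because the upper end is where the
    containment in \<open>Q\<close> is known.\<close>
  have sub: "submodule (N i) A M \<and> N i \<subseteq> Q" if "i \<le> n" for i
    using that
  proof (induction rule: inc_induct)
    case base then show ?case using N assms by simp
  next
    case (step i) then show ?case using N(3)[of i] unfolding covers_def by auto
  qed
  then have "simple_module A (quot_module (M\<lparr>carrier := N (Suc i)\<rparr>) (N i))" "N i \<subseteq> N (Suc i)"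
    if "i < n" for i
    using simple_subquotient_iff[of "N i" "N (Suc i)"] N(3)[OF that] that by (auto simp: covers_def)
  then show ?l unfolding has_length_def
    using N sub by (intro exI[of _ N]) (simp add: submodule_restrict_iff[OF assms])
qed

end

text \<open>\<open>has_length\<close> is a relation witnessed by a series, which does not allow
  arithmetic. The locale postulates a height on all submodules that is strict and grows by one along
  covers; a single composition series provides such a height.\<close>

locale finite_length = lmod A M
  for A :: "('a, 'x) ring_scheme" and M :: "('a, 'm) module" +
  fixes h :: "'m set \<Rightarrow> nat"
  assumes h_zero: "h {\<zero>\<^bsub>M\<^esub>} = 0"
    and h_strict: "\<lbrakk>submodule X A M; submodule Y A M; X \<subset> Y\<rbrakk> \<Longrightarrow> h X < h Y"
    and h_covers: "covers A M X Y \<Longrightarrow> h Y = Suc (h X)"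

text \<open>Given a composition series \<open>N\<close>, the length of \<open>X\<close> counts the indices \<open>i\<close> for which \<open>X\<close>
  meets \<open>N (i + 1)\<close> outside \<open>N i\<close>.\<close>

lemma (in lmod) ex_finite_length:
  assumes "has_length A M n"
  shows "\<exists>h. finite_length A M h \<and> h (carrier M) = n"
proof -
  obtain N where N: "N 0 = {\<zero>\<^bsub>M\<^esub>}" "N n = carrier M" "\<And>i. i < n \<Longrightarrow> covers A M (N i) (N (Suc i))"
    using assms has_length_iff[of "carrier M"] by auto
  have sub: "submodule (N i) A M" if "i \<le> n" for i
    using that N(3)[of i] N(2) by (cases "i = n") (auto simp: covers_def)
  have mono: "N i \<subseteq> N j" if "i \<le> j" "j \<le> n" for i j
    using that
  proof (induction rule: dec_induct)
    case (step k) then show ?case using N(3)[of k] unfolding covers_def by auto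
  qed simp
  define J where "J X = {i. i < n \<and> (\<exists>x\<in>X. x \<in> N (Suc i) \<and> x \<notin> N i)}" for X
  have fin: "finite (J X)" for X by (simp add: J_def)
  have Jmono: "J X \<subseteq> J Y" if "X \<subseteq> Y" for X Y using that by (auto simp: J_def)
  \<comment> \<open>Induction on \<open>i\<close>: at an index of \<open>Y\<close> that is also an
    index of \<open>X\<close>, some element of \<open>X\<close> generates \<open>N (Suc i)\<close>
    modulo \<open>N i\<close>, so \<open>y\<close> differs from an element of \<open>X\<close> by an
    element of \<open>Y \<inter> N i\<close>.\<close>
  have Jeq: "X = Y" if X: "submodule X A M" and Y: "submodule Y A M" and XY: "X \<subseteq> Y" "J Y \<subseteq> J X" for X Y
  proof -
    have "Y \<inter> N i \<subseteq> X" if "i \<le> n" for i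
      using that
    proof (induction i)
      case 0 then show ?case using N(1) submodule_closed(2)[OF X] by auto
    next
      case (Suc i)
      then have i: "i < n" "i \<le> n" "Suc i \<le> n" by simp_all
      show ?case
      proof
        fix y assume y: "y \<in> Y \<inter> N (Suc i)"
        show "y \<in> X"
        proof (cases "y \<in> N i")
          case True then show ?thesis using Suc.IH i y by blast
        next
          case False
          then have "i \<in> J Y" using y i by (auto simp: J_def)
          then obtain x where x: "x \<in> X" "x \<in> N (Suc i)" "x \<notin> N i" using XY by (auto simp: J_def)
          have "N (Suc i) = N i <+>\<^bsub>M\<^esub> (X \<inter> N (Suc i))"
            using covers_split[OF N(3)[OF i(1)] X] x by blast
          then have "y \<in> N i <+>\<^bsub>M\<^esub> (X \<inter> N (Suc i))" using y by simp
          then obtain u v where uv: "u \<in> N i" "v \<in> X" "y = u \<oplus>\<^bsub>M\<^esub> v"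
            by (auto simp: mem_set_add)
          have c: "u \<in> carrier M" "v \<in> carrier M"
            using uv submodule_closed(1)[OF sub[OF i(2)]] submodule_closed(1)[OF X] by auto
          then have "u = y \<ominus>\<^bsub>M\<^esub> v" using uv by (simp add: add_diff_cancel)
          then have "u \<in> Y" using submodule_minus[OF Y, of y v] y uv XY by auto
          then have "u \<in> X" using Suc.IH i uv by blast
          then show ?thesis using submodule_closed(3)[OF X] uv by simp
        qed
      qed
    qed
    from this[of n] show ?thesis using N(2) submodule_closed(1)[OF Y] XY by auto
  qed
  have strict: "card (J X) < card (J Y)" if "submodule X A M" "submodule Y A M" "X \<subset> Y" for X Y
  proof (rule psubset_card_mono[OF fin])
    show "J X \<subset> J Y" using Jmono[of X Y] Jeq[of X Y] that by blast
  qed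
  have cov: "card (J Y) = Suc (card (J X))" if c: "covers A M X Y" for X Y
  proof -
    have X: "submodule X A M" and Y: "submodule Y A M" and XY: "X \<subset> Y" using c by (auto simp: covers_def)
    \<comment> \<open>Two new indices \<open>i < j\<close> are impossible: the element
      \<open>x\<close> found at \<open>i\<close> lies outside \<open>X\<close>, hence
      \<open>Y\<close> is \<open>X\<close> plus a part of \<open>N (Suc i)\<close>, and the element
      \<open>y\<close> found at \<open>j\<close> can be corrected by an element of
      \<open>N (Suc i) \<subseteq> N j\<close> to an element of \<open>X\<close> that still
      witnesses \<open>j\<close>.\<close>
    have uniq: False if ij: "i < j" "i \<in> J Y" "i \<notin> J X" "j \<in> J Y" "j \<notin> J X" for i j
    proof -
      have n: "i < n" "j < n" using ij by (auto simp: J_def)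
      have Nij: "N (Suc i) \<subseteq> N j" "N j \<subseteq> N (Suc j)" using mono n ij by auto
      obtain x where x: "x \<in> Y" "x \<in> N (Suc i)" "x \<notin> N i" using ij by (auto simp: J_def)
      obtain y where y: "y \<in> Y" "y \<in> N (Suc j)" "y \<notin> N j" using ij by (auto simp: J_def)
      have "x \<notin> X" using x ij n by (auto simp: J_def)
      then have "Y = X <+>\<^bsub>M\<^esub> (N (Suc i) \<inter> Y)"
        using covers_split[OF c sub, of "Suc i" x] n x by simp
      then have "y \<in> X <+>\<^bsub>M\<^esub> (N (Suc i) \<inter> Y)" using y by simp
      then obtain u v where uv: "u \<in> X" "v \<in> N (Suc i)" "y = u \<oplus>\<^bsub>M\<^esub> v"
        by (auto simp: mem_set_add)
      have sN: "submodule (N (Suc j)) A M" "submodule (N j) A M" using sub n by auto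
      have cc: "u \<in> carrier M" "v \<in> carrier M"
        using uv submodule_closed(1)[OF X] submodule_closed(1)[OF sub, of "Suc i"] n by auto
      then have "u = y \<ominus>\<^bsub>M\<^esub> v" using uv by (simp add: add_diff_cancel)
      then have "u \<in> N (Suc j)" using submodule_minus[OF sN(1) y(2), of v] uv Nij by auto
      moreover have "u \<notin> N j" using submodule_closed(3)[OF sN(2), of u v] uv Nij y by auto
      ultimately show False using ij n uv by (auto simp: J_def)
    qed
    have "J X \<subseteq> J Y" "J X \<noteq> J Y" using Jmono[of X Y] Jeq[OF X Y] XY by auto
    then obtain i where i: "i \<in> J Y" "i \<notin> J X" by blast
    have "J Y = insert i (J X)"
    proof
      show "J Y \<subseteq> insert i (J X)" using uniq[of i] uniq[of _ i] i by (metis insertCI linorder_neqE_nat subsetI)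
    qed (use i Jmono[of X Y] XY in auto)
    then show ?thesis using i fin by simp
  qed
  have "J (carrier M) = {..<n}"
  proof -
    have "\<exists>x\<in>carrier M. x \<in> N (Suc i) \<and> x \<notin> N i" if "i < n" for i
    proof -
      have "N i \<subset> N (Suc i)" using N(3)[OF that] by (simp add: covers_def)
      then obtain x where "x \<in> N (Suc i)" "x \<notin> N i" by auto
      moreover have "N (Suc i) \<subseteq> carrier M" using submodule_closed(1)[OF sub] that by simp
      ultimately show ?thesis by auto
    qed
    then show ?thesis by (auto simp: J_def)
  qed
  moreover have "J {\<zero>\<^bsub>M\<^esub>} = {}"
    using submodule_closed(2)[OF sub] by (auto simp: J_def)
  ultimately show ?thesis
    using strict cov
    by (intro exI[of _ "\<lambda>X. card (J X)"]) (simp add: finite_length_def finite_length_axioms_def lmod_axioms)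
qed

section \<open>Perspective intervals and the dimension formula\<close>

context left_module
begin

text \<open>Second isomorphism theorem for intervals: a submodule \<open>U\<close> between the two
  sums is recovered from \<open>U \<inter> Z\<close> by the modular law, and
  \<open>U \<inter> Z\<close> has only two possible values.\<close>

lemma covers_transpose:
  assumes c: "covers A M Z' Z" and X: "submodule X A M" and le: "X \<inter> Z \<subseteq> Z'"
  shows "covers A M (X <+>\<^bsub>M\<^esub> Z') (X <+>\<^bsub>M\<^esub> Z)"
proof -
  have Z: "submodule Z' A M" "submodule Z A M" "Z' \<subset> Z" using c by (auto simp: covers_def)
  note s = submodule_set_add[OF X Z(1)] submodule_set_add[OF X Z(2)]
  note up = set_add_upper[OF X Z(1)] set_add_upper[OF X Z(2)]
  have sub: "X <+>\<^bsub>M\<^esub> Z' \<subseteq> X <+>\<^bsub>M\<^esub> Z" using up Z s by (intro set_add_least) auto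
  \<comment> \<open>Keeps the transposed inclusion strict: cutting the smaller sum with
    \<open>Z\<close> gives back \<open>Z'\<close> and not \<open>Z\<close>.\<close>
  have *: "Z \<inter> (X <+>\<^bsub>M\<^esub> Z') = Z'"
  proof -
    have "Z \<inter> (Z' <+>\<^bsub>M\<^esub> X) = Z' <+>\<^bsub>M\<^esub> (Z \<inter> X)" using modular_law[OF Z(1) X Z(2)] Z(3) by auto
    moreover have "Z' <+>\<^bsub>M\<^esub> (Z \<inter> X) \<subseteq> Z'" using Z le by (intro set_add_least) auto
    moreover have "Z' \<subseteq> Z' <+>\<^bsub>M\<^esub> (Z \<inter> X)" by (intro set_add_upper submodule_Int Z X)
    ultimately show ?thesis using set_add_commute[OF X Z(1)] by auto
  qed
  show ?thesis unfolding covers_def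
  proof (intro conjI allI impI s)
    show "X <+>\<^bsub>M\<^esub> Z' \<subset> X <+>\<^bsub>M\<^esub> Z" using sub * up Z by auto
    fix U assume U: "submodule U A M \<and> X <+>\<^bsub>M\<^esub> Z' \<subseteq> U \<and> U \<subseteq> X <+>\<^bsub>M\<^esub> Z"
    then have sU: "submodule U A M" by simp
    have XU: "X \<subseteq> U" "Z' \<subseteq> U" using U up by auto
    have "U \<inter> Z = Z' \<or> U \<inter> Z = Z"
      using c submodule_Int[OF sU Z(2)] XU Z(3) unfolding covers_def by auto
    then show "U = X <+>\<^bsub>M\<^esub> Z' \<or> U = X <+>\<^bsub>M\<^esub> Z"
    proof
      assume "U \<inter> Z = Z'"
      moreover have "U \<inter> (X <+>\<^bsub>M\<^esub> Z) = X <+>\<^bsub>M\<^esub> (U \<inter> Z)" by (rule modular_law[OF X Z(2) sU XU(1)])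
      ultimately show ?thesis using U by auto
    next
      assume "U \<inter> Z = Z"
      then have "X <+>\<^bsub>M\<^esub> Z \<subseteq> U" using XU sU by (intro set_add_least) auto
      then show ?thesis using U by auto
    qed
  qed
qed

lemma set_add_absorb:
  assumes "submodule X A M" "submodule Y A M" "Y \<subseteq> X"
  shows "X <+>\<^bsub>M\<^esub> Y = X"
  using set_add_least[OF assms(1) subset_refl assms(3)] set_add_upper[OF assms(1,2)] by auto

end

context finite_length
begin

lemma h_mono: "submodule X A M \<Longrightarrow> submodule Y A M \<Longrightarrow> X \<subseteq> Y \<Longrightarrow> h X \<le> h Y"
  using h_strict[of X Y] by (cases "X = Y") (simp_all add: psubset_eq)

lemma h_eq: "submodule X A M \<Longrightarrow> submodule Y A M \<Longrightarrow> X \<subseteq> Y \<Longrightarrow> h Y \<le> h X \<Longrightarrow> X = Y"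
  using h_strict[of X Y] by (cases "X = Y") (simp_all add: psubset_eq)

lemma h_le: "submodule X A M \<Longrightarrow> h X \<le> h (carrier M)"
  using h_mono[OF _ submodule_carrier] submodule_closed(1) by blast

lemma h_eq_0: "submodule X A M \<Longrightarrow> h X = 0 \<longleftrightarrow> X = {\<zero>\<^bsub>M\<^esub>}"
  using h_eq[OF submodule_zero, of X] submodule_closed(2)[of X] h_zero by auto

text \<open>A strict height leaves no room inside an inclusion across which it grows by one. From
  here on a cover can be verified by counting.\<close>

lemma covers_iff_h:
  "covers A M X Y \<longleftrightarrow> submodule X A M \<and> submodule Y A M \<and> X \<subseteq> Y \<and> h Y = Suc (h X)"
proof
  assume r: "submodule X A M \<and> submodule Y A M \<and> X \<subseteq> Y \<and> h Y = Suc (h X)"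
  have "Z = X \<or> Z = Y" if Z: "submodule Z A M" "X \<subseteq> Z" "Z \<subseteq> Y" for Z
    using h_eq[of X Z] h_eq[of Z Y] h_mono[of X Z] h_mono[of Z Y] r Z
    by (cases "h Z \<le> h X") auto
  then show "covers A M X Y" using r unfolding covers_def by auto
qed (auto simp: h_covers covers_def)

lemma ex_covered_above:
  assumes "submodule X A M" "submodule Y A M" "X \<subset> Y"
  shows "\<exists>Z. X \<subseteq> Z \<and> covers A M Z Y"
proof -
  let ?P = "\<lambda>Z. submodule Z A M \<and> X \<subseteq> Z \<and> Z \<subset> Y"
  have "\<exists>Z. ?P Z \<and> (\<forall>U. ?P U \<longrightarrow> h U \<le> h Z)"
    by (rule ex_has_greatest_nat[where k = X and b = "Suc (h Y)"])
      (use assms h_mono in \<open>auto simp: less_Suc_eq_le le_Suc_eq psubset_eq\<close>)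
  then obtain Z where Z: "?P Z" and max: "\<And>U. ?P U \<Longrightarrow> h U \<le> h Z" by blast
  have "U = Z \<or> U = Y" if U: "submodule U A M" "Z \<subseteq> U" "U \<subseteq> Y" for U
  proof (cases "U = Y")
    case False
    then have "?P U" using U Z by auto
    then show ?thesis using max[of U] h_eq[of Z U] U Z by auto
  qed simp
  then have "covers A M Z Y" unfolding covers_def using Z assms by auto
  then show ?thesis using Z by auto
qed

lemma ex_covered_below:
  assumes "submodule X A M" "submodule Y A M" "X \<subset> Y"
  shows "\<exists>Z. covers A M X Z \<and> Z \<subseteq> Y"
proof -
  let ?P = "\<lambda>Z. submodule Z A M \<and> X \<subset> Z \<and> Z \<subseteq> Y"
  have "\<exists>Z. ?P Z \<and> (\<forall>U. ?P U \<longrightarrow> h Z \<le> h U)"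
    by (rule ex_has_least_nat[of ?P Y h]) (use assms in auto)
  then obtain Z where Z: "?P Z" and min: "\<And>U. ?P U \<Longrightarrow> h Z \<le> h U" by blast
  have "U = X \<or> U = Z" if U: "submodule U A M" "X \<subseteq> U" "U \<subseteq> Z" for U
  proof (cases "U = X")
    case False
    then have "?P U" using U Z by auto
    then show ?thesis using min[of U] h_eq[of U Z] U Z by auto
  qed simp
  then have "covers A M X Z" unfolding covers_def using Z assms by auto
  then show ?thesis using Z by auto
qed

text \<open>Climb from \<open>X \<inter> Y\<close> to \<open>Y\<close> one cover at a time. Each
  cover transposes to a cover of the sums with \<open>X\<close>, so both sides of the equation grow
  by one.\<close>

lemma h_modular:
  assumes X: "submodule X A M" and Y: "submodule Y A M"
  shows "h (X <+>\<^bsub>M\<^esub> Y) + h (X \<inter> Y) = h X + h Y"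
proof -
  have "h (X <+>\<^bsub>M\<^esub> Z) + h (X \<inter> Y) = h X + h Z"
    if "submodule Z A M" "X \<inter> Y \<subseteq> Z" "Z \<subseteq> Y" for Z
    using that
  proof (induction "h Z" arbitrary: Z rule: less_induct)
    case less
    show ?case
    proof (cases "Z = X \<inter> Y")
      case True
      then show ?thesis using set_add_absorb[OF X less.prems(1)] by simp
    next
      case False
      then obtain Z' where Z': "X \<inter> Y \<subseteq> Z'" "covers A M Z' Z"
        using ex_covered_above[OF submodule_Int[OF X Y] less.prems(1)] less.prems by blast
      then have sZ': "submodule Z' A M" "Z' \<subseteq> Z" "h Z = Suc (h Z')" using h_covers by (auto simp: covers_def)
      have "covers A M (X <+>\<^bsub>M\<^esub> Z') (X <+>\<^bsub>M\<^esub> Z)"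
        by (rule covers_transpose[OF Z'(2) X]) (use Z' less.prems in blast)
      then have "h (X <+>\<^bsub>M\<^esub> Z) = Suc (h (X <+>\<^bsub>M\<^esub> Z'))" by (rule h_covers)
      then show ?thesis using less.hyps[of Z'] sZ' Z' less.prems by auto
    qed
  qed
  from this[of Y] show ?thesis using Y by simp
qed

text \<open>Contains the Jordan-Hoelder theorem: \<open>h\<close> grows by one along each step of a
  series, so every composition series of \<open>Q\<close> has \<open>h Q\<close> steps.\<close>

lemma has_length_iff_h:
  assumes "submodule Q A M"
  shows "has_length A (M\<lparr>carrier := Q\<rparr>) n \<longleftrightarrow> h Q = n"
proof
  assume "has_length A (M\<lparr>carrier := Q\<rparr>) n"
  then obtain N where N: "N 0 = {\<zero>\<^bsub>M\<^esub>}" "N n = Q" "\<And>i. i < n \<Longrightarrow> covers A M (N i) (N (Suc i))"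
    unfolding has_length_iff[OF assms] by auto
  have "h (N i) = i" if "i \<le> n" for i
    using that by (induction i) (simp_all add: N(1) h_zero h_covers[OF N(3)])
  then show "h Q = n" using N(2) by auto
next
  assume "h Q = n"
  then show "has_length A (M\<lparr>carrier := Q\<rparr>) n"
    using assms
  proof (induction n arbitrary: Q)
    case 0
    then have "Q = {\<zero>\<^bsub>M\<^esub>}" using h_eq_0 by simp
    then show ?case unfolding has_length_iff[OF 0(2)] by (intro exI[of _ "\<lambda>_. Q"]) simp
  next
    case (Suc n)
    have "{\<zero>\<^bsub>M\<^esub>} \<subset> Q" using Suc.prems h_zero submodule_closed(2)[OF Suc.prems(2)] by auto
    then obtain Z where Z: "covers A M Z Q" using ex_covered_above[OF submodule_zero Suc.prems(2)] by blast
    have hZ: "h Z = n" "submodule Z A M" using h_covers[OF Z] Suc.prems Z by (auto simp: covers_def)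
    then obtain N where N: "N 0 = {\<zero>\<^bsub>M\<^esub>}" "N n = Z" "\<And>i. i < n \<Longrightarrow> covers A M (N i) (N (Suc i))"
      using Suc.IH[OF hZ] unfolding has_length_iff[OF hZ(2)] by auto
    then show ?case unfolding has_length_iff[OF Suc.prems(2)] using Z
      by (intro exI[of _ "N(Suc n := Q)"]) (simp add: less_Suc_eq)
  qed
qed

lemma finite_length_submodule:
  assumes "submodule Q A M"
  shows "finite_length A (M\<lparr>carrier := Q\<rparr>) h"
  unfolding finite_length_def finite_length_axioms_def
  using lmod_submodule[OF assms] h_zero h_strict h_covers
  by (simp add: submodule_restrict_iff[OF assms] covers_restrict[OF assms])

section \<open>Radical and socle, local and colocal modules\<close>

lemma maximal_submodule_iff: "maximal_submodule A M N \<longleftrightarrow> covers A M N (carrier M)"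
proof -
  have 1: "submodule N A M \<and> submodule (carrier M) A M \<and> N \<subset> carrier M \<and> P \<longleftrightarrow>
      submodule N A M \<and> N \<noteq> carrier M \<and> P" for P
    using submodule_closed(1)[of N] submodule_carrier by blast
  have 2: "submodule Z A M \<and> N \<subseteq> Z \<and> Z \<subseteq> carrier M \<longleftrightarrow> submodule Z A M \<and> N \<subseteq> Z" for Z
    using submodule_closed(1)[of Z] by blast
  show ?thesis unfolding maximal_submodule_def covers_def 1 2 by simp
qed

lemma submodule_rad: "submodule (rad A M) A M"
  unfolding rad_def by (rule submodule_Inter) (simp add: maximal_submodule_def)

lemma rad_eq_largest:
  assumes "largest_proper_submodule A M Q"
  shows "rad A M = Q" "covers A M Q (carrier M)"
proof -
  have Q: "submodule Q A M" "Q \<noteq> carrier M"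
    "\<And>N. submodule N A M \<Longrightarrow> N \<noteq> carrier M \<Longrightarrow> N \<subseteq> Q"
    using assms by (auto simp: largest_proper_submodule_def)
  have m: "maximal_submodule A M Q"
    unfolding maximal_submodule_def using Q by blast
  then show "covers A M Q (carrier M)" by (simp add: maximal_submodule_iff)
  have "N = Q" if "maximal_submodule A M N" for N
    using that Q unfolding maximal_submodule_def by blast
  then have "{N. maximal_submodule A M N} = {Q}" using m by blast
  then show "rad A M = Q" unfolding rad_def using submodule_closed(1)[OF Q(1)] by auto
qed

text \<open>If the top is simple, the radical is itself maximal; a proper submodule lies in some
  maximal one, which contains the radical and therefore equals it. Afterwards locality is a
  statement about the lattice of submodules.\<close>

lemma local_module_iff: "local_module A M \<longleftrightarrow> (\<exists>Q. largest_proper_submodule A M Q)"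
proof -
  interpret quotient_projection A M "rad A M"
    by (simp add: quotient_projection_def quotient_projection_axioms_def left_module_axioms submodule_rad)
  have *: "local_module A M \<longleftrightarrow> covers A M (rad A M) (carrier M)"
    unfolding local_module_def top_module_def by (rule simple_quot_module_iff)
  show ?thesis
  proof
    assume "local_module A M"
    then have c: "covers A M (rad A M) (carrier M)" using * by simp
    have "N \<subseteq> rad A M" if N: "submodule N A M" "N \<noteq> carrier M" for N
    proof -
      have "N \<subset> carrier M" using N submodule_closed(1) by blast
      then obtain Z where Z: "N \<subseteq> Z" "covers A M Z (carrier M)"
        using ex_covered_above[OF N(1) submodule_carrier] by blast
      have "rad A M \<subseteq> Z" unfolding rad_def using Z(2) maximal_submodule_iff by blast
      then have "Z = rad A M" using c Z(2) unfolding covers_def by blast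
      then show ?thesis using Z by simp
    qed
    then show "\<exists>Q. largest_proper_submodule A M Q"
      using c unfolding largest_proper_submodule_def covers_def by blast
  next
    assume "\<exists>Q. largest_proper_submodule A M Q"
    then show "local_module A M" using rad_eq_largest * by auto
  qed
qed

lemma submodule_span_eq: "submodule S A M \<Longrightarrow> submodule_span A M S = S"
  unfolding submodule_span_def by blast

lemma submodule_submodule_span:
  assumes "X \<subseteq> carrier M" shows "submodule (submodule_span A M X) A M"
proof -
  have "submodule_span A M X = carrier M \<inter> \<Inter>{N. submodule N A M \<and> X \<subseteq> N}"
    unfolding submodule_span_def using assms submodule_carrier by blast
  then show ?thesis using submodule_Inter[of "{N. submodule N A M \<and> X \<subseteq> N}"] by simp
qed

lemma ex_atom_below:
  assumes "submodule N A M" "N \<noteq> {\<zero>\<^bsub>M\<^esub>}"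
  shows "\<exists>T. covers A M {\<zero>\<^bsub>M\<^esub>} T \<and> T \<subseteq> N"
  using ex_covered_below[OF submodule_zero assms(1)] assms submodule_closed(2)[OF assms(1)] by auto

lemma soc_eq_smallest:
  assumes "smallest_nonzero_submodule A M S"
  shows "soc A M = S" "covers A M {\<zero>\<^bsub>M\<^esub>} S"
proof -
  have S: "submodule S A M" "S \<noteq> {\<zero>\<^bsub>M\<^esub>}"
    "\<And>N. submodule N A M \<Longrightarrow> N \<noteq> {\<zero>\<^bsub>M\<^esub>} \<Longrightarrow> S \<subseteq> N"
    using assms by (auto simp: smallest_nonzero_submodule_def)
  obtain T where T: "covers A M {\<zero>\<^bsub>M\<^esub>} T" "T \<subseteq> S" using ex_atom_below S by blast
  have at: "T' = S" if "covers A M {\<zero>\<^bsub>M\<^esub>} T'" for T'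
  proof -
    have s: "submodule T' A M" "T' \<noteq> {\<zero>\<^bsub>M\<^esub>}" using that by (auto simp: covers_def)
    have "h T' = Suc 0" using h_covers[OF that] h_zero by simp
    moreover have "h S \<noteq> 0" using h_eq_0 S by simp
    ultimately show ?thesis using S(3)[OF s] h_eq[OF S(1) s(1)] by auto
  qed
  then show c: "covers A M {\<zero>\<^bsub>M\<^esub>} S" using T by auto
  have "{S. submodule S A M \<and> simple_module A (M\<lparr>carrier := S\<rparr>)} = {S}"
    using at c S(1) simple_submodule_iff by blast
  then show "soc A M = S" unfolding soc_def using submodule_span_eq[OF S(1)] by simp
qed

text \<open>Dual to the local case: if the socle is simple, then a simple submodule of any nonzero
  \<open>N\<close> lies in the socle and equals it by height.\<close>

lemma colocal_module_iff: "colocal_module A M \<longleftrightarrow> (\<exists>S. smallest_nonzero_submodule A M S)"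
proof -
  let ?U = "\<Union>{S. submodule S A M \<and> simple_module A (M\<lparr>carrier := S\<rparr>)}"
  have "?U \<subseteq> carrier M" using submodule_closed(1) by blast
  then have s: "submodule (soc A M) A M" unfolding soc_def by (rule submodule_submodule_span)
  have U: "?U \<subseteq> soc A M" unfolding soc_def submodule_span_def by blast
  have *: "colocal_module A M \<longleftrightarrow> covers A M {\<zero>\<^bsub>M\<^esub>} (soc A M)"
    unfolding colocal_module_def by (rule simple_submodule_iff[OF s])
  show ?thesis
  proof
    assume "colocal_module A M"
    then have c: "covers A M {\<zero>\<^bsub>M\<^esub>} (soc A M)" using * by simp
    have "soc A M \<subseteq> N" if N: "submodule N A M" "N \<noteq> {\<zero>\<^bsub>M\<^esub>}" for N
    proof -
      obtain T where T: "covers A M {\<zero>\<^bsub>M\<^esub>} T" "T \<subseteq> N" using ex_atom_below N by blast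
      have sT: "submodule T A M" using T by (simp add: covers_def)
      have "T \<subseteq> soc A M" using U simple_submodule_iff[OF sT] T(1) sT by blast
      moreover have "h T = h (soc A M)" using h_covers[OF T(1)] h_covers[OF c] by simp
      ultimately have "T = soc A M" using h_eq[OF sT s] by simp
      then show ?thesis using T by simp
    qed
    then show "\<exists>S. smallest_nonzero_submodule A M S"
      using c unfolding smallest_nonzero_submodule_def covers_def by blast
  next
    assume "\<exists>S. smallest_nonzero_submodule A M S"
    then show "colocal_module A M" using soc_eq_smallest * by auto
  qed
qed

lemma h_less_chain:
  assumes "\<And>i. i \<le> k \<Longrightarrow> submodule (X i) A M" "\<And>i. i < k \<Longrightarrow> X i \<subset> X (Suc i)"
  shows "h (X 0) + k \<le> h (X k)"
  using assms
proof (induction k)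
  case (Suc k)
  have "h (X k) < h (X (Suc k))" using h_strict[of "X k" "X (Suc k)"] Suc.prems by simp
  moreover have "h (X 0) + k \<le> h (X k)" using Suc by simp
  ultimately show ?case by simp
qed simp

end

section \<open>Primitive idempotents of an artin algebra\<close>

lemma left_module_of_module: "module R M \<Longrightarrow> left_module R M"
proof -
  assume "module R M"
  then interpret module R M .
  show ?thesis
    by (intro left_module.intro left_module_axioms.intro R.ring_axioms M.abelian_group_axioms)
      (simp_all add: smult_l_distr smult_r_distr smult_assoc1)
qed

definition regular_module :: "('a, 'x) ring_scheme \<Rightarrow> ('a, 'a) module" where
  "regular_module A = \<lparr>carrier = carrier A, mult = mult A, one = one A, zero = zero A, add = add A,
     smult = mult A\<rparr>"

lemma regular_module_simps [simp]:
  "carrier (regular_module A) = carrier A" "zero (regular_module A) = zero A"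
  "add (regular_module A) = add A" "smult (regular_module A) = mult A"
  by (simp_all add: regular_module_def)

lemma left_module_regular_module:
  assumes "ring A" shows "left_module A (regular_module A)"
proof -
  interpret ring A by fact
  have "abelian_group (regular_module A)"
    by (rule abelian_groupI) (auto simp: a_ac intro: add.l_inv_ex)
  then show ?thesis
    unfolding left_module_def left_module_axioms_def
    by (simp add: ring_axioms l_distr r_distr m_assoc)
qed

text \<open>Needed because \<open>artinian\<close> speaks about ideals, while chains in a module
  produce submodules of the regular module.\<close>

lemma ideal_of_submodule:
  assumes "cring R" "submodule I R (regular_module R)"
  shows "ideal I R"
proof -
  interpret cring R by fact
  interpret reg: left_module R "regular_module R" by (rule left_module_regular_module) (rule ring_axioms)
  note cl = reg.submodule_closed[OF assms(2)]
  have "\<ominus>\<^bsub>R\<^esub> x \<in> I" if "x \<in> I" for x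
    using cl(4)[of "\<ominus>\<^bsub>R\<^esub> \<one>\<^bsub>R\<^esub>" x] cl(1) that by (auto simp: l_minus)
  then have "additive_subgroup I R"
    using cl(1-3) by (intro additive_subgroup.intro add.subgroupI) (auto simp: a_inv_def[symmetric])
  then show ?thesis
  proof (intro idealI ring_axioms additive_subgroup.a_subgroup)
    fix a x assume a: "a \<in> I" and x: "x \<in> carrier R"
    show "x \<otimes>\<^bsub>R\<^esub> a \<in> I" using cl(4)[OF x a] by simp
    moreover have "a \<in> carrier R" using a cl(1) by auto
    ultimately show "a \<otimes>\<^bsub>R\<^esub> x \<in> I" using m_comm[of a x] x by simp
  qed
qed

section \<open>Descending chains over an artinian base ring\<close>

context left_module
begin

text \<open>Chains run in the whole of \<open>M\<close> and are only compared on \<open>F\<close>.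
  This makes an induction over generators possible, in which \<open>F\<close> grows and the chain
  stays the same.\<close>

definition chains_stabilise_on :: "'c set \<Rightarrow> bool" where
  "chains_stabilise_on F \<longleftrightarrow> (\<forall>N :: nat \<Rightarrow> 'c set. (\<forall>n. submodule (N n) A M) \<and> (\<forall>n. N (Suc n) \<subseteq> N n)
     \<longrightarrow> (\<exists>m. \<forall>n\<ge>m. F \<inter> N n = F \<inter> N m))"

text \<open>The usual argument for an extension by a cyclic module: a chain is controlled by its
  traces on \<open>F\<close> and by the ideals \<open>I n\<close> of those \<open>r\<close> for
  which \<open>r a\<close> lies in \<open>F + N n\<close>. Both become stationary.\<close>

lemma chains_stabilise_on_set_add:
  assumes cring: "cring A" and art: "artinian A"
    and F: "submodule F A M" "chains_stabilise_on F" and a: "a \<in> carrier M"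
  shows "chains_stabilise_on (F <+>\<^bsub>M\<^esub> cyclic a)"
  unfolding chains_stabilise_on_def
proof (intro allI impI)
  fix N :: "nat \<Rightarrow> 'c set" assume "(\<forall>n. submodule (N n) A M) \<and> (\<forall>n. N (Suc n) \<subseteq> N n)"
  then have N: "\<And>n. submodule (N n) A M" and dec: "\<And>n. N (Suc n) \<subseteq> N n" by simp_all
  have anti: "N n \<subseteq> N m" if "m \<le> n" for m n
    using lift_Suc_antimono_le[of N, OF dec that] .
  interpret A: cring A by (rule cring)
  interpret reg: left_module A "regular_module A" by (rule left_module_regular_module) (rule A.ring_axioms)
  define I where "I n = {r \<in> carrier A. r \<odot>\<^bsub>M\<^esub> a \<in> F <+>\<^bsub>M\<^esub> N n}" for n
  have FN: "submodule (F <+>\<^bsub>M\<^esub> N n) A M" for n by (rule submodule_set_add[OF F(1) N])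
  have "submodule (I n) A (regular_module A)" for n
    unfolding I_def
    by (rule reg.left_submoduleI)
      (use a submodule_closed[OF FN] in \<open>simp_all add: subset_iff smult_l_distr smult_zero_left smult_assoc1\<close>)
  then have "ideal (I n) A" for n by (rule ideal_of_submodule[OF cring])
  moreover have "I (Suc n) \<subseteq> I n" for n
  proof -
    have "F <+>\<^bsub>M\<^esub> N (Suc n) \<subseteq> F <+>\<^bsub>M\<^esub> N n"
      using set_add_upper[OF F(1) N, of n] order_trans[OF dec[of n]] by (intro set_add_least FN) auto
    then show ?thesis by (auto simp: I_def)
  qed
  ultimately obtain m1 where m1: "\<And>n. n \<ge> m1 \<Longrightarrow> I n = I m1"
    using art unfolding artinian_def by meson
  obtain m2 where m2: "\<And>n. n \<ge> m2 \<Longrightarrow> F \<inter> N n = F \<inter> N m2"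
    using F(2) N dec unfolding chains_stabilise_on_def by meson
  define m where "m = max m1 m2"
  have "(F <+>\<^bsub>M\<^esub> cyclic a) \<inter> N n = (F <+>\<^bsub>M\<^esub> cyclic a) \<inter> N m" if "n \<ge> m" for n
  proof
    show "(F <+>\<^bsub>M\<^esub> cyclic a) \<inter> N n \<subseteq> (F <+>\<^bsub>M\<^esub> cyclic a) \<inter> N m" using anti[OF that] by auto
    show "(F <+>\<^bsub>M\<^esub> cyclic a) \<inter> N m \<subseteq> (F <+>\<^bsub>M\<^esub> cyclic a) \<inter> N n"
    proof
      fix x assume x: "x \<in> (F <+>\<^bsub>M\<^esub> cyclic a) \<inter> N m"
      then obtain f r where fr: "f \<in> F" "r \<in> carrier A" "x = f \<oplus>\<^bsub>M\<^esub> r \<odot>\<^bsub>M\<^esub> a"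
        by (auto simp: mem_set_add cyclic_def)
      have xN: "x \<in> N m" using x by simp
      have c: "f \<in> carrier M" "x \<in> carrier M" "r \<odot>\<^bsub>M\<^esub> a \<in> carrier M"
        using fr submodule_closed(1)[OF F(1)] submodule_closed(1)[OF N] xN a by auto
      have eq: "r \<odot>\<^bsub>M\<^esub> a = x \<ominus>\<^bsub>M\<^esub> f" using c fr add_diff_cancel[of "r \<odot>\<^bsub>M\<^esub> a" f] M.a_comm[of f "r \<odot>\<^bsub>M\<^esub> a"] by simp
      have "x \<in> F <+>\<^bsub>M\<^esub> N m" "f \<in> F <+>\<^bsub>M\<^esub> N m" using set_add_upper[OF F(1) N, of m] xN fr by auto
      then have "r \<odot>\<^bsub>M\<^esub> a \<in> F <+>\<^bsub>M\<^esub> N m" unfolding eq by (rule submodule_minus[OF FN])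
      then have "r \<in> I m" unfolding I_def using fr by simp
      moreover have "I m = I n" using m1[of m] m1[of n] that unfolding m_def by simp
      ultimately have "r \<in> I n" by simp
      \<comment> \<open>Since \<open>r a\<close> can be rewritten with the smaller
        \<open>N n\<close>, \<open>x\<close> differs from an element \<open>y\<close> of
        \<open>N n\<close> by an element of \<open>F\<close>, and on \<open>F\<close> the chain is
        stationary already.\<close>
      then obtain f' y where y: "f' \<in> F" "y \<in> N n" "r \<odot>\<^bsub>M\<^esub> a = f' \<oplus>\<^bsub>M\<^esub> y"
        by (auto simp: I_def mem_set_add)
      have c': "f' \<in> carrier M" "y \<in> carrier M"
        using y submodule_closed(1)[OF F(1)] submodule_closed(1)[OF N] by auto
      have "x \<ominus>\<^bsub>M\<^esub> y = f \<oplus>\<^bsub>M\<^esub> f'"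
        using fr y c c' by (simp add: M.a_assoc[symmetric] add_diff_cancel)
      then have "x \<ominus>\<^bsub>M\<^esub> y \<in> F" using submodule_closed(3)[OF F(1)] fr y by simp
      moreover have "x \<ominus>\<^bsub>M\<^esub> y \<in> N m" using submodule_minus[OF N xN] y anti[OF that] by auto
      moreover have "F \<inter> N m = F \<inter> N n" using m2[of m] m2[of n] that unfolding m_def by simp
      ultimately have "x \<ominus>\<^bsub>M\<^esub> y \<in> N n" by auto
      then have "x \<in> N n" using submodule_mem_cancel[OF N c(2) y(2)] by simp
      then show "x \<in> (F <+>\<^bsub>M\<^esub> cyclic a) \<inter> N n" using x by simp
    qed
  qed
  then show "\<exists>m. \<forall>n\<ge>m. (F <+>\<^bsub>M\<^esub> cyclic a) \<inter> N n = (F <+>\<^bsub>M\<^esub> cyclic a) \<inter> N m" by blast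
qed

lemma chains_stabilise:
  assumes cring: "cring A" and art: "artinian A" and fg: "finitely_generated A M"
  shows "chains_stabilise_on (carrier M)"
proof -
  obtain X where X: "finite X" "X \<subseteq> carrier M" "submodule_span A M X = carrier M"
    using fg unfolding finitely_generated_def by blast
  have "\<exists>F. submodule F A M \<and> X \<subseteq> F \<and> chains_stabilise_on F"
    using X(1,2)
  proof (induction X rule: finite_induct)
    case empty
    have "{\<zero>\<^bsub>M\<^esub>} \<inter> N = {\<zero>\<^bsub>M\<^esub>}" if "submodule N A M" for N
      using submodule_closed(2)[OF that] by simp
    then have "chains_stabilise_on {\<zero>\<^bsub>M\<^esub>}" unfolding chains_stabilise_on_def by simp
    then show ?case using submodule_zero by blast
  next
    case (insert a X)
    then obtain F where F: "submodule F A M" "X \<subseteq> F" "chains_stabilise_on F" by auto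
    have a: "a \<in> carrier M" using insert.prems by simp
    have "insert a X \<subseteq> F <+>\<^bsub>M\<^esub> cyclic a"
      using set_add_upper[OF F(1) submodule_cyclic[OF a]] mem_cyclic[OF a] F(2) by auto
    then show ?case
      using submodule_set_add[OF F(1) submodule_cyclic[OF a]]
        chains_stabilise_on_set_add[OF cring art F(1,3) a] by blast
  qed
  then obtain F where F: "submodule F A M" "X \<subseteq> F" "chains_stabilise_on F" by blast
  then have "carrier M \<subseteq> F" using X(3) unfolding submodule_span_def by blast
  then show ?thesis using F submodule_closed(1)[OF F(1)] by simp
qed

lemma ex_minimal_submodule:
  assumes cring: "cring A" and art: "artinian A" and fg: "finitely_generated A M"
    and \<F>: "\<F> \<noteq> {}" "\<And>N. N \<in> \<F> \<Longrightarrow> submodule N A M"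
  shows "\<exists>N\<in>\<F>. \<forall>N'\<in>\<F>. N' \<subseteq> N \<longrightarrow> N' = N"
proof -
  let ?r = "{(X, Y). X \<in> \<F> \<and> Y \<in> \<F> \<and> X \<subset> Y}"
  have "wf ?r"
    unfolding wf_iff_no_infinite_down_chain
  proof
    assume "\<exists>N. \<forall>i. (N (Suc i), N i) \<in> ?r"
    then obtain N where *: "\<forall>i. (N (Suc i), N i) \<in> ?r" by (elim exE)
    then have N: "\<And>i. N i \<in> \<F>" "\<And>i. N (Suc i) \<subset> N i" by simp_all
    have s: "submodule (N i) A M" for i by (rule \<F>(2)[OF N(1)])
    have "\<exists>m. \<forall>n\<ge>m. carrier M \<inter> N n = carrier M \<inter> N m"
      using chains_stabilise[OF cring art fg] s N(2) unfolding chains_stabilise_on_def by (simp add: psubset_eq)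
    then obtain m where "carrier M \<inter> N (Suc m) = carrier M \<inter> N m" by (metis le_SucI order_refl)
    moreover have "carrier M \<inter> N i = N i" for i using submodule_closed(1)[OF s] by auto
    ultimately show False using N(2)[of m] by simp
  qed
  moreover obtain X where "X \<in> \<F>" using \<F>(1) by blast
  ultimately have "\<exists>Z\<in>\<F>. \<forall>Y. (Y, Z) \<in> ?r \<longrightarrow> Y \<notin> \<F>"
    unfolding wf_eq_minimal by (elim allE) (erule mp)
  then obtain Z where Z: "Z \<in> \<F>" "\<forall>Y. (Y, Z) \<in> ?r \<longrightarrow> Y \<notin> \<F>" by (rule bexE)
  have "N' = Z" if "N' \<in> \<F>" "N' \<subseteq> Z" for N'
  proof (rule ccontr)
    assume "N' \<noteq> Z"
    then have "(N', Z) \<in> ?r" using that Z(1) by simp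
    then show False using Z(2) that(1) by blast
  qed
  then show ?thesis using Z(1) by (intro bexI[of _ Z] ballI impI)
qed

end

text \<open>The equations \<open>e f = f\<close> and \<open>f e = f\<close> describe the corner ring
  eAe, so the last clause says that its only idempotents are zero and its identity
  \<open>e\<close>.\<close>

definition primitive_idempotent :: "('a, 'x) ring_scheme \<Rightarrow> 'a \<Rightarrow> bool" where
  "primitive_idempotent A e \<longleftrightarrow> e \<in> carrier A \<and> e \<noteq> \<zero>\<^bsub>A\<^esub> \<and> e \<otimes>\<^bsub>A\<^esub> e = e \<and>
     (\<forall>f\<in>carrier A. f \<otimes>\<^bsub>A\<^esub> f = f \<and> e \<otimes>\<^bsub>A\<^esub> f = f \<and> f \<otimes>\<^bsub>A\<^esub> e = f \<longrightarrow> f = \<zero>\<^bsub>A\<^esub> \<or> f = e)"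

lemma primitive_idempotent_opposite:
  "primitive_idempotent (opposite A) e = primitive_idempotent A e"
  unfolding primitive_idempotent_def opposite_def by auto

text \<open>Among the idempotents \<open>e\<close> with \<open>e x\<close> outside \<open>Q\<close>,
  to which the identity belongs, choose one with Ae minimal; the descending chain condition over
  \<open>R\<close> allows this. If \<open>f\<close> is an idempotent of eAe, then
  \<open>e = f + (e - f)\<close>, and one of the two summands still carries \<open>x\<close> outside
  \<open>Q\<close>; by minimality that one is \<open>e\<close>.\<close>

lemma ex_primitive_idempotent:
  assumes alg: "artin_algebra R A" and W: "left_module A W"
    and Q: "submodule Q A W" and x: "x \<in> carrier W" "x \<notin> Q"
  shows "\<exists>e. primitive_idempotent A e \<and> e \<odot>\<^bsub>W\<^esub> x \<notin> Q"
proof -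
  interpret alg: artin_algebra R A by (rule alg)
  interpret RA: left_module R A by (rule left_module_of_module) (rule alg.module_axioms)
  interpret W: left_module A W by (rule W)
  let ?L = "\<lambda>e. (\<lambda>a. a \<otimes>\<^bsub>A\<^esub> e) ` carrier A"
  let ?E = "{e \<in> carrier A. e \<otimes>\<^bsub>A\<^esub> e = e \<and> e \<odot>\<^bsub>W\<^esub> x \<notin> Q}"
  have sub: "submodule (?L e) R A" if e: "e \<in> carrier A" for e
  proof (rule RA.left_submoduleI)
    show "?L e \<subseteq> carrier A" using e by auto
    show "\<zero>\<^bsub>A\<^esub> \<in> ?L e" using e by (intro image_eqI[of _ _ "\<zero>\<^bsub>A\<^esub>"]) auto
  next
    fix u v assume "u \<in> ?L e" "v \<in> ?L e"
    then obtain a b where "a \<in> carrier A" "b \<in> carrier A" "u = a \<otimes>\<^bsub>A\<^esub> e" "v = b \<otimes>\<^bsub>A\<^esub> e" by auto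
    then show "u \<oplus>\<^bsub>A\<^esub> v \<in> ?L e" using e
      by (intro image_eqI[of _ _ "a \<oplus>\<^bsub>A\<^esub> b"]) (simp_all add: alg.l_distr)
  next
    fix r u assume "r \<in> carrier R" "u \<in> ?L e"
    then obtain a where "r \<in> carrier R" "a \<in> carrier A" "u = a \<otimes>\<^bsub>A\<^esub> e" by auto
    then show "r \<odot>\<^bsub>A\<^esub> u \<in> ?L e" using e
      by (intro image_eqI[of _ _ "r \<odot>\<^bsub>A\<^esub> a"]) (simp_all add: alg.smult_mult_left)
  qed
  have "\<one>\<^bsub>A\<^esub> \<in> ?E" using x by simp
  then have "?L ` ?E \<noteq> {}" by blast
  then obtain N where N: "N \<in> ?L ` ?E" "\<forall>N'\<in>?L ` ?E. N' \<subseteq> N \<longrightarrow> N' = N"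
    using RA.ex_minimal_submodule[OF _ alg.artinian_base alg.finitely_generated_base, of "?L ` ?E"]
      alg.R.cring_axioms sub by auto
  then obtain e where e: "e \<in> carrier A" "e \<otimes>\<^bsub>A\<^esub> e = e" "e \<odot>\<^bsub>W\<^esub> x \<notin> Q" "N = ?L e" by auto
  \<comment> \<open>As Af is inside Ae, minimality gives \<open>e = a f\<close> for some
    \<open>a\<close>. Then \<open>e f = a f = e\<close>, while \<open>e f = f\<close> because
    \<open>f\<close> lies in eAe.\<close>
  have min: "f = e" if f: "f \<in> carrier A" "f \<otimes>\<^bsub>A\<^esub> f = f" "e \<otimes>\<^bsub>A\<^esub> f = f" "f \<otimes>\<^bsub>A\<^esub> e = f" "f \<odot>\<^bsub>W\<^esub> x \<notin> Q" for f
  proof -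
    have "?L f \<subseteq> ?L e"
    proof
      fix u assume "u \<in> ?L f"
      then obtain a where "a \<in> carrier A" "u = a \<otimes>\<^bsub>A\<^esub> f" by auto
      then show "u \<in> ?L e" using e f
        by (intro image_eqI[of _ _ "a \<otimes>\<^bsub>A\<^esub> f"]) (simp_all add: alg.m_assoc)
    qed
    then have "?L f = ?L e" using N(2) f e(4) by auto
    moreover have "e \<in> ?L e" using e by (intro image_eqI[of _ _ e]) auto
    ultimately have "e \<in> ?L f" by simp
    then obtain a where a: "a \<in> carrier A" "e = a \<otimes>\<^bsub>A\<^esub> f" by auto
    then have "e \<otimes>\<^bsub>A\<^esub> f = a \<otimes>\<^bsub>A\<^esub> (f \<otimes>\<^bsub>A\<^esub> f)" using f by (simp add: alg.m_assoc)
    then show ?thesis using f a by simp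
  qed
  have "e \<noteq> \<zero>\<^bsub>A\<^esub>"
    using e(3) W.smult_zero_left[OF x(1)] W.submodule_closed(2)[OF Q] by auto
  moreover have "f = \<zero>\<^bsub>A\<^esub> \<or> f = e"
    if f: "f \<in> carrier A" "f \<otimes>\<^bsub>A\<^esub> f = f" "e \<otimes>\<^bsub>A\<^esub> f = f" "f \<otimes>\<^bsub>A\<^esub> e = f" for f
  proof (cases "f \<odot>\<^bsub>W\<^esub> x \<in> Q")
    case False
    then show ?thesis using min f by blast
  next
    case True
    define g where "g = e \<ominus>\<^bsub>A\<^esub> f"
    have g: "g \<in> carrier A" using e f by (simp add: g_def)
    have gf: "g \<oplus>\<^bsub>A\<^esub> f = e" unfolding g_def using e f RA.minus_add_cancel by simp
    have eg: "e \<otimes>\<^bsub>A\<^esub> g = g" "g \<otimes>\<^bsub>A\<^esub> e = g"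
      unfolding g_def using e f by (simp_all add: alg.r_distr alg.l_distr a_minus_def alg.r_minus alg.l_minus)
    have fg: "f \<otimes>\<^bsub>A\<^esub> g = \<zero>\<^bsub>A\<^esub>"
      unfolding g_def using e f by (simp add: alg.r_distr a_minus_def alg.r_minus alg.r_neg)
    have "g \<otimes>\<^bsub>A\<^esub> g = (e \<ominus>\<^bsub>A\<^esub> f) \<otimes>\<^bsub>A\<^esub> g" by (simp add: g_def)
    also have "\<dots> = g" using e f g eg fg by (simp add: alg.l_distr a_minus_def alg.l_minus)
    finally have gg: "g \<otimes>\<^bsub>A\<^esub> g = g" .
    have "e \<odot>\<^bsub>W\<^esub> x = g \<odot>\<^bsub>W\<^esub> x \<oplus>\<^bsub>W\<^esub> f \<odot>\<^bsub>W\<^esub> x" using gf g f x W.smult_l_distr[of g f x] by simp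
    then have "g \<odot>\<^bsub>W\<^esub> x \<notin> Q" using e(3) True W.submodule_closed(3)[OF Q] by auto
    then have "g = e" using min g gg eg by blast
    then have "f = \<zero>\<^bsub>A\<^esub>" using gf f e alg.add.r_cancel_one'[of f e] by (metis alg.add.r_cancel_one alg.a_comm)
    then show ?thesis by simp
  qed
  ultimately have "primitive_idempotent A e" using e unfolding primitive_idempotent_def by blast
  then show ?thesis using e by blast
qed

text \<open>The set of all \<open>a\<close> with \<open>a e = a\<close> is the left ideal Ae. A copy
  \<open>P\<close> with a coordinate map \<open>\<theta>\<close> is used, because the conditions on
  projective modules range over \<open>'a fg_object\<close>.\<close>

definition represents_left_ideal ::
    "('a, 'x) ring_scheme \<Rightarrow> 'a \<Rightarrow> 'a fg_object \<Rightarrow> ((nat \<Rightarrow> 'a) set \<Rightarrow> 'a) \<Rightarrow> bool" where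
  "represents_left_ideal A e P \<theta> \<longleftrightarrow> left_module A P \<and> inj_on \<theta> (carrier P) \<and>
     \<theta> ` carrier P = {a \<in> carrier A. a \<otimes>\<^bsub>A\<^esub> e = a} \<and>
     (\<forall>x\<in>carrier P. \<forall>y\<in>carrier P. \<theta> (x \<oplus>\<^bsub>P\<^esub> y) = \<theta> x \<oplus>\<^bsub>A\<^esub> \<theta> y) \<and>
     (\<forall>a\<in>carrier A. \<forall>x\<in>carrier P. \<theta> (a \<odot>\<^bsub>P\<^esub> x) = a \<otimes>\<^bsub>A\<^esub> \<theta> x)"

lemma ex_represents_left_ideal:
  fixes A :: "('a, 'x) ring_scheme"
  assumes "ring A" and e: "e \<in> carrier A" "e \<otimes>\<^bsub>A\<^esub> e = e"
  shows "\<exists>P \<theta>. fg_module A P \<and> represents_left_ideal A e P \<theta>"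
proof -
  interpret ring A by fact
  interpret reg: left_module A "regular_module A" by (rule left_module_regular_module) (rule ring_axioms)
  let ?L = "{a \<in> carrier A. a \<otimes>\<^bsub>A\<^esub> e = a}"
  let ?M = "regular_module A\<lparr>carrier := ?L\<rparr>"
  have sub: "submodule ?L A (regular_module A)"
    by (rule reg.left_submoduleI) (use e in \<open>auto simp: l_distr m_assoc\<close>)
  interpret L: left_module A ?M by (rule reg.left_module_submodule[OF sub])
  have least: "?L \<subseteq> N" if N: "submodule N A ?M" "e \<in> N" for N
  proof
    fix a assume "a \<in> ?L"
    then show "a \<in> N" using L.submodule_closed(4)[OF N(1), of a e] N(2) by simp
  qed
  have "submodule_span A ?M {e} = carrier ?M"
  proof (intro subset_antisym)
    show "submodule_span A ?M {e} \<subseteq> carrier ?M"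
      unfolding submodule_span_def by (rule Inter_lower) (use L.submodule_carrier e in simp)
    show "carrier ?M \<subseteq> submodule_span A ?M {e}"
      unfolding submodule_span_def by (rule Inter_greatest) (use least in simp)
  qed
  then have "finitely_generated A ?M" unfolding finitely_generated_def using e by (intro exI[of _ "{e}"]) simp
  then have "fg_module A ?M" by (simp add: fg_module_def L.left_module_axioms)
  then obtain P :: "'a fg_object" and f where P: "fg_module A P" "f \<in> module_iso A ?M P"
    using ex_isomorphic_fg_object by blast
  interpret P: left_module A P using P by (simp add: fg_module_def)
  have f: "bij_betw f ?L (carrier P)"
    "\<And>x y. x \<in> ?L \<Longrightarrow> y \<in> ?L \<Longrightarrow> f (x \<oplus>\<^bsub>A\<^esub> y) = f x \<oplus>\<^bsub>P\<^esub> f y"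
    "\<And>a x. a \<in> carrier A \<Longrightarrow> x \<in> ?L \<Longrightarrow> f (a \<otimes>\<^bsub>A\<^esub> x) = a \<odot>\<^bsub>P\<^esub> f x"
    using P(2) by (auto simp: module_iso_def module_hom_def)
  define \<theta> where "\<theta> = inv_into ?L f"
  have \<theta>: "bij_betw \<theta> (carrier P) ?L" unfolding \<theta>_def by (rule bij_betw_inv_into[OF f(1)])
  have f\<theta>: "f (\<theta> x) = x" "\<theta> x \<in> ?L" if "x \<in> carrier P" for x
    unfolding \<theta>_def using bij_betw_inv_into_right[OF f(1) that] bij_betwE[OF \<theta>] that by (auto simp: \<theta>_def)
  have \<theta>f: "\<theta> (f y) = y" if "y \<in> ?L" for y
    unfolding \<theta>_def using bij_betw_inv_into_left[OF f(1) that] .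
  have Lcl: "x \<oplus>\<^bsub>A\<^esub> y \<in> ?L" "a \<otimes>\<^bsub>A\<^esub> x \<in> ?L" if "x \<in> ?L" "y \<in> ?L" "a \<in> carrier A" for x y a
    using reg.submodule_closed(3)[OF sub that(1,2)] reg.submodule_closed(4)[OF sub that(3,1)] by simp_all
  have "\<theta> (x \<oplus>\<^bsub>P\<^esub> y) = \<theta> x \<oplus>\<^bsub>A\<^esub> \<theta> y" if "x \<in> carrier P" "y \<in> carrier P" for x y
    using f(2)[OF f\<theta>(2)[OF that(1)] f\<theta>(2)[OF that(2)]] \<theta>f[OF Lcl(1)[OF f\<theta>(2)[OF that(1)] f\<theta>(2)[OF that(2)] e(1)]]
      f\<theta>(1) that by simp
  moreover have "\<theta> (a \<odot>\<^bsub>P\<^esub> x) = a \<otimes>\<^bsub>A\<^esub> \<theta> x" if "a \<in> carrier A" "x \<in> carrier P" for a x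
    using f(3)[OF that(1) f\<theta>(2)[OF that(2)]] \<theta>f[OF Lcl(2)[OF f\<theta>(2)[OF that(2)] f\<theta>(2)[OF that(2)] that(1)]]
      f\<theta>(1) that by simp
  ultimately have "represents_left_ideal A e P \<theta>"
    unfolding represents_left_ideal_def using \<theta> P.left_module_axioms by (simp add: bij_betw_def)
  then show ?thesis using P(1) by blast
qed

locale left_ideal_module = lmod A P
  for A :: "('a, 'x) ring_scheme" and P :: "'a fg_object" +
  fixes e :: 'a and \<theta> :: "(nat \<Rightarrow> 'a) set \<Rightarrow> 'a"
  assumes prim: "primitive_idempotent A e"
    and rep: "represents_left_ideal A e P \<theta>"
begin

lemma e: "e \<in> carrier A" "e \<noteq> \<zero>\<^bsub>A\<^esub>" "e \<otimes>\<^bsub>A\<^esub> e = e"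
  using prim by (auto simp: primitive_idempotent_def)

lemma \<theta>_inj: "inj_on \<theta> (carrier P)"
  and \<theta>_image: "\<theta> ` carrier P = {a \<in> carrier A. a \<otimes>\<^bsub>A\<^esub> e = a}"
  and \<theta>_add: "\<And>x y. x \<in> carrier P \<Longrightarrow> y \<in> carrier P \<Longrightarrow> \<theta> (x \<oplus>\<^bsub>P\<^esub> y) = \<theta> x \<oplus>\<^bsub>A\<^esub> \<theta> y"
  and \<theta>_smult: "\<And>a x. a \<in> carrier A \<Longrightarrow> x \<in> carrier P \<Longrightarrow> \<theta> (a \<odot>\<^bsub>P\<^esub> x) = a \<otimes>\<^bsub>A\<^esub> \<theta> x"
  using rep by (auto simp: represents_left_ideal_def)

lemma \<theta>_closed: "x \<in> carrier P \<Longrightarrow> \<theta> x \<in> carrier A" and \<theta>_e: "x \<in> carrier P \<Longrightarrow> \<theta> x \<otimes>\<^bsub>A\<^esub> e = \<theta> x"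
  using \<theta>_image by blast+

lemma \<theta>_eq_iff: "x \<in> carrier P \<Longrightarrow> y \<in> carrier P \<Longrightarrow> \<theta> x = \<theta> y \<longleftrightarrow> x = y"
  using \<theta>_inj by (simp add: inj_on_eq_iff)

lemma \<theta>_surj:
  assumes "a \<in> carrier A" "a \<otimes>\<^bsub>A\<^esub> e = a" shows "\<exists>x\<in>carrier P. \<theta> x = a"
proof -
  have "a \<in> \<theta> ` carrier P" unfolding \<theta>_image using assms by simp
  then show ?thesis by auto
qed

definition generator :: "(nat \<Rightarrow> 'a) set" where "generator = inv_into (carrier P) \<theta> e"

lemma generator: "generator \<in> carrier P" "\<theta> generator = e"
proof -
  have "e \<in> \<theta> ` carrier P" using \<theta>_surj[of e] e by (auto simp: image_iff)
  then show "generator \<in> carrier P" "\<theta> generator = e"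
    unfolding generator_def by (auto intro: inv_into_into f_inv_into_f)
qed

lemma generates: "x \<in> carrier P \<Longrightarrow> x = \<theta> x \<odot>\<^bsub>P\<^esub> generator"
  using \<theta>_eq_iff[of x "\<theta> x \<odot>\<^bsub>P\<^esub> generator"] \<theta>_smult[of "\<theta> x" generator]
  by (simp add: \<theta>_closed \<theta>_e generator)

lemma \<theta>_zero: "\<theta> \<zero>\<^bsub>P\<^esub> = \<zero>\<^bsub>A\<^esub>"
  using \<theta>_smult[of "\<zero>\<^bsub>A\<^esub>" "\<zero>\<^bsub>P\<^esub>"] \<theta>_closed[of "\<zero>\<^bsub>P\<^esub>"] by (simp add: smult_zero_left)

text \<open>Split the generator along \<open>N\<close> and \<open>N'\<close> as
  \<open>e = f + g\<close>. Then \<open>f\<close> is an idempotent of eAe, so primitivity makes one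
  part zero and puts the generator into the other summand.\<close>

lemma indecomposable: "indecomposable A P"
  unfolding indecomposable_def
proof (intro conjI allI impI)
  show "carrier P \<noteq> {\<zero>\<^bsub>P\<^esub>}" using generator \<theta>_zero e by force
  fix N N' assume *: "internal_direct_sum A P N N'"
  then have N: "submodule N A P" and N': "submodule N' A P" and sum: "N <+>\<^bsub>P\<^esub> N' = carrier P"
    and int: "N \<inter> N' = {\<zero>\<^bsub>P\<^esub>}" by (auto simp: internal_direct_sum_def)
  have "generator \<in> N <+>\<^bsub>P\<^esub> N'" using generator sum by simp
  then obtain x y where xy: "x \<in> N" "y \<in> N'" "generator = x \<oplus>\<^bsub>P\<^esub> y" by (auto simp: mem_set_add)
  have c: "x \<in> carrier P" "y \<in> carrier P" using xy submodule_closed(1) N N' by auto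
  define f g where "f = \<theta> x" and "g = \<theta> y"
  have fg: "f \<in> carrier A" "g \<in> carrier A" "f \<otimes>\<^bsub>A\<^esub> e = f" "g \<otimes>\<^bsub>A\<^esub> e = g" "e = f \<oplus>\<^bsub>A\<^esub> g"
    using c \<theta>_closed \<theta>_e \<theta>_add[of x y] xy generator by (auto simp: f_def g_def)
  have ffg: "f \<otimes>\<^bsub>A\<^esub> f \<oplus>\<^bsub>A\<^esub> f \<otimes>\<^bsub>A\<^esub> g = f"
    using fg A.r_distr[of f g f] by simp
  have gfg: "g \<otimes>\<^bsub>A\<^esub> f \<oplus>\<^bsub>A\<^esub> g \<otimes>\<^bsub>A\<^esub> g = g"
    using fg A.r_distr[of f g g] by simp
  \<comment> \<open>\<open>f y = x - f x\<close> lies in \<open>N\<close> because \<open>x\<close>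
    does, and in \<open>N'\<close> because \<open>y\<close> does; hence it vanishes, which gives
    \<open>f g = 0\<close>. The product \<open>g f\<close> vanishes in the same way.\<close>
  have "f \<odot>\<^bsub>P\<^esub> y \<in> N"
  proof -
    have "\<theta> (f \<odot>\<^bsub>P\<^esub> x \<oplus>\<^bsub>P\<^esub> f \<odot>\<^bsub>P\<^esub> y) = \<theta> x"
      using c fg(1,2) ffg by (simp add: \<theta>_add \<theta>_smult f_def[symmetric] g_def[symmetric])
    then have "f \<odot>\<^bsub>P\<^esub> x \<oplus>\<^bsub>P\<^esub> f \<odot>\<^bsub>P\<^esub> y = x" using \<theta>_eq_iff c fg by simp
    then have "f \<odot>\<^bsub>P\<^esub> y = x \<ominus>\<^bsub>P\<^esub> f \<odot>\<^bsub>P\<^esub> x"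
      using c fg add_diff_cancel[of "f \<odot>\<^bsub>P\<^esub> y" "f \<odot>\<^bsub>P\<^esub> x"] by (simp add: M.a_comm)
    then show ?thesis using submodule_minus[OF N xy(1)] submodule_closed(4)[OF N fg(1) xy(1)] by simp
  qed
  moreover have "f \<odot>\<^bsub>P\<^esub> y \<in> N'" using submodule_closed(4)[OF N' fg(1) xy(2)] .
  ultimately have "f \<odot>\<^bsub>P\<^esub> y = \<zero>\<^bsub>P\<^esub>" using int by blast
  then have fg0: "f \<otimes>\<^bsub>A\<^esub> g = \<zero>\<^bsub>A\<^esub>" using \<theta>_smult[OF fg(1) c(2)] \<theta>_zero by (simp add: g_def)
  have "g \<odot>\<^bsub>P\<^esub> x \<in> N'"
  proof -
    have "\<theta> (g \<odot>\<^bsub>P\<^esub> x \<oplus>\<^bsub>P\<^esub> g \<odot>\<^bsub>P\<^esub> y) = \<theta> y"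
      using c fg(1,2) gfg by (simp add: \<theta>_add \<theta>_smult f_def[symmetric] g_def[symmetric])
    then have "g \<odot>\<^bsub>P\<^esub> x \<oplus>\<^bsub>P\<^esub> g \<odot>\<^bsub>P\<^esub> y = y" using \<theta>_eq_iff c fg by simp
    then have "g \<odot>\<^bsub>P\<^esub> x = y \<ominus>\<^bsub>P\<^esub> g \<odot>\<^bsub>P\<^esub> y"
      using c fg add_diff_cancel[of "g \<odot>\<^bsub>P\<^esub> x" "g \<odot>\<^bsub>P\<^esub> y"] by simp
    then show ?thesis using submodule_minus[OF N' xy(2)] submodule_closed(4)[OF N' fg(2) xy(2)] by simp
  qed
  moreover have "g \<odot>\<^bsub>P\<^esub> x \<in> N" using submodule_closed(4)[OF N fg(2) xy(1)] .
  ultimately have "g \<odot>\<^bsub>P\<^esub> x = \<zero>\<^bsub>P\<^esub>" using int by blast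
  then have gf0: "g \<otimes>\<^bsub>A\<^esub> f = \<zero>\<^bsub>A\<^esub>" using \<theta>_smult[OF fg(2) c(1)] \<theta>_zero by (simp add: f_def)
  have ff: "f \<otimes>\<^bsub>A\<^esub> f = f" using ffg fg0 fg(1) by simp
  have ef: "e \<otimes>\<^bsub>A\<^esub> f = f" using fg(1,2,5) A.l_distr[of f g f] ff gf0 by simp
  have disj: "f = \<zero>\<^bsub>A\<^esub> \<or> f = e" using prim fg(1,3) ff ef unfolding primitive_idempotent_def by blast
  have gen: "K = carrier P" if K: "submodule K A P" "generator \<in> K" for K
  proof -
    have "x \<in> K" if "x \<in> carrier P" for x
      using generates[OF that] submodule_closed(4)[OF K(1) \<theta>_closed[OF that] K(2)] by simp
    then show ?thesis using submodule_closed(1)[OF K(1)] by blast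
  qed
  show "N = {\<zero>\<^bsub>P\<^esub>} \<or> N' = {\<zero>\<^bsub>P\<^esub>}"
  proof (cases "f = \<zero>\<^bsub>A\<^esub>")
    case True
    then have "x = \<zero>\<^bsub>P\<^esub>" using \<theta>_eq_iff[of x "\<zero>\<^bsub>P\<^esub>"] c \<theta>_zero by (simp add: f_def)
    then have "generator = y" using xy c by simp
    then have "N' = carrier P" using gen[OF N'] xy by simp
    then show ?thesis using int submodule_closed(1)[OF N] by auto
  next
    case False
    then have "f = e" using disj by simp
    then have "x = generator" using \<theta>_eq_iff[of x generator] c generator by (simp add: f_def)
    then have "N = carrier P" using gen[OF N] xy by simp
    then show ?thesis using int submodule_closed(1)[OF N'] by auto
  qed
qed

lemma hom_exists:
  assumes X: "left_module A X" and x: "x \<in> carrier X"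
  shows "(\<lambda>w. \<theta> w \<odot>\<^bsub>X\<^esub> x) \<in> module_hom A P X"
proof -
  interpret X: left_module A X by (rule X)
  show ?thesis
    by (rule module_homI)
      (simp_all add: x \<theta>_closed \<theta>_add \<theta>_smult X.smult_l_distr X.smult_assoc1)
qed

text \<open>A homomorphism out of Ae is determined by the image of the generator. Any preimage
  \<open>x\<close> of that image under \<open>p\<close> gives the lift that sends \<open>a\<close>
  to \<open>a x\<close>.\<close>

lemma projective:
  assumes "fg_module A P" shows "projective A P"
  unfolding projective_def
proof (intro conjI allI ballI impI assms)
  fix X Y :: "'a fg_object" and p f
  assume p: "p \<in> module_hom A X Y" and f: "f \<in> module_hom A P Y"
    and *: "fg_module A X \<and> fg_module A Y \<and> p ` carrier X = carrier Y"
  interpret p: module_morphism A X Y p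
    using * p by (intro module_morphismI) (auto simp: fg_module_def)
  interpret f: module_morphism A P Y f
    using * f by (intro module_morphismI left_module_axioms) (auto simp: fg_module_def)
  have "f generator \<in> p ` carrier X" using * generator f.hom_closed by simp
  then obtain x where x: "x \<in> carrier X" "p x = f generator" by auto
  have "p (\<theta> w \<odot>\<^bsub>X\<^esub> x) = f w" if w: "w \<in> carrier P" for w
  proof -
    have "p (\<theta> w \<odot>\<^bsub>X\<^esub> x) = f (\<theta> w \<odot>\<^bsub>P\<^esub> generator)"
      using x w generator by (simp add: p.hom_smult f.hom_smult \<theta>_closed)
    then show ?thesis using generates[OF w] by simp
  qed
  then show "\<exists>g\<in>module_hom A P X. \<forall>x\<in>carrier P. p (g x) = f x"
    using hom_exists[OF p.M.left_module_axioms x(1)]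
    by (intro bexI[of _ "\<lambda>w. \<theta> w \<odot>\<^bsub>X\<^esub> x"] ballI)
qed

end

lemma ex_left_ideal_module:
  fixes A :: "('a, 'x) ring_scheme"
  assumes "ring A" "primitive_idempotent A e"
  shows "\<exists>P \<theta>. left_ideal_module A P e \<theta> \<and> projective A P \<and> indecomposable A P"
proof -
  obtain P \<theta> where P: "fg_module A P" "represents_left_ideal A e P \<theta>"
    using ex_represents_left_ideal[OF assms(1), of e] assms(2) by (auto simp: primitive_idempotent_def)
  then interpret left_ideal_module A P e \<theta>
    using assms(2)
    by (simp add: left_ideal_module_def left_ideal_module_axioms_def lmod_def fg_module_def)
  show ?thesis using projective[OF P(1)] indecomposable left_ideal_module_axioms by blast
qed

section \<open>Perpendicular submodules\<close>

text \<open>Equality is allowed, since taking perpendiculars or intersecting with a submodule may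
  collapse a cover; in this form the relation survives both operations.\<close>

definition weakly_covers ::
    "('a, 'x) ring_scheme \<Rightarrow> ('a, 'm, 'y) module_scheme \<Rightarrow> 'm set \<Rightarrow> 'm set \<Rightarrow> bool" where
  "weakly_covers A M X X' \<longleftrightarrow> submodule X A M \<and> submodule X' A M \<and> X \<subseteq> X' \<and>
     (\<forall>Z. submodule Z A M \<and> X \<subseteq> Z \<and> Z \<subseteq> X' \<longrightarrow> Z = X \<or> Z = X')"

abbreviation cover_chain where "cover_chain A M \<equiv> (weakly_covers A M)\<^sup>*\<^sup>*"

context left_module
begin

lemma weakly_coversD:
  assumes "weakly_covers A M X X'"
  shows "submodule X A M" "submodule X' A M" "X \<subseteq> X'"
    and "\<And>Z. submodule Z A M \<Longrightarrow> X \<subseteq> Z \<Longrightarrow> Z \<subseteq> X' \<Longrightarrow> Z = X \<or> Z = X'"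
  using assms unfolding weakly_covers_def by simp_all

text \<open>For \<open>Z\<close> in the smaller interval, adding \<open>X\<close> gives one of the
  two ends of the larger interval, and intersecting with \<open>N\<close> returns \<open>Z\<close>
  by the modular law.\<close>

lemma weakly_covers_Int:
  assumes c: "weakly_covers A M X X'" and N: "submodule N A M"
  shows "weakly_covers A M (X \<inter> N) (X' \<inter> N)"
proof -
  note X = weakly_coversD[OF c]
  have "Z = X \<inter> N \<or> Z = X' \<inter> N" if Z: "submodule Z A M" "X \<inter> N \<subseteq> Z" "Z \<subseteq> X' \<inter> N" for Z
  proof -
    note up = set_add_upper[OF X(1) Z(1)]
    have "X <+>\<^bsub>M\<^esub> Z \<subseteq> X'" using X Z by (intro set_add_least) auto
    then consider "X <+>\<^bsub>M\<^esub> Z = X" | "X <+>\<^bsub>M\<^esub> Z = X'"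
      using X(4)[OF submodule_set_add[OF X(1) Z(1)] up(1)] by auto
    then show ?thesis
    proof cases
      case 1
      then show ?thesis using up Z by auto
    next
      case 2
      have "N \<inter> (Z <+>\<^bsub>M\<^esub> X) = Z <+>\<^bsub>M\<^esub> (N \<inter> X)" by (rule modular_law[OF Z(1) X(1) N]) (use Z in auto)
      also have "\<dots> = Z" using Z(2) by (intro set_add_absorb Z submodule_Int N X) auto
      finally show ?thesis using 2 set_add_commute[OF X(1) Z(1)] by auto
    qed
  qed
  then show ?thesis unfolding weakly_covers_def using X(3) submodule_Int[OF X(1) N] submodule_Int[OF X(2) N] by auto
qed

lemma cover_chain_Int:
  assumes "cover_chain A M X X'" "submodule N A M"
  shows "cover_chain A M (X \<inter> N) (X' \<inter> N)"
  using assms(1)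
proof (induction rule: rtranclp_induct)
  case (step Y Z)
  then show ?case using weakly_covers_Int[OF step(2) assms(2)] by (auto intro: rtranclp.rtrancl_into_rtrancl)
qed simp

text \<open>Equality in \<open>M\<close> modulo \<open>Z\<close>, stated for elements. Membership in
  the carrier is part of it, so that chains of congruences carry their own side conditions.\<close>

definition congruent_mod :: "'c set \<Rightarrow> 'c \<Rightarrow> 'c \<Rightarrow> bool" where
  "congruent_mod Z x y \<longleftrightarrow> x \<in> carrier M \<and> y \<in> carrier M \<and> x \<ominus>\<^bsub>M\<^esub> y \<in> Z"

context
  fixes Z assumes Z: "submodule Z A M"
begin

lemma congruent_mod_sym: "congruent_mod Z x y \<Longrightarrow> congruent_mod Z y x"
  unfolding congruent_mod_def
  using submodule_minus[OF Z submodule_closed(2)[OF Z], of "x \<ominus>\<^bsub>M\<^esub> y"]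
  by (simp add: a_minus_def M.minus_add M.minus_minus M.a_comm)

lemma congruent_mod_add:
  assumes "congruent_mod Z x y" "congruent_mod Z u v"
  shows "congruent_mod Z (x \<oplus>\<^bsub>M\<^esub> u) (y \<oplus>\<^bsub>M\<^esub> v)"
proof -
  have c: "x \<in> carrier M" "y \<in> carrier M" "u \<in> carrier M" "v \<in> carrier M"
    using assms by (simp_all add: congruent_mod_def)
  have "(x \<oplus>\<^bsub>M\<^esub> u) \<ominus>\<^bsub>M\<^esub> (y \<oplus>\<^bsub>M\<^esub> v) = (x \<ominus>\<^bsub>M\<^esub> y) \<oplus>\<^bsub>M\<^esub> (u \<ominus>\<^bsub>M\<^esub> v)"
    using c by (simp add: a_minus_def M.minus_add M.a_ac)
  then show ?thesis using assms c submodule_closed(3)[OF Z] by (simp add: congruent_mod_def)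
qed

lemma congruent_mod_trans:
  assumes "congruent_mod Z x y" "congruent_mod Z y z"
  shows "congruent_mod Z x z"
proof -
  have c: "x \<in> carrier M" "y \<in> carrier M" "z \<in> carrier M"
    using assms by (simp_all add: congruent_mod_def)
  have "(x \<ominus>\<^bsub>M\<^esub> y) \<oplus>\<^bsub>M\<^esub> (y \<ominus>\<^bsub>M\<^esub> z) = x \<ominus>\<^bsub>M\<^esub> z"
    using c by (simp add: a_minus_def M.a_assoc M.r_neg1 M.r_neg2)
  moreover have "(x \<ominus>\<^bsub>M\<^esub> y) \<oplus>\<^bsub>M\<^esub> (y \<ominus>\<^bsub>M\<^esub> z) \<in> Z"
    using assms submodule_closed(3)[OF Z] by (simp add: congruent_mod_def)
  ultimately show ?thesis using c by (simp add: congruent_mod_def)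
qed

lemma congruent_mod_smult:
  "congruent_mod Z x y \<Longrightarrow> a \<in> carrier A \<Longrightarrow> congruent_mod Z (a \<odot>\<^bsub>M\<^esub> x) (a \<odot>\<^bsub>M\<^esub> y)"
  using submodule_closed(4)[OF Z] by (simp add: congruent_mod_def smult_minus_right[symmetric])

lemma congruent_mod_zero: "z \<in> Z \<Longrightarrow> congruent_mod Z z \<zero>\<^bsub>M\<^esub>"
  using submodule_closed(1)[OF Z] by (auto simp: congruent_mod_def minus_zero)

lemma congruent_mod_mem: "congruent_mod Z x y \<Longrightarrow> y \<in> Z \<Longrightarrow> x \<in> Z"
  using submodule_mem_cancel[OF Z] by (simp add: congruent_mod_def)

end

end

text \<open>The target of the pairing is considered modulo \<open>Z\<close>. As \<open>E/Z\<close> has the simple socle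
  generated by \<open>t\<close>, it plays the role of an injective cogenerator.\<close>

locale pairing = P: left_module R P + Y: left_module R Y + E: left_module R E
  for R :: "('r, 'x) ring_scheme" and P :: "('r, 'p, 'y1) module_scheme"
    and Y :: "('r, 'n, 'y2) module_scheme" and E :: "('r, 'e, 'y3) module_scheme" +
  fixes \<beta> :: "'p \<Rightarrow> 'n \<Rightarrow> 'e" and Z :: "'e set" and t :: 'e
  assumes comm: "cring R"
    and \<beta>_closed: "\<lbrakk>w \<in> carrier P; y \<in> carrier Y\<rbrakk> \<Longrightarrow> \<beta> w y \<in> carrier E"
    and \<beta>_add_left: "\<lbrakk>w \<in> carrier P; w' \<in> carrier P; y \<in> carrier Y\<rbrakk> \<Longrightarrow> \<beta> (w \<oplus>\<^bsub>P\<^esub> w') y = \<beta> w y \<oplus>\<^bsub>E\<^esub> \<beta> w' y"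
    and \<beta>_add_right: "\<lbrakk>w \<in> carrier P; y \<in> carrier Y; y' \<in> carrier Y\<rbrakk> \<Longrightarrow> \<beta> w (y \<oplus>\<^bsub>Y\<^esub> y') = \<beta> w y \<oplus>\<^bsub>E\<^esub> \<beta> w y'"
    and \<beta>_smult_left: "\<lbrakk>r \<in> carrier R; w \<in> carrier P; y \<in> carrier Y\<rbrakk> \<Longrightarrow> \<beta> (r \<odot>\<^bsub>P\<^esub> w) y = r \<odot>\<^bsub>E\<^esub> \<beta> w y"
    and \<beta>_smult_right: "\<lbrakk>r \<in> carrier R; w \<in> carrier P; y \<in> carrier Y\<rbrakk> \<Longrightarrow> \<beta> w (r \<odot>\<^bsub>Y\<^esub> y) = r \<odot>\<^bsub>E\<^esub> \<beta> w y"
    and Z: "submodule Z R E"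
    and t: "t \<in> carrier E" "t \<notin> Z"
    and t_socle: "\<lbrakk>z \<in> carrier E; z \<notin> Z\<rbrakk> \<Longrightarrow> \<exists>r\<in>carrier R. r \<odot>\<^bsub>E\<^esub> z \<ominus>\<^bsub>E\<^esub> t \<in> Z"

lemma pairing_flip: "pairing R P Y E \<beta> Z t \<Longrightarrow> pairing R Y P E (\<lambda>y w. \<beta> w y) Z t"
  by (simp add: pairing_def pairing_axioms_def)

context pairing
begin

definition lperp :: "'p set \<Rightarrow> 'n set" where
  "lperp V = {y \<in> carrier Y. \<forall>w\<in>V. \<beta> w y \<in> Z}"

definition rperp :: "'n set \<Rightarrow> 'p set" where
  "rperp N = {w \<in> carrier P. \<forall>y\<in>N. \<beta> w y \<in> Z}"

lemma submodule_lperp: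
  assumes "V \<subseteq> carrier P" shows "submodule (lperp V) R Y"
proof (rule Y.left_submoduleI)
  note cl = E.submodule_closed[OF Z]
  show "lperp V \<subseteq> carrier Y" by (auto simp: lperp_def)
  have "\<beta> w \<zero>\<^bsub>Y\<^esub> \<in> Z" if "w \<in> carrier P" for w
  proof -
    have "\<beta> w \<zero>\<^bsub>Y\<^esub> = \<beta> w (\<zero>\<^bsub>R\<^esub> \<odot>\<^bsub>Y\<^esub> \<zero>\<^bsub>Y\<^esub>)" by (simp add: Y.smult_zero_left)
    also have "\<dots> = \<zero>\<^bsub>E\<^esub>" using that \<beta>_smult_right[of "\<zero>\<^bsub>R\<^esub>" w "\<zero>\<^bsub>Y\<^esub>"] by (simp add: E.smult_zero_left \<beta>_closed)
    finally show ?thesis using cl(2) by simp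
  qed
  then show "\<zero>\<^bsub>Y\<^esub> \<in> lperp V" using assms by (auto simp: lperp_def)
  show "x \<oplus>\<^bsub>Y\<^esub> y \<in> lperp V" if "x \<in> lperp V" "y \<in> lperp V" for x y
    using that cl(3) assms by (simp add: lperp_def \<beta>_add_right subset_iff)
  show "a \<odot>\<^bsub>Y\<^esub> x \<in> lperp V" if "a \<in> carrier R" "x \<in> lperp V" for a x
    using that cl(4) assms by (simp add: lperp_def \<beta>_smult_right subset_iff)
qed

text \<open>If \<open>w\<close> lies in \<open>V'\<close> but not in \<open>V\<close>, then
  \<open>V'\<close> is \<open>V\<close> plus the multiples of \<open>w\<close>, so an element of
  \<open>lperp V\<close> belongs to \<open>lperp V'\<close> as soon as its value at \<open>w\<close>
  is in \<open>Z\<close>. Modulo \<open>Z\<close>, these values lie in the simple socle of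
  \<open>E\<close>, so a nonzero one generates all others.\<close>

lemma weakly_covers_lperp:
  assumes c: "weakly_covers R P V V'"
  shows "weakly_covers R Y (lperp V') (lperp V)"
proof -
  note V = P.weakly_coversD[OF c]
  note cV = P.submodule_closed[OF V(1)] and cV' = P.submodule_closed[OF V(2)]
  note clZ = E.submodule_closed[OF Z]
  have split: "\<exists>v\<in>V. \<exists>s\<in>carrier R. x = v \<oplus>\<^bsub>P\<^esub> s \<odot>\<^bsub>P\<^esub> w" if w: "w \<in> V'" "w \<notin> V" and x: "x \<in> V'" for w x
  proof -
    have wP: "w \<in> carrier P" using w cV' by auto
    note s = V(1) P.submodule_cyclic[OF wP]
    have "V <+>\<^bsub>P\<^esub> P.cyclic w \<subseteq> V'" using V P.cyclic_subset[OF V(2) w(1)] by (intro P.set_add_least)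
    moreover have "V <+>\<^bsub>P\<^esub> P.cyclic w \<noteq> V" using P.set_add_upper[OF s] P.mem_cyclic[OF wP] w by auto
    ultimately have "V <+>\<^bsub>P\<^esub> P.cyclic w = V'"
      using V(4)[OF P.submodule_set_add[OF s] P.set_add_upper(1)[OF s]] by auto
    then have "x \<in> V <+>\<^bsub>P\<^esub> P.cyclic w" using x by simp
    then show ?thesis unfolding P.mem_set_add P.cyclic_def by blast
  qed
  have "U = lperp V' \<or> U = lperp V"
    if U: "submodule U R Y" "lperp V' \<subseteq> U" "U \<subseteq> lperp V" for U
  proof (rule disjCI)
    assume "U \<noteq> lperp V"
    then obtain y' where y': "y' \<in> lperp V" "y' \<notin> U" using U by blast
    show "U = lperp V'"
    proof (rule ccontr)
      assume "U \<noteq> lperp V'"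
      then obtain y where y: "y \<in> U" "y \<notin> lperp V'" using U by blast
      have cy: "y \<in> carrier Y" "y' \<in> carrier Y" "y \<in> lperp V" using y y' U by (auto simp: lperp_def)
      then obtain w where w: "w \<in> V'" "\<beta> w y \<notin> Z" using y by (auto simp: lperp_def)
      have cw: "w \<in> carrier P" using w cV' by auto
      have wV: "w \<notin> V" using w cy by (auto simp: lperp_def)
      \<comment> \<open>The multiplier is \<open>c a\<close>: both values have multiples congruent
        to \<open>t\<close>, with factors \<open>a\<close> and \<open>b\<close>; as
        \<open>b w\<close> is not in \<open>V\<close>, one can write \<open>w = v + c b w\<close>,
        so \<open>\<beta> w y'\<close> is congruent to \<open>c t\<close>, that is to
        \<open>c a \<beta> w y\<close>. If the value at \<open>y'\<close> is already in
        \<open>Z\<close>, zero will do.\<close>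
      have "\<exists>r\<in>carrier R. E.congruent_mod Z (\<beta> w y') (r \<odot>\<^bsub>E\<^esub> \<beta> w y)"
      proof (cases "\<beta> w y' \<in> Z")
        case True
        then show ?thesis using E.congruent_mod_zero[OF Z True] cw cy
          by (intro bexI[of _ "\<zero>\<^bsub>R\<^esub>"]) (simp_all add: E.smult_zero_left \<beta>_closed)
      next
        case False
        obtain a where a: "a \<in> carrier R" "a \<odot>\<^bsub>E\<^esub> \<beta> w y \<ominus>\<^bsub>E\<^esub> t \<in> Z" using t_socle[OF \<beta>_closed w(2)] cw cy by blast
        obtain b where b: "b \<in> carrier R" "b \<odot>\<^bsub>E\<^esub> \<beta> w y' \<ominus>\<^bsub>E\<^esub> t \<in> Z" using t_socle[OF \<beta>_closed False] cw cy by blast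
        have ca: "E.congruent_mod Z (a \<odot>\<^bsub>E\<^esub> \<beta> w y) t" and cb: "E.congruent_mod Z (b \<odot>\<^bsub>E\<^esub> \<beta> w y') t"
          using a b cw cy t by (simp_all add: E.congruent_mod_def \<beta>_closed)
        have "b \<odot>\<^bsub>E\<^esub> \<beta> w y' \<notin> Z" using E.congruent_mod_mem[OF Z E.congruent_mod_sym[OF Z cb]] t by auto
        then have "b \<odot>\<^bsub>P\<^esub> w \<notin> V" using y' \<beta>_smult_left[OF b(1) cw cy(2)] by (auto simp: lperp_def)
        then obtain v c where v: "v \<in> V" "c \<in> carrier R" "w = v \<oplus>\<^bsub>P\<^esub> c \<odot>\<^bsub>P\<^esub> (b \<odot>\<^bsub>P\<^esub> w)"
          using split[of "b \<odot>\<^bsub>P\<^esub> w" w] cV'(4)[OF b(1) w(1)] w(1) by blast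
        have cv: "v \<in> carrier P" using v cV by auto
        have "\<beta> w y' = \<beta> (v \<oplus>\<^bsub>P\<^esub> c \<odot>\<^bsub>P\<^esub> (b \<odot>\<^bsub>P\<^esub> w)) y'" using v(3) by simp
        also have "\<dots> = \<beta> v y' \<oplus>\<^bsub>E\<^esub> c \<odot>\<^bsub>E\<^esub> (b \<odot>\<^bsub>E\<^esub> \<beta> w y')"
          using cv v(2) b(1) cw cy by (simp add: \<beta>_add_left \<beta>_smult_left)
        finally have eq: "\<beta> w y' = \<beta> v y' \<oplus>\<^bsub>E\<^esub> c \<odot>\<^bsub>E\<^esub> (b \<odot>\<^bsub>E\<^esub> \<beta> w y')" .
        have "\<beta> v y' \<in> Z" using v(1) y'(1) by (auto simp: lperp_def)
        then have "E.congruent_mod Z (\<beta> w y') (\<zero>\<^bsub>E\<^esub> \<oplus>\<^bsub>E\<^esub> c \<odot>\<^bsub>E\<^esub> t)"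
          by (subst eq) (intro E.congruent_mod_add E.congruent_mod_zero E.congruent_mod_smult Z cb v(2))
        then have "E.congruent_mod Z (\<beta> w y') (c \<odot>\<^bsub>E\<^esub> t)" using v t by simp
        moreover have "E.congruent_mod Z (c \<odot>\<^bsub>E\<^esub> t) ((c \<otimes>\<^bsub>R\<^esub> a) \<odot>\<^bsub>E\<^esub> \<beta> w y)"
          using E.congruent_mod_smult[OF Z E.congruent_mod_sym[OF Z ca] v(2)] v(2) a(1) cw cy
          by (simp add: E.smult_assoc1 \<beta>_closed)
        ultimately show ?thesis using E.congruent_mod_trans[OF Z] v(2) a(1)
          by (intro bexI[of _ "c \<otimes>\<^bsub>R\<^esub> a"]) auto
      qed
      then obtain r where r: "r \<in> carrier R" "E.congruent_mod Z (\<beta> w y') (r \<odot>\<^bsub>E\<^esub> \<beta> w y)" by blast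
      \<comment> \<open>\<open>d\<close> is \<open>y'\<close> with its value at \<open>w\<close>
        removed; it is perpendicular to \<open>w\<close> and to \<open>V\<close>, hence to all of
        \<open>V'\<close>, and so lies in \<open>U\<close>.\<close>
      define d where "d = y' \<ominus>\<^bsub>Y\<^esub> r \<odot>\<^bsub>Y\<^esub> y"
      have cd: "d \<in> carrier Y" using cy r by (simp add: d_def)
      have yd: "y' = d \<oplus>\<^bsub>Y\<^esub> r \<odot>\<^bsub>Y\<^esub> y" unfolding d_def using cy r by (simp add: Y.minus_add_cancel)
      have "\<beta> w y' = \<beta> w d \<oplus>\<^bsub>E\<^esub> r \<odot>\<^bsub>E\<^esub> \<beta> w y"
        using yd cd cw cy r by (metis Y.smult_closed \<beta>_add_right \<beta>_smult_right)
      then have "\<beta> w d \<in> Z" using r cd cw cy by (simp add: E.congruent_mod_def E.add_diff_cancel \<beta>_closed)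
      moreover have "d \<in> lperp V"
        unfolding d_def using Y.submodule_minus[OF submodule_lperp] cV(1) y'(1) cy(3)
          Y.submodule_closed(4)[OF submodule_lperp] r by simp
      ultimately have "\<beta> x d \<in> Z" if x: "x \<in> V'" for x
      proof -
        obtain v s where v: "v \<in> V" "s \<in> carrier R" "x = v \<oplus>\<^bsub>P\<^esub> s \<odot>\<^bsub>P\<^esub> w" using split[OF w(1) wV x] by blast
        have cv: "v \<in> carrier P" using v cV by auto
        have "\<beta> x d = \<beta> v d \<oplus>\<^bsub>E\<^esub> s \<odot>\<^bsub>E\<^esub> \<beta> w d"
          using v cv cw cd by (simp add: \<beta>_add_left \<beta>_smult_left)
        moreover have "\<beta> v d \<in> Z" using v(1) \<open>d \<in> lperp V\<close> by (auto simp: lperp_def)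
        ultimately show ?thesis using \<open>\<beta> w d \<in> Z\<close> clZ(3,4) v(2) by simp
      qed
      then have "d \<in> lperp V'" using cd by (simp add: lperp_def)
      then have "d \<in> U" using U by blast
      moreover have "r \<odot>\<^bsub>Y\<^esub> y \<in> U" using Y.submodule_closed(4)[OF U(1) r(1) y(1)] .
      ultimately have "y' \<in> U" unfolding yd by (rule Y.submodule_closed(3)[OF U(1)])
      then show False using y' by simp
    qed
  qed
  moreover have "lperp V' \<subseteq> lperp V" using V(3) by (auto simp: lperp_def)
  ultimately show ?thesis unfolding weakly_covers_def
    using submodule_lperp[OF cV(1)] submodule_lperp[OF cV'(1)] by blast
qed

lemma cover_chain_lperp:
  assumes "cover_chain R P V V'"
  shows "cover_chain R Y (lperp V') (lperp V)"
  using assms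
proof (induction rule: rtranclp_induct)
  case (step U U')
  then show ?case using weakly_covers_lperp[OF step(2)] by (auto intro: converse_rtranclp_into_rtranclp)
qed simp

lemma subset_rperp_lperp: "V \<subseteq> carrier P \<Longrightarrow> V \<subseteq> rperp (lperp V)"
  by (auto simp: rperp_def lperp_def)

lemma lperp_antimono: "V \<subseteq> V' \<Longrightarrow> lperp V' \<subseteq> lperp V"
  by (auto simp: lperp_def)

end

context pairing
begin

interpretation flip: pairing R Y P E "\<lambda>y w. \<beta> w y" Z t
  by (rule pairing_flip) (rule pairing_axioms)

lemma flip_perp: "flip.lperp = rperp" "flip.rperp = lperp"
  by (auto simp: flip.lperp_def flip.rperp_def lperp_def rperp_def fun_eq_iff)

lemma lperp_rperp_lperp: "V \<subseteq> carrier P \<Longrightarrow> lperp (rperp (lperp V)) = lperp V"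
  using flip.subset_rperp_lperp[of "lperp V"] lperp_antimono[OF subset_rperp_lperp, of V]
  unfolding flip_perp by (auto simp: lperp_def)

lemma submodule_rperp: "N \<subseteq> carrier Y \<Longrightarrow> submodule (rperp N) R P"
  using flip.submodule_lperp unfolding flip_perp .

lemma rperp_antimono: "N \<subseteq> N' \<Longrightarrow> rperp N' \<subseteq> rperp N"
  using flip.lperp_antimono unfolding flip_perp .

text \<open>Taking perpendiculars twice preserves weak covers, hence cannot jump over \<open>V'\<close>.\<close>

lemma closed_weakly_covers:
  assumes c: "weakly_covers R P V V'" and cl: "rperp (lperp V) = V"
  shows "rperp (lperp V') = V'"
proof -
  note V = P.weakly_coversD[OF c]
  have "weakly_covers R P (rperp (lperp V)) (rperp (lperp V'))"
    using flip.weakly_covers_lperp[OF weakly_covers_lperp[OF c]] unfolding flip_perp .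
  note d = P.weakly_coversD[OF this, unfolded cl]
  have "V' \<subseteq> rperp (lperp V')" using subset_rperp_lperp P.submodule_closed(1)[OF V(2)] .
  then have "V' = V \<or> V' = rperp (lperp V')" using d(4)[OF V(2,3)] by simp
  then show ?thesis using cl by auto
qed

lemma closed_cover_chain:
  assumes "cover_chain R P V V'" "rperp (lperp V) = V"
  shows "rperp (lperp V') = V'"
  using assms(1)
proof (induction rule: rtranclp_induct)
  case base show ?case by (rule assms(2))
next
  case (step U U') show ?case by (rule closed_weakly_covers[OF step.hyps(2) step.IH])
qed

text \<open>Intersecting the chain with \<open>V\<close> gives a chain from \<open>K\<close> to
  \<open>V\<close>, along which closedness is inherited.\<close>

lemma closed_above:
  assumes ch: "cover_chain R P K (carrier P)" and K: "rperp (lperp K) = K"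
    and V: "submodule V R P" "K \<subseteq> V"
  shows "rperp (lperp V) = V"
proof -
  have "cover_chain R P (K \<inter> V) (carrier P \<inter> V)" by (rule P.cover_chain_Int[OF ch V(1)])
  moreover have "K \<inter> V = K" "carrier P \<inter> V = V" using V P.submodule_closed(1)[OF V(1)] by auto
  ultimately show ?thesis using closed_cover_chain K by simp
qed

end

section \<open>Perpendiculars as mutually inverse maps\<close>

context pairing
begin

interpretation flip: pairing R Y P E "\<lambda>y w. \<beta> w y" Z t
  by (rule pairing_flip) (rule pairing_axioms)

text \<open>The chain in \<open>P\<close> has perpendiculars that form a chain in \<open>Y\<close>
  from \<open>lperp (carrier P)\<close> to the top. Its bottom, being a perpendicular, is closed,
  and so is everything above it. Taking perpendiculars once more gives the same for
  \<open>P\<close>.\<close>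

lemma double_perp:
  assumes ch: "cover_chain R P {\<zero>\<^bsub>P\<^esub>} (carrier P)"
  shows "\<And>N. submodule N R Y \<Longrightarrow> lperp (carrier P) \<subseteq> N \<Longrightarrow> lperp (rperp N) = N"
    and "\<And>V. submodule V R P \<Longrightarrow> rperp (carrier Y) \<subseteq> V \<Longrightarrow> rperp (lperp V) = V"
proof -
  have "rperp (carrier Y) \<subseteq> carrier P" "lperp (carrier P) \<subseteq> carrier Y"
    by (auto simp: rperp_def lperp_def)
  have "lperp {\<zero>\<^bsub>P\<^esub>} = carrier Y"
    using P.submodule_closed(2)[OF submodule_rperp[OF subset_refl]] by (auto simp: lperp_def rperp_def)
  then have chY: "cover_chain R Y (lperp (carrier P)) (carrier Y)"
    using cover_chain_lperp[OF ch] by simp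
  have eqY: "lperp (rperp (lperp (carrier P))) = lperp (carrier P)" by (rule lperp_rperp_lperp) simp
  show "lperp (rperp N) = N" if "submodule N R Y" "lperp (carrier P) \<subseteq> N" for N
    using flip.closed_above[OF chY] eqY that unfolding flip_perp by simp
  have "rperp (lperp (carrier P)) = carrier P"
    using subset_rperp_lperp[of "carrier P"] by (auto simp: rperp_def)
  then have chP: "cover_chain R P (rperp (carrier Y)) (carrier P)"
    using flip.cover_chain_lperp[OF chY] unfolding flip_perp by simp
  have eqP: "rperp (lperp (rperp (carrier Y))) = rperp (carrier Y)"
    using flip.lperp_rperp_lperp[of "carrier Y"] unfolding flip_perp by simp
  show "rperp (lperp V) = V" if "submodule V R P" "rperp (carrier Y) \<subseteq> V" for V
    by (rule closed_above[OF chP eqP that])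
qed

end

section \<open>Restriction of scalars\<close>

text \<open>Left modules over \<open>A\<close> and over its opposite have to meet as modules over
  the commutative ring \<open>R\<close>, where the pairing lives.\<close>

definition restrict_scalars :: "('r, 'a, 'y) module_scheme \<Rightarrow> ('a, 'm) module \<Rightarrow> ('r, 'm) module" where
  "restrict_scalars A M = \<lparr>carrier = carrier M, mult = mult M, one = one M, zero = zero M, add = add M,
     smult = (\<lambda>r x. (r \<odot>\<^bsub>A\<^esub> \<one>\<^bsub>A\<^esub>) \<odot>\<^bsub>M\<^esub> x)\<rparr>"

lemma restrict_scalars_simps [simp]:
  "carrier (restrict_scalars A M) = carrier M" "zero (restrict_scalars A M) = zero M"
  "add (restrict_scalars A M) = add M"
  "r \<odot>\<^bsub>restrict_scalars A M\<^esub> x = (r \<odot>\<^bsub>A\<^esub> \<one>\<^bsub>A\<^esub>) \<odot>\<^bsub>M\<^esub> x"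
  by (simp_all add: restrict_scalars_def)

locale artin_algebra_module = alg: artin_algebra R A + lmod A M
  for R :: "('r, 'x) ring_scheme" and A :: "('r, 'a, 'y) module_scheme" and M :: "('a, 'm) module"
begin

abbreviation emb :: "'r \<Rightarrow> 'a" where "emb r \<equiv> r \<odot>\<^bsub>A\<^esub> \<one>\<^bsub>A\<^esub>"

lemma emb_central: "r \<in> carrier R \<Longrightarrow> a \<in> carrier A \<Longrightarrow> a \<otimes>\<^bsub>A\<^esub> emb r = emb r \<otimes>\<^bsub>A\<^esub> a"
  by (simp add: alg.smult_mult_left alg.smult_mult_right)

lemma emb_smult_commute:
  "r \<in> carrier R \<Longrightarrow> a \<in> carrier A \<Longrightarrow> x \<in> carrier M \<Longrightarrow> a \<odot>\<^bsub>M\<^esub> (emb r \<odot>\<^bsub>M\<^esub> x) = emb r \<odot>\<^bsub>M\<^esub> (a \<odot>\<^bsub>M\<^esub> x)"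
  by (simp add: smult_assoc1[symmetric] emb_central)

lemma emb_mult: "r \<in> carrier R \<Longrightarrow> s \<in> carrier R \<Longrightarrow> emb (r \<otimes>\<^bsub>R\<^esub> s) = emb r \<otimes>\<^bsub>A\<^esub> emb s"
  by (simp add: alg.smult_mult_left alg.smult_assoc1)

lemma left_module_restrict_scalars: "left_module R (restrict_scalars A M)"
proof -
  have "abelian_group (restrict_scalars A M)"
    by (rule abelian_groupI) (auto simp: M.a_ac intro: M.add.l_inv_ex)
  then show ?thesis
    by (intro left_module.intro left_module_axioms.intro alg.R.ring_axioms)
      (simp_all add: alg.smult_l_distr smult_l_distr smult_r_distr emb_mult smult_assoc1 del: alg.smult_assoc1)
qed

sublocale RM: left_module R "restrict_scalars A M"
  by (rule left_module_restrict_scalars)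

lemma submodule_restrict_scalars:
  assumes "submodule N A M" shows "submodule N R (restrict_scalars A M)"
  by (rule RM.left_submoduleI) (use submodule_closed[OF assms] in auto)

text \<open>The factor \<open>V'/V\<close> is simple, so each \<open>r \<in> R\<close> acts on it as zero or bijectively, and since
  \<open>R\<close> is artinian, the inverse is again the action of an element of \<open>R\<close>.\<close>

lemma ex_inverse_action:
  assumes c: "covers A M V V'" and r: "r \<in> carrier R" and u: "u \<in> V'" "emb r \<odot>\<^bsub>M\<^esub> u \<notin> V"
  shows "\<exists>s\<in>carrier R. \<forall>v\<in>V'. v \<ominus>\<^bsub>M\<^esub> emb s \<odot>\<^bsub>M\<^esub> (emb r \<odot>\<^bsub>M\<^esub> v) \<in> V"
proof -
  have V: "submodule V A M" and V': "submodule V' A M" and VV': "V \<subset> V'" using c by (auto simp: covers_def)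
  note cl = submodule_closed[OF V] and cl' = submodule_closed[OF V']
  \<comment> \<open>The part of \<open>V'\<close> reached by \<open>r\<close> modulo
    \<open>V\<close>. It is an \<open>A\<close>-submodule because \<open>r\<close> acts centrally,
    and it contains \<open>r u\<close> outside \<open>V\<close>, so by the cover it is all of
    \<open>V'\<close>.\<close>
  define D where "D = {v \<in> V'. \<exists>v'\<in>V'. v \<ominus>\<^bsub>M\<^esub> emb r \<odot>\<^bsub>M\<^esub> v' \<in> V}"
  have D: "submodule D A M"
  proof (rule left_submoduleI)
    show "D \<subseteq> carrier M" using cl' by (auto simp: D_def)
    show "\<zero>\<^bsub>M\<^esub> \<in> D" unfolding D_def using cl(2) cl'(2) r
      by (auto simp: smult_zero_right minus_zero intro!: bexI[of _ "\<zero>\<^bsub>M\<^esub>"])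
    fix x y assume "x \<in> D" "y \<in> D"
    then obtain x' y' where *: "x \<in> V'" "y \<in> V'" "x' \<in> V'" "y' \<in> V'"
      "x \<ominus>\<^bsub>M\<^esub> emb r \<odot>\<^bsub>M\<^esub> x' \<in> V" "y \<ominus>\<^bsub>M\<^esub> emb r \<odot>\<^bsub>M\<^esub> y' \<in> V" by (auto simp: D_def)
    then have cc: "x \<in> carrier M" "y \<in> carrier M" "x' \<in> carrier M" "y' \<in> carrier M" using cl'(1) by auto
    have "congruent_mod V (x \<oplus>\<^bsub>M\<^esub> y) (emb r \<odot>\<^bsub>M\<^esub> x' \<oplus>\<^bsub>M\<^esub> emb r \<odot>\<^bsub>M\<^esub> y')"
      using * cc r by (intro congruent_mod_add V) (simp_all add: congruent_mod_def)
    then have "(x \<oplus>\<^bsub>M\<^esub> y) \<ominus>\<^bsub>M\<^esub> emb r \<odot>\<^bsub>M\<^esub> (x' \<oplus>\<^bsub>M\<^esub> y') \<in> V"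
      using cc r by (simp add: congruent_mod_def smult_r_distr)
    then show "x \<oplus>\<^bsub>M\<^esub> y \<in> D" using * cl'(3) by (auto simp: D_def)
  next
    fix a x assume a: "a \<in> carrier A" and "x \<in> D"
    then obtain x' where *: "x \<in> V'" "x' \<in> V'" "x \<ominus>\<^bsub>M\<^esub> emb r \<odot>\<^bsub>M\<^esub> x' \<in> V" by (auto simp: D_def)
    then have cc: "x \<in> carrier M" "x' \<in> carrier M" using cl'(1) by auto
    have "a \<odot>\<^bsub>M\<^esub> (x \<ominus>\<^bsub>M\<^esub> emb r \<odot>\<^bsub>M\<^esub> x') \<in> V" using cl(4)[OF a *(3)] .
    then have "a \<odot>\<^bsub>M\<^esub> x \<ominus>\<^bsub>M\<^esub> emb r \<odot>\<^bsub>M\<^esub> (a \<odot>\<^bsub>M\<^esub> x') \<in> V"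
      using cc a r by (simp add: smult_minus_right emb_smult_commute)
    then show "a \<odot>\<^bsub>M\<^esub> x \<in> D" using * cl'(4)[OF a] by (auto simp: D_def)
  qed
  have "V \<subseteq> D"
  proof
    fix x assume x: "x \<in> V"
    then have "x \<in> carrier M" using cl by auto
    then have "x \<ominus>\<^bsub>M\<^esub> emb r \<odot>\<^bsub>M\<^esub> \<zero>\<^bsub>M\<^esub> \<in> V" using x r by (simp add: smult_zero_right minus_zero)
    then show "x \<in> D" unfolding D_def using x VV' cl'(2) by blast
  qed
  moreover have "D \<subseteq> V'" by (auto simp: D_def)
  moreover have "D \<noteq> V"
  proof -
    have uc: "u \<in> carrier M" using u cl' by auto
    have "emb r \<odot>\<^bsub>M\<^esub> u \<ominus>\<^bsub>M\<^esub> emb r \<odot>\<^bsub>M\<^esub> u = \<zero>\<^bsub>M\<^esub>" using uc r by (simp add: minus_eq_zero_iff)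
    then have "emb r \<odot>\<^bsub>M\<^esub> u \<ominus>\<^bsub>M\<^esub> emb r \<odot>\<^bsub>M\<^esub> u \<in> V" using cl(2) by simp
    then have "emb r \<odot>\<^bsub>M\<^esub> u \<in> D" unfolding D_def using u(1) cl'(4)[of "emb r" u] r by blast
    then show ?thesis using u by auto
  qed
  ultimately have "D = V'" using c D unfolding covers_def by blast
  then have step: "\<exists>v'\<in>V'. v \<ominus>\<^bsub>M\<^esub> emb r \<odot>\<^bsub>M\<^esub> v' \<in> V" if "v \<in> V'" for v using that by (auto simp: D_def)
  have pow: "r [^]\<^bsub>R\<^esub> (n::nat) \<in> carrier R" for n using r by simp
  \<comment> \<open>Iterated surjectivity: modulo \<open>V\<close>, every \<open>v\<close> is
    divisible by each power of \<open>r\<close>. The principal ideals of the powers become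
    stationary, so \<open>r ^ m = s r ^ (m + 1)\<close> for some \<open>m\<close> and
    \<open>s\<close>, and on elements divisible by \<open>r ^ m\<close> the scalar \<open>s\<close>
    undoes \<open>r\<close>.\<close>
  have powers: "\<exists>v'\<in>V'. v \<ominus>\<^bsub>M\<^esub> emb (r [^]\<^bsub>R\<^esub> (n::nat)) \<odot>\<^bsub>M\<^esub> v' \<in> V" if "v \<in> V'" for v n
    using that
  proof (induction n arbitrary: v)
    case 0
    then have "v \<in> carrier M" using cl' by auto
    then have "v \<ominus>\<^bsub>M\<^esub> emb (r [^]\<^bsub>R\<^esub> (0::nat)) \<odot>\<^bsub>M\<^esub> v = \<zero>\<^bsub>M\<^esub>" by (simp add: minus_eq_zero_iff)
    then show ?case using 0 cl(2) by (intro bexI[of _ v]) simp_all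
  next
    case (Suc n)
    obtain v1 where v1: "v1 \<in> V'" "v \<ominus>\<^bsub>M\<^esub> emb (r [^]\<^bsub>R\<^esub> n) \<odot>\<^bsub>M\<^esub> v1 \<in> V" using Suc by blast
    obtain v2 where v2: "v2 \<in> V'" "v1 \<ominus>\<^bsub>M\<^esub> emb r \<odot>\<^bsub>M\<^esub> v2 \<in> V" using step v1 by blast
    have cc: "v \<in> carrier M" "v1 \<in> carrier M" "v2 \<in> carrier M" using Suc.prems v1 v2 cl' by auto
    have "congruent_mod V v (emb (r [^]\<^bsub>R\<^esub> n) \<odot>\<^bsub>M\<^esub> v1)" using v1 cc pow by (simp add: congruent_mod_def)
    moreover have "congruent_mod V (emb (r [^]\<^bsub>R\<^esub> n) \<odot>\<^bsub>M\<^esub> v1) (emb (r [^]\<^bsub>R\<^esub> n) \<odot>\<^bsub>M\<^esub> (emb r \<odot>\<^bsub>M\<^esub> v2))"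
      using v2 cc pow r by (intro congruent_mod_smult V) (simp_all add: congruent_mod_def)
    ultimately have "congruent_mod V v (emb (r [^]\<^bsub>R\<^esub> n) \<odot>\<^bsub>M\<^esub> (emb r \<odot>\<^bsub>M\<^esub> v2))" by (rule congruent_mod_trans[OF V])
    moreover have "emb (r [^]\<^bsub>R\<^esub> n) \<odot>\<^bsub>M\<^esub> (emb r \<odot>\<^bsub>M\<^esub> v2) = emb (r [^]\<^bsub>R\<^esub> Suc n) \<odot>\<^bsub>M\<^esub> v2"
      using cc pow r emb_mult[OF pow r, of n] by (simp add: smult_assoc1)
    ultimately show ?case using v2 by (auto simp: congruent_mod_def)
  qed
  let ?I = "\<lambda>n::nat. PIdl\<^bsub>R\<^esub> (r [^]\<^bsub>R\<^esub> n)"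
  have "?I (Suc n) \<subseteq> ?I n" for n
  proof
    fix x assume "x \<in> ?I (Suc n)"
    then obtain c where "c \<in> carrier R" "x = c \<otimes>\<^bsub>R\<^esub> r [^]\<^bsub>R\<^esub> Suc n" by (auto simp: cgenideal_def)
    then have "x = (c \<otimes>\<^bsub>R\<^esub> r) \<otimes>\<^bsub>R\<^esub> r [^]\<^bsub>R\<^esub> n" "c \<otimes>\<^bsub>R\<^esub> r \<in> carrier R"
      using r pow by (simp_all add: alg.R.m_ac)
    then show "x \<in> ?I n" unfolding cgenideal_def by blast
  qed
  moreover have "ideal (?I n) R" for n using alg.R.cgenideal_ideal[OF pow] .
  ultimately have "\<exists>m. \<forall>n\<ge>m. ?I n = ?I m" 
    using alg.artinian_base[unfolded artinian_def, rule_format, of ?I] by blast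
  then obtain m where m: "?I (Suc m) = ?I m" by (metis le_SucI order_refl)
  have "r [^]\<^bsub>R\<^esub> m \<in> ?I (Suc m)" unfolding m by (rule alg.R.cgenideal_self[OF pow])
  then obtain s where s: "s \<in> carrier R" "r [^]\<^bsub>R\<^esub> m = s \<otimes>\<^bsub>R\<^esub> r [^]\<^bsub>R\<^esub> Suc m" by (auto simp: cgenideal_def)
  have "v \<ominus>\<^bsub>M\<^esub> emb s \<odot>\<^bsub>M\<^esub> (emb r \<odot>\<^bsub>M\<^esub> v) \<in> V" if v: "v \<in> V'" for v
  proof -
    obtain v' where v': "v' \<in> V'" "v \<ominus>\<^bsub>M\<^esub> emb (r [^]\<^bsub>R\<^esub> m) \<odot>\<^bsub>M\<^esub> v' \<in> V" using powers v by blast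
    have cc: "v \<in> carrier M" "v' \<in> carrier M" using v v' cl' by auto
    let ?p = "emb (r [^]\<^bsub>R\<^esub> m) \<odot>\<^bsub>M\<^esub> v'"
    have 1: "congruent_mod V v ?p" using v' cc pow by (simp add: congruent_mod_def)
    have "emb s \<odot>\<^bsub>M\<^esub> (emb r \<odot>\<^bsub>M\<^esub> ?p) = emb (s \<otimes>\<^bsub>R\<^esub> (r \<otimes>\<^bsub>R\<^esub> r [^]\<^bsub>R\<^esub> m)) \<odot>\<^bsub>M\<^esub> v'"
      using cc s r pow by (simp add: emb_mult smult_assoc1)
    also have "s \<otimes>\<^bsub>R\<^esub> (r \<otimes>\<^bsub>R\<^esub> r [^]\<^bsub>R\<^esub> m) = r [^]\<^bsub>R\<^esub> m"
      using s r pow by (simp add: alg.R.m_comm)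
    finally have eq: "emb s \<odot>\<^bsub>M\<^esub> (emb r \<odot>\<^bsub>M\<^esub> ?p) = ?p" .
    have "emb r \<in> carrier A" "emb s \<in> carrier A" using r s by simp_all
    from congruent_mod_smult[OF V congruent_mod_smult[OF V 1 this(1)] this(2)]
    have 2: "congruent_mod V (emb s \<odot>\<^bsub>M\<^esub> (emb r \<odot>\<^bsub>M\<^esub> v)) ?p" unfolding eq .
    show ?thesis using congruent_mod_trans[OF V 1 congruent_mod_sym[OF V 2]] by (simp add: congruent_mod_def)
  qed
  then show ?thesis using s by blast
qed

text \<open>A simple factor over \<open>A\<close> has finite length over \<open>R\<close>: if
  \<open>w\<close> lies in \<open>V'\<close> but not in \<open>V\<close>, then \<open>V'\<close> is
  spanned over \<open>V\<close> by the elements \<open>a w\<close>, with \<open>a\<close> from a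
  finite set of generators of \<open>A\<close> over \<open>R\<close>. They are adjoined one at a
  time.\<close>

lemma cover_chain_of_covers:
  assumes c: "covers A M V V'"
  shows "cover_chain R (restrict_scalars A M) V V'"
proof -
  have V: "submodule V A M" and V': "submodule V' A M" and VV': "V \<subset> V'" using c by (auto simp: covers_def)
  note cl' = submodule_closed[OF V']
  interpret RA: left_module R A by (rule left_module_of_module) (rule alg.module_axioms)
  obtain w where w: "w \<in> V'" "w \<notin> V" using VV' by blast
  have wM: "w \<in> carrier M" using w cl' by auto
  let ?RM = "restrict_scalars A M"
  have RV': "submodule V' R ?RM" using submodule_restrict_scalars[OF V'] .
  \<comment> \<open>A submodule that lies strictly above \<open>U\<close> contains some
    \<open>r u\<close> outside \<open>U\<close>, hence outside \<open>V\<close>, and the inverse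
    action \<open>s\<close> recovers \<open>u\<close> from it modulo \<open>V\<close>. Only a weak
    cover is claimed, as \<open>u\<close> may be in \<open>U\<close> already.\<close>
  have step: "weakly_covers R ?RM U (U <+>\<^bsub>?RM\<^esub> RM.cyclic u)"
    if U: "submodule U R ?RM" "V \<subseteq> U" "U \<subseteq> V'" and u: "u \<in> V'" for U u
  proof -
    have uM: "u \<in> carrier ?RM" using u cl' by auto
    note s = U(1) RM.submodule_cyclic[OF uM]
    note S = RM.submodule_set_add[OF s] and up = RM.set_add_upper[OF s]
    have "Z = U \<or> Z = U <+>\<^bsub>?RM\<^esub> RM.cyclic u"
      if Z: "submodule Z R ?RM" "U \<subseteq> Z" "Z \<subseteq> U <+>\<^bsub>?RM\<^esub> RM.cyclic u" for Z
    proof (cases "Z = U")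
      case False
      then obtain z where z: "z \<in> Z" "z \<notin> U" using Z by blast
      then have "z \<in> U <+>\<^bsub>?RM\<^esub> RM.cyclic u" using Z(3) by blast
      then obtain x r where xr: "x \<in> U" "r \<in> carrier R" "z = x \<oplus>\<^bsub>M\<^esub> emb r \<odot>\<^bsub>M\<^esub> u"
        by (auto simp: RM.mem_set_add RM.cyclic_def)
      have ru: "emb r \<odot>\<^bsub>M\<^esub> u \<notin> U" using z(2) xr RM.submodule_closed(3)[OF U(1), of x] by auto
      have xM: "x \<in> carrier M" using xr(1) RM.submodule_closed(1)[OF U(1)] by auto
      have rM: "emb r \<odot>\<^bsub>M\<^esub> u \<in> carrier M" using xr uM by simp
      have "(x \<oplus>\<^bsub>M\<^esub> emb r \<odot>\<^bsub>M\<^esub> u) \<in> Z" using z xr by simp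
      then have "(emb r \<odot>\<^bsub>M\<^esub> u) \<oplus>\<^bsub>M\<^esub> x \<in> Z" using M.a_comm[OF xM rM] by simp
      then have ruZ: "emb r \<odot>\<^bsub>M\<^esub> u \<in> Z"
        using RM.submodule_minus[OF Z(1), of "(emb r \<odot>\<^bsub>M\<^esub> u) \<oplus>\<^bsub>M\<^esub> x" x] xr(1) Z(2)
          RM.add_diff_cancel[of "emb r \<odot>\<^bsub>M\<^esub> u" x] xM rM by auto
      obtain s where s: "s \<in> carrier R" "u \<ominus>\<^bsub>M\<^esub> emb s \<odot>\<^bsub>M\<^esub> (emb r \<odot>\<^bsub>M\<^esub> u) \<in> V"
        using ex_inverse_action[OF c xr(2) u] ru U(2) u by blast
      have sZ: "emb s \<odot>\<^bsub>M\<^esub> (emb r \<odot>\<^bsub>M\<^esub> u) \<in> Z" using RM.submodule_closed(4)[OF Z(1) s(1) ruZ] by simp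
      have eq: "(u \<ominus>\<^bsub>M\<^esub> emb s \<odot>\<^bsub>M\<^esub> (emb r \<odot>\<^bsub>M\<^esub> u)) \<oplus>\<^bsub>M\<^esub> emb s \<odot>\<^bsub>M\<^esub> (emb r \<odot>\<^bsub>M\<^esub> u) = u"
        using uM rM s(1) by (simp add: minus_add_cancel)
      have "u \<ominus>\<^bsub>M\<^esub> emb s \<odot>\<^bsub>M\<^esub> (emb r \<odot>\<^bsub>M\<^esub> u) \<in> Z" using s(2) U(2) Z(2) by blast
      from RM.submodule_closed(3)[OF Z(1) this sZ] have "u \<in> Z" by (simp add: eq)
      then have "U <+>\<^bsub>?RM\<^esub> RM.cyclic u \<subseteq> Z" using Z RM.cyclic_subset by (intro RM.set_add_least) auto
      then show ?thesis using Z by blast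
    qed simp
    then show ?thesis unfolding weakly_covers_def using U(1) S up by blast
  qed
  obtain X where X: "finite X" "X \<subseteq> carrier A" "submodule_span R A X = carrier A"
    using alg.finitely_generated_base unfolding finitely_generated_def by blast
  have "\<exists>U. submodule U R ?RM \<and> V \<subseteq> U \<and> U \<subseteq> V' \<and> cover_chain R ?RM V U \<and> (\<forall>a\<in>X. a \<odot>\<^bsub>M\<^esub> w \<in> U)"
    using X(1,2)
  proof (induction X rule: finite_induct)
    case empty
    show ?case using submodule_restrict_scalars[OF V] VV' by (intro exI[of _ V]) auto
  next
    case (insert a X)
    then obtain U where U: "submodule U R ?RM" "V \<subseteq> U" "U \<subseteq> V'" "cover_chain R ?RM V U"
      "\<forall>a\<in>X. a \<odot>\<^bsub>M\<^esub> w \<in> U" by auto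
    have aw: "a \<odot>\<^bsub>M\<^esub> w \<in> V'" using cl'(4) w insert.prems by simp
    then have awM: "a \<odot>\<^bsub>M\<^esub> w \<in> carrier ?RM" using cl' by auto
    let ?U = "U <+>\<^bsub>?RM\<^esub> RM.cyclic (a \<odot>\<^bsub>M\<^esub> w)"
    note s = U(1) RM.submodule_cyclic[OF awM]
    have "cover_chain R ?RM V ?U" using U(4) step[OF U(1-3) aw] by (rule rtranclp.rtrancl_into_rtrancl)
    moreover have "?U \<subseteq> V'" using U(3) RM.cyclic_subset[OF RV' aw] by (intro RM.set_add_least RV')
    moreover have "\<forall>b\<in>insert a X. b \<odot>\<^bsub>M\<^esub> w \<in> ?U"
      using RM.set_add_upper[OF s] RM.mem_cyclic[OF awM] U(5) by auto
    ultimately show ?case using RM.submodule_set_add[OF s] RM.set_add_upper[OF s] U(2) by (intro exI[of _ ?U]) auto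
  qed
  then obtain U where U: "submodule U R ?RM" "V \<subseteq> U" "U \<subseteq> V'" "cover_chain R ?RM V U"
      "\<forall>a\<in>X. a \<odot>\<^bsub>M\<^esub> w \<in> U" by blast
  have "submodule {a \<in> carrier A. a \<odot>\<^bsub>M\<^esub> w \<in> U} R A"
  proof (rule RA.left_submoduleI)
    fix r a assume "r \<in> carrier R" "a \<in> {a \<in> carrier A. a \<odot>\<^bsub>M\<^esub> w \<in> U}"
    then have r: "r \<in> carrier R" and a: "a \<in> carrier A" "a \<odot>\<^bsub>M\<^esub> w \<in> U" by auto
    have "(emb r \<otimes>\<^bsub>A\<^esub> a) \<odot>\<^bsub>M\<^esub> w = emb r \<odot>\<^bsub>M\<^esub> (a \<odot>\<^bsub>M\<^esub> w)" using r a wM by (simp add: smult_assoc1)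
    moreover have "emb r \<otimes>\<^bsub>A\<^esub> a = r \<odot>\<^bsub>A\<^esub> a" using r a by (simp add: alg.smult_mult_left)
    ultimately show "r \<odot>\<^bsub>A\<^esub> a \<in> {a \<in> carrier A. a \<odot>\<^bsub>M\<^esub> w \<in> U}"
      using RM.submodule_closed(4)[OF U(1) r a(2)] r a by simp
  qed (use RM.submodule_closed[OF U(1)] wM in \<open>auto simp: smult_zero_left smult_l_distr\<close>)
  moreover have "X \<subseteq> {a \<in> carrier A. a \<odot>\<^bsub>M\<^esub> w \<in> U}" using U(5) X(2) by auto
  ultimately have "submodule_span R A X \<subseteq> {a \<in> carrier A. a \<odot>\<^bsub>M\<^esub> w \<in> U}"
    unfolding submodule_span_def by (intro Inter_lower) simp
  then have aw: "a \<odot>\<^bsub>M\<^esub> w \<in> U" if "a \<in> carrier A" for a using X(3) that by auto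
  have "V' = V <+>\<^bsub>M\<^esub> (cyclic w \<inter> V')"
    by (rule covers_split[OF c submodule_cyclic[OF wM]]) (use w mem_cyclic[OF wM] in auto)
  moreover have "V <+>\<^bsub>M\<^esub> (cyclic w \<inter> V') \<subseteq> U"
  proof
    fix x assume "x \<in> V <+>\<^bsub>M\<^esub> (cyclic w \<inter> V')"
    then obtain v a where "v \<in> V" "a \<in> carrier A" "x = v \<oplus>\<^bsub>M\<^esub> a \<odot>\<^bsub>M\<^esub> w"
      by (auto simp: mem_set_add cyclic_def)
    then show "x \<in> U" using RM.submodule_closed(3)[OF U(1), of v "a \<odot>\<^bsub>M\<^esub> w"] U(2) aw by auto
  qed
  ultimately have "U = V'" using U(3) by auto
  then show ?thesis using U(4) by simp
qed

lemma cover_chain_of_has_length: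
  assumes "has_length A M n"
  shows "cover_chain R (restrict_scalars A M) {\<zero>\<^bsub>M\<^esub>} (carrier M)"
proof -
  have "has_length A (M\<lparr>carrier := carrier M\<rparr>) n" using assms by simp
  then obtain N where N: "N 0 = {\<zero>\<^bsub>M\<^esub>}" "N n = carrier M" "\<And>i. i < n \<Longrightarrow> covers A M (N i) (N (Suc i))"
    unfolding has_length_iff[OF submodule_carrier] by auto
  have "cover_chain R (restrict_scalars A M) (N 0) (N i)" if "i \<le> n" for i
    using that
  proof (induction i)
    case (Suc i)
    then show ?case using cover_chain_of_covers[OF N(3)[of i]] by (auto intro: rtranclp_trans)
  qed simp
  from this[of n] show ?thesis using N by simp
qed

end

section \<open>Duality\<close>

text \<open>An anti-isomorphism between two intervals that reach to the top, above
  \<open>K\<^sub>0\<close> in \<open>M\<close> and above \<open>K\<close> in \<open>P\<close>.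
  Restricting to intervals matters because the module on the left may be far larger than
  \<open>P\<close>, as is the product in the extension argument.\<close>

definition dual_intervals ::
    "('a, 'x) ring_scheme \<Rightarrow> ('a, 'm) module \<Rightarrow> 'm set \<Rightarrow> ('b, 'z) ring_scheme \<Rightarrow> ('b, 'p) module \<Rightarrow> 'p set \<Rightarrow>
      ('m set \<Rightarrow> 'p set) \<Rightarrow> ('p set \<Rightarrow> 'm set) \<Rightarrow> bool" where
  "dual_intervals A M K\<^sub>0 B P K \<Phi> \<Psi> \<longleftrightarrow> submodule K B P \<and>
     (\<forall>N. submodule N A M \<and> K\<^sub>0 \<subseteq> N \<longrightarrow> submodule (\<Phi> N) B P \<and> K \<subseteq> \<Phi> N \<and> \<Psi> (\<Phi> N) = N) \<and>
     (\<forall>V. submodule V B P \<and> K \<subseteq> V \<longrightarrow> submodule (\<Psi> V) A M \<and> K\<^sub>0 \<subseteq> \<Psi> V \<and> \<Phi> (\<Psi> V) = V) \<and>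
     (\<forall>N N'. N \<subseteq> N' \<longrightarrow> \<Phi> N' \<subseteq> \<Phi> N) \<and> (\<forall>V V'. V \<subseteq> V' \<longrightarrow> \<Psi> V' \<subseteq> \<Psi> V)"

lemma dual_intervalsD:
  assumes "dual_intervals A M K\<^sub>0 B P K \<Phi> \<Psi>"
  shows "submodule K B P"
    and "\<And>N. submodule N A M \<Longrightarrow> K\<^sub>0 \<subseteq> N \<Longrightarrow> submodule (\<Phi> N) B P"
    and "\<And>N. submodule N A M \<Longrightarrow> K\<^sub>0 \<subseteq> N \<Longrightarrow> K \<subseteq> \<Phi> N"
    and "\<And>N. submodule N A M \<Longrightarrow> K\<^sub>0 \<subseteq> N \<Longrightarrow> \<Psi> (\<Phi> N) = N"
    and "\<And>V. submodule V B P \<Longrightarrow> K \<subseteq> V \<Longrightarrow> submodule (\<Psi> V) A M"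
    and "\<And>V. submodule V B P \<Longrightarrow> K \<subseteq> V \<Longrightarrow> K\<^sub>0 \<subseteq> \<Psi> V"
    and "\<And>V. submodule V B P \<Longrightarrow> K \<subseteq> V \<Longrightarrow> \<Phi> (\<Psi> V) = V"
    and "\<And>N N'. N \<subseteq> N' \<Longrightarrow> \<Phi> N' \<subseteq> \<Phi> N"
    and "\<And>V V'. V \<subseteq> V' \<Longrightarrow> \<Psi> V' \<subseteq> \<Psi> V"
  using assms unfolding dual_intervals_def by simp_all

text \<open>The hypothesis on \<open>t\<close> says that \<open>M\<close> modulo
  \<open>K\<^sub>0\<close> is colocal with socle generated by \<open>t\<close>. The elements of eA
  multiply those of \<open>M\<close>, for a primitive \<open>e\<close> that keeps \<open>e t\<close>
  outside \<open>K\<^sub>0\<close>. Perpendiculars are formed over \<open>R\<close>, but since the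
  product is balanced they are submodules over \<open>A\<close> and its opposite.\<close>

lemma (in artin_algebra_module) ex_dual_intervals:
  assumes quadri: "projectives_quadri (opposite A)"
    and K0: "submodule K\<^sub>0 A M" and t: "t \<in> carrier M" "t \<notin> K\<^sub>0"
    and t_min: "\<And>X. submodule X A M \<Longrightarrow> K\<^sub>0 \<subset> X \<Longrightarrow> t \<in> X"
  shows "\<exists>(P :: 'a fg_object) h K \<Phi> \<Psi>. projective (opposite A) P \<and> indecomposable (opposite A) P \<and>
    finite_length (opposite A) P h \<and> h (carrier P) \<le> 4 \<and>
    dual_intervals A M K\<^sub>0 (opposite A) P K \<Phi> \<Psi>"
proof -
  obtain e where e: "primitive_idempotent A e" "e \<odot>\<^bsub>M\<^esub> t \<notin> K\<^sub>0"
    using ex_primitive_idempotent[OF alg.artin_algebra_axioms left_module_axioms K0 t] by blast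
  have eA: "e \<in> carrier A" "e \<otimes>\<^bsub>A\<^esub> e = e" using e(1) by (simp_all add: primitive_idempotent_def)
  \<comment> \<open>Passing to \<open>e t\<close> makes \<open>e\<close> fix it, so the generator of
    eA pairs with \<open>t1\<close> to \<open>t1\<close> itself, which will stay outside
    \<open>Z\<close>.\<close>
  define t1 where "t1 = e \<odot>\<^bsub>M\<^esub> t"
  have t1: "t1 \<in> carrier M" "t1 \<notin> K\<^sub>0" "e \<odot>\<^bsub>M\<^esub> t1 = t1"
    unfolding t1_def using e(2) eA t by (simp_all add: smult_assoc1[symmetric])
  have t1_min: "t1 \<in> X" if "submodule X A M" "K\<^sub>0 \<subset> X" for X
    unfolding t1_def using t_min[OF that] submodule_closed(4)[OF that(1) eA(1)] by simp
  let ?B = "opposite A"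
  have B: "carrier ?B = carrier A" "\<one>\<^bsub>?B\<^esub> = \<one>\<^bsub>A\<^esub>" "smult ?B = smult A" "add ?B = add A"
    "\<And>x y. x \<otimes>\<^bsub>?B\<^esub> y = y \<otimes>\<^bsub>A\<^esub> x"
    by (simp_all add: opposite_def)
  have algB: "artin_algebra R ?B" by (rule artin_algebra_opposite[OF alg.artin_algebra_axioms])
  then have "ring ?B" by (simp add: artin_algebra_def)
  then obtain P :: "'a fg_object" and \<theta> where P: "left_ideal_module ?B P e \<theta>" "projective ?B P" "indecomposable ?B P"
    using ex_left_ideal_module[of ?B e] e(1) by (auto simp: primitive_idempotent_opposite)
  interpret P: left_ideal_module ?B P e \<theta> by (rule P(1))
  obtain n where n: "n \<le> 4" "has_length ?B P n"
    using quadri P(2,3) unfolding projectives_quadri_def quadri_condition_def Let_def by blast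
  obtain h where h: "finite_length ?B P h" "h (carrier P) = n" using P.ex_finite_length[OF n(2)] by blast
  interpret BP: artin_algebra_module R ?B P
    using algB by (simp add: artin_algebra_module_def P.lmod_axioms)
  let ?RM = "restrict_scalars A M" and ?RP = "restrict_scalars ?B P"
  obtain Z where Z: "submodule Z R ?RM" "K\<^sub>0 \<subseteq> Z" "t1 \<notin> Z"
    and Zmax: "\<And>X. submodule X R ?RM \<Longrightarrow> Z \<subset> X \<Longrightarrow> t1 \<in> X"
    using RM.ex_maximal_avoiding[OF submodule_restrict_scalars[OF K0] t1(2)] by blast
  \<comment> \<open>Maximality of \<open>Z\<close> in the form that the pairing asks for: modulo
    \<open>Z\<close>, \<open>t1\<close> is a multiple of every \<open>z\<close> outside
    \<open>Z\<close>.\<close>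
  have socle: "\<exists>r\<in>carrier R. r \<odot>\<^bsub>?RM\<^esub> z \<ominus>\<^bsub>?RM\<^esub> t1 \<in> Z" if z: "z \<in> carrier ?RM" "z \<notin> Z" for z
  proof -
    note s = Z(1) RM.submodule_cyclic[OF z(1)]
    have "Z \<subset> Z <+>\<^bsub>?RM\<^esub> RM.cyclic z" using RM.set_add_upper[OF s] RM.mem_cyclic[OF z(1)] z(2) by auto
    then have "t1 \<in> Z <+>\<^bsub>?RM\<^esub> RM.cyclic z" by (rule Zmax[OF RM.submodule_set_add[OF s]])
    then obtain x r where xr: "x \<in> Z" "r \<in> carrier R" "t1 = x \<oplus>\<^bsub>?RM\<^esub> r \<odot>\<^bsub>?RM\<^esub> z"
      unfolding RM.mem_set_add RM.cyclic_def by blast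
    have c: "x \<in> carrier ?RM" "r \<odot>\<^bsub>?RM\<^esub> z \<in> carrier ?RM"
      using xr(1) RM.submodule_closed(1)[OF Z(1)] RM.smult_closed[OF xr(2) z(1)] by auto
    have "t1 \<ominus>\<^bsub>?RM\<^esub> r \<odot>\<^bsub>?RM\<^esub> z = x" using c xr(3) RM.add_diff_cancel[OF c] by simp
    then have "RM.congruent_mod Z t1 (r \<odot>\<^bsub>?RM\<^esub> z)" using xr(1) t1(1) c by (simp add: RM.congruent_mod_def)
    then have "RM.congruent_mod Z (r \<odot>\<^bsub>?RM\<^esub> z) t1" by (rule RM.congruent_mod_sym[OF Z(1)])
    then show ?thesis using xr(2) by (auto simp: RM.congruent_mod_def)
  qed
  have \<theta>A: "\<theta> w \<in> carrier A" if "w \<in> carrier P" for w using P.\<theta>_closed[OF that] by (simp add: B)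
  interpret pr: pairing R ?RP ?RM ?RM "\<lambda>w y. \<theta> w \<odot>\<^bsub>M\<^esub> y" Z t1
  proof (intro pairing.intro pairing_axioms.intro BP.left_module_restrict_scalars left_module_restrict_scalars
      alg.R.is_cring Z(1,3) socle)
    fix r w y assume r: "r \<in> carrier R" and w: "w \<in> carrier ?RP" and y: "y \<in> carrier ?RM"
    have er: "emb r \<in> carrier A" using r by simp
    have "\<theta> (r \<odot>\<^bsub>?RP\<^esub> w) = \<theta> w \<otimes>\<^bsub>A\<^esub> emb r"
      using P.\<theta>_smult[of "emb r" w] w er by (simp add: B)
    then show "\<theta> (r \<odot>\<^bsub>?RP\<^esub> w) \<odot>\<^bsub>M\<^esub> y = r \<odot>\<^bsub>?RM\<^esub> (\<theta> w \<odot>\<^bsub>M\<^esub> y)"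
      using w y r er \<theta>A[of w] by (simp add: emb_central smult_assoc1)
    show "\<theta> w \<odot>\<^bsub>M\<^esub> (r \<odot>\<^bsub>?RM\<^esub> y) = r \<odot>\<^bsub>?RM\<^esub> (\<theta> w \<odot>\<^bsub>M\<^esub> y)"
      using w y r \<theta>A[of w] by (simp add: emb_smult_commute)
  qed (use t1(1) \<theta>A in \<open>simp_all add: P.\<theta>_add B smult_l_distr smult_r_distr\<close>)
  have lp: "submodule (pr.lperp V) A M" if V: "submodule V ?B P" for V
  proof -
    note clV = P.submodule_closed[OF V]
    have s: "submodule (pr.lperp V) R ?RM" using clV(1) by (intro pr.submodule_lperp) simp
    show ?thesis
    proof (rule left_submoduleI)
      fix a y assume a: "a \<in> carrier A" and y: "y \<in> pr.lperp V"
      have yM: "y \<in> carrier M" using y by (simp add: pr.lperp_def)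
      have "\<theta> w \<odot>\<^bsub>M\<^esub> (a \<odot>\<^bsub>M\<^esub> y) \<in> Z" if w: "w \<in> V" for w
      proof -
        have wP: "w \<in> carrier P" using w clV by auto
        have "\<theta> (a \<odot>\<^bsub>P\<^esub> w) = \<theta> w \<otimes>\<^bsub>A\<^esub> a" using P.\<theta>_smult[of a w] a wP by (simp add: B)
        then have "\<theta> w \<odot>\<^bsub>M\<^esub> (a \<odot>\<^bsub>M\<^esub> y) = \<theta> (a \<odot>\<^bsub>P\<^esub> w) \<odot>\<^bsub>M\<^esub> y"
          using \<theta>A[OF wP] a yM by (simp add: smult_assoc1)
        moreover have "a \<odot>\<^bsub>P\<^esub> w \<in> V" using clV(4)[of a w] a w by (simp add: B)
        ultimately show ?thesis using y by (simp add: pr.lperp_def)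
      qed
      then show "a \<odot>\<^bsub>M\<^esub> y \<in> pr.lperp V" using a yM by (simp add: pr.lperp_def)
    qed (use RM.submodule_closed[OF s] in simp_all)
  qed
  have rp: "submodule (pr.rperp N) ?B P" if N: "submodule N A M" for N
  proof -
    note clN = submodule_closed[OF N]
    have s: "submodule (pr.rperp N) R ?RP" using clN(1) by (intro pr.submodule_rperp) simp
    show ?thesis
    proof (rule P.left_submoduleI)
      fix a w assume a': "a \<in> carrier ?B" and w: "w \<in> pr.rperp N"
      have wP: "w \<in> carrier P" using w by (simp add: pr.rperp_def)
      have a: "a \<in> carrier A" using a' by (simp add: B)
      have "\<theta> (a \<odot>\<^bsub>P\<^esub> w) \<odot>\<^bsub>M\<^esub> y \<in> Z" if y: "y \<in> N" for y
      proof -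
        have yM: "y \<in> carrier M" using y clN by auto
        have "\<theta> (a \<odot>\<^bsub>P\<^esub> w) = \<theta> w \<otimes>\<^bsub>A\<^esub> a" using P.\<theta>_smult[of a w] a wP by (simp add: B)
        then have "\<theta> (a \<odot>\<^bsub>P\<^esub> w) \<odot>\<^bsub>M\<^esub> y = \<theta> w \<odot>\<^bsub>M\<^esub> (a \<odot>\<^bsub>M\<^esub> y)"
          using \<theta>A[OF wP] a yM by (simp add: smult_assoc1)
        then show ?thesis using w clN(4)[OF a y] by (simp add: pr.rperp_def)
      qed
      then show "a \<odot>\<^bsub>P\<^esub> w \<in> pr.rperp N" using a' wP by (simp add: pr.rperp_def)
    qed (use BP.RM.submodule_closed[OF s] in simp_all)
  qed
  have K0_lp: "K\<^sub>0 \<subseteq> pr.lperp V" if "V \<subseteq> carrier P" for V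
  proof
    fix y assume y: "y \<in> K\<^sub>0"
    have "\<theta> w \<odot>\<^bsub>M\<^esub> y \<in> Z" if "w \<in> V" for w
      using submodule_closed(4)[OF K0 \<theta>A y] \<open>V \<subseteq> carrier P\<close> that Z(2) by blast
    then show "y \<in> pr.lperp V" using y submodule_closed(1)[OF K0] by (auto simp: pr.lperp_def)
  qed
  \<comment> \<open>The pairing is nondegenerate above \<open>K\<^sub>0\<close>: a larger
    perpendicular would contain \<open>t1\<close>, which the generator does not send into
    \<open>Z\<close>.\<close>
  have lpP: "pr.lperp (carrier P) = K\<^sub>0"
  proof (rule ccontr)
    assume "pr.lperp (carrier P) \<noteq> K\<^sub>0"
    then have "K\<^sub>0 \<subset> pr.lperp (carrier P)" using K0_lp by blast
    then have "t1 \<in> pr.lperp (carrier P)" using t1_min[OF lp] by simp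
    then have "\<theta> P.generator \<odot>\<^bsub>M\<^esub> t1 \<in> Z" using P.generator(1) by (simp add: pr.lperp_def)
    then show False using t1(3) Z(3) P.generator(2) by simp
  qed
  have "cover_chain R ?RP {\<zero>\<^bsub>?RP\<^esub>} (carrier ?RP)"
    using BP.cover_chain_of_has_length[OF n(2)] by simp
  note dp = pr.double_perp[OF this]
  define K where "K = pr.rperp (carrier M)"
  have "dual_intervals A M K\<^sub>0 ?B P K pr.rperp pr.lperp"
    unfolding dual_intervals_def
  proof (intro conjI allI impI)
    show "submodule K ?B P" unfolding K_def by (rule rp[OF submodule_carrier])
    fix N assume N: "submodule N A M \<and> K\<^sub>0 \<subseteq> N"
    then show "submodule (pr.rperp N) ?B P" using rp by simp
    show "K \<subseteq> pr.rperp N" unfolding K_def using N submodule_closed(1) by (intro pr.rperp_antimono) simp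
    show "pr.lperp (pr.rperp N) = N" using dp(1) submodule_restrict_scalars N lpP by simp
  next
    fix V assume V: "submodule V ?B P \<and> K \<subseteq> V"
    then show "submodule (pr.lperp V) A M" using lp by simp
    show "K\<^sub>0 \<subseteq> pr.lperp V" using K0_lp V P.submodule_closed(1) by simp
    show "pr.rperp (pr.lperp V) = V" using dp(2) BP.submodule_restrict_scalars V by (simp add: K_def)
  qed (simp_all add: pr.rperp_antimono pr.lperp_antimono)
  then show ?thesis using P(2,3) h n(1) by blast
qed

text \<open>A strict chain above \<open>K\<^sub>0\<close> turns into a descending chain above
  \<open>K\<close>, strict because \<open>\<Psi>\<close> recovers its members. So the length of the
  projective module bounds chains in \<open>M\<close>.\<close>

lemma dual_intervals_chain:
  assumes fl: "finite_length B P h" and d: "dual_intervals A M K\<^sub>0 B P K \<Phi> \<Psi>"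
    and X: "\<And>i. i \<le> k \<Longrightarrow> submodule (X i) A M \<and> K\<^sub>0 \<subseteq> X i" "\<And>i. i < k \<Longrightarrow> X i \<subset> X (Suc i)"
  shows "h K + k \<le> h (carrier P)"
proof -
  interpret P: finite_length B P h by (rule fl)
  note D = dual_intervalsD[OF d]
  have strict: "\<Phi> (X (Suc i)) \<subset> \<Phi> (X i)" if "i < k" for i
  proof -
    have "\<Psi> (\<Phi> (X i)) = X i" "\<Psi> (\<Phi> (X (Suc i))) = X (Suc i)" using D(4) X(1)[of i] X(1)[of "Suc i"] that by auto
    then have "\<Phi> (X (Suc i)) \<noteq> \<Phi> (X i)" using X(2)[OF that] by auto
    moreover have "\<Phi> (X (Suc i)) \<subseteq> \<Phi> (X i)" using D(8) X(2)[OF that] by blast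
    ultimately show ?thesis by blast
  qed
  have sub: "submodule (\<Phi> (X i)) B P" if "i \<le> k" for i using D(2) X(1)[OF that] by blast
  \<comment> \<open>\<open>h_less_chain\<close> wants an ascending chain, hence the reversed index
    \<open>k - i\<close>.\<close>
  have "h (\<Phi> (X (k - 0))) + k \<le> h (\<Phi> (X (k - k)))"
  proof (rule P.h_less_chain)
    fix i assume "i < k"
    then have "k - i = Suc (k - Suc i)" "k - Suc i < k" by simp_all
    then show "\<Phi> (X (k - i)) \<subset> \<Phi> (X (k - Suc i))" using strict[of "k - Suc i"] by simp
  qed (use sub in simp)
  moreover have "h K \<le> h (\<Phi> (X k))" using P.h_mono[OF D(1) sub] D(3) X(1)[of k] by simp
  moreover have "h (\<Phi> (X 0)) \<le> h (carrier P)" using P.h_le[OF sub] by simp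
  ultimately show ?thesis by simp
qed

section \<open>Colocal modules of length four\<close>

definition prod_module :: "('a, 'm) module \<Rightarrow> ('a, 'n) module \<Rightarrow> ('a, 'm \<times> 'n) module" where
  "prod_module M N = \<lparr>carrier = carrier M \<times> carrier N, mult = (\<lambda>_ _. (zero M, zero N)), one = (zero M, zero N),
     zero = (zero M, zero N), add = (\<lambda>(x, y) (x', y'). (x \<oplus>\<^bsub>M\<^esub> x', y \<oplus>\<^bsub>N\<^esub> y')),
     smult = (\<lambda>a (x, y). (a \<odot>\<^bsub>M\<^esub> x, a \<odot>\<^bsub>N\<^esub> y))\<rparr>"

lemma prod_module_simps [simp]:
  "carrier (prod_module M N) = carrier M \<times> carrier N" "zero (prod_module M N) = (zero M, zero N)"
  "(x, y) \<oplus>\<^bsub>prod_module M N\<^esub> (x', y') = (x \<oplus>\<^bsub>M\<^esub> x', y \<oplus>\<^bsub>N\<^esub> y')"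
  "a \<odot>\<^bsub>prod_module M N\<^esub> (x, y) = (a \<odot>\<^bsub>M\<^esub> x, a \<odot>\<^bsub>N\<^esub> y)"
  by (simp_all add: prod_module_def)

lemma left_module_prod_module:
  assumes "left_module A M" "left_module A N"
  shows "left_module A (prod_module M N)"
proof -
  interpret M: left_module A M by fact
  interpret N: left_module A N by fact
  have "abelian_group (prod_module M N)"
    by (rule abelian_groupI) (auto simp: M.M.a_ac N.M.a_ac intro: M.M.add.l_inv_ex N.M.add.l_inv_ex)
  then show ?thesis
    by (intro left_module.intro left_module_axioms.intro M.A.ring_axioms)
      (auto simp: M.smult_l_distr M.smult_r_distr M.smult_assoc1 N.smult_l_distr N.smult_r_distr N.smult_assoc1)
qed

context artin_algebra_module
begin

text \<open>Extending \<open>f\<close> along \<open>i\<close> means enlarging the graph of \<open>f \<circ> i\<^sup>-\<^sup>1\<close> in \<open>M \<times> Y\<close> to the graph of a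
  homomorphism on \<open>Y\<close>. A submodule \<open>K\<close> above the graph that is maximal with \<open>(t, 0) \<notin> K\<close> does it:
  the duality bounds the length of \<open>(M \<times> Y)/K\<close> by four, so that \<open>M\<close> covers this quotient.\<close>

lemma injective_of_colocal:
  assumes quadri: "projectives_quadri (opposite A)"
    and fg: "fg_module A M" and len: "has_length A M 4"
    and S: "smallest_nonzero_submodule A M S"
  shows "injective A M"
  unfolding injective_def
proof (intro conjI fg allI ballI impI)
  fix X Y :: "'a fg_object" and i f
  assume i: "i \<in> module_hom A X Y" and f: "f \<in> module_hom A X M"
    and *: "fg_module A X \<and> fg_module A Y \<and> inj_on i (carrier X)"
  interpret i: module_morphism A X Y i using * i by (intro module_morphismI) (auto simp: fg_module_def)
  interpret f: module_morphism A X M f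
    using * f by (intro module_morphismI left_module_axioms) (auto simp: fg_module_def)
  have inj: "inj_on i (carrier X)" using * by simp
  have sS: "submodule S A M" "S \<noteq> {\<zero>\<^bsub>M\<^esub>}" and Smin: "\<And>N. submodule N A M \<Longrightarrow> N \<noteq> {\<zero>\<^bsub>M\<^esub>} \<Longrightarrow> S \<subseteq> N"
    using S by (auto simp: smallest_nonzero_submodule_def)
  obtain t where t: "t \<in> S" "t \<noteq> \<zero>\<^bsub>M\<^esub>" using sS submodule_closed(2)[OF sS(1)] by blast
  have tM: "t \<in> carrier M" using t submodule_closed(1)[OF sS(1)] by blast
  let ?W = "prod_module M Y"
  have lW: "left_module A ?W" by (rule left_module_prod_module[OF left_module_axioms i.N.left_module_axioms])
  interpret W: artin_algebra_module R A ?W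
    by (simp add: artin_algebra_module_def lmod_def lW alg.artin_algebra_axioms)
  \<comment> \<open>The graph of the partial map from \<open>Y\<close> to \<open>M\<close>, values
    first. It avoids the pair of \<open>t\<close> and zero, because \<open>i\<close> is injective
    and \<open>t\<close> is not zero.\<close>
  define G where "G = (\<lambda>x. (f x, i x)) ` carrier X"
  have G: "submodule G A ?W"
  proof (rule W.left_submoduleI)
    show "G \<subseteq> carrier ?W" by (auto simp: G_def)
    show "\<zero>\<^bsub>?W\<^esub> \<in> G" unfolding G_def by (rule image_eqI[of _ _ "\<zero>\<^bsub>X\<^esub>"]) (simp_all add: f.hom_zero i.hom_zero)
    fix u v assume "u \<in> G" "v \<in> G"
    then obtain x y where "x \<in> carrier X" "y \<in> carrier X" "u = (f x, i x)" "v = (f y, i y)" by (auto simp: G_def)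
    then show "u \<oplus>\<^bsub>?W\<^esub> v \<in> G"
      unfolding G_def by (intro image_eqI[of _ _ "x \<oplus>\<^bsub>X\<^esub> y"]) (simp_all add: f.hom_add i.hom_add)
  next
    fix a u assume "a \<in> carrier A" "u \<in> G"
    then obtain x where "a \<in> carrier A" "x \<in> carrier X" "u = (f x, i x)" by (auto simp: G_def)
    then show "a \<odot>\<^bsub>?W\<^esub> u \<in> G"
      unfolding G_def by (intro image_eqI[of _ _ "a \<odot>\<^bsub>X\<^esub> x"]) (simp_all add: f.hom_smult i.hom_smult)
  qed
  have tG: "(t, \<zero>\<^bsub>Y\<^esub>) \<notin> G"
  proof
    assume "(t, \<zero>\<^bsub>Y\<^esub>) \<in> G"
    then obtain x where x: "x \<in> carrier X" "f x = t" "i x = \<zero>\<^bsub>Y\<^esub>" by (auto simp: G_def)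
    then have "x = \<zero>\<^bsub>X\<^esub>" using inj i.hom_zero by (metis inj_on_eq_iff i.M.M.zero_closed)
    then show False using x t f.hom_zero by simp
  qed
  obtain K where K: "submodule K A ?W" "G \<subseteq> K" "(t, \<zero>\<^bsub>Y\<^esub>) \<notin> K"
    and Kmax: "\<And>X. submodule X A ?W \<Longrightarrow> K \<subset> X \<Longrightarrow> (t, \<zero>\<^bsub>Y\<^esub>) \<in> X"
    using W.ex_maximal_avoiding[OF G tG] by blast
  note clK = W.submodule_closed[OF K(1)]
  \<comment> \<open>The trace of \<open>K\<close> on \<open>M\<close> is a submodule; if it were
    nonzero, it would contain \<open>S\<close> and with it \<open>t\<close>.\<close>
  have K_M: "m = \<zero>\<^bsub>M\<^esub>" if m: "(m, \<zero>\<^bsub>Y\<^esub>) \<in> K" for m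
  proof -
    define N where "N = {m \<in> carrier M. (m, \<zero>\<^bsub>Y\<^esub>) \<in> K}"
    have "submodule N A M"
    proof (rule left_submoduleI)
      fix x y assume "x \<in> N" "y \<in> N"
      then show "x \<oplus>\<^bsub>M\<^esub> y \<in> N" using clK(3)[of "(x, \<zero>\<^bsub>Y\<^esub>)" "(y, \<zero>\<^bsub>Y\<^esub>)"] by (simp add: N_def)
    next
      fix a x assume "a \<in> carrier A" "x \<in> N"
      then show "a \<odot>\<^bsub>M\<^esub> x \<in> N" using clK(4)[of a "(x, \<zero>\<^bsub>Y\<^esub>)"] by (simp add: N_def i.N.smult_zero_right)
    qed (use clK(2) in \<open>auto simp: N_def\<close>)
    moreover have "t \<notin> N" using K(3) by (simp add: N_def)
    ultimately have "N = {\<zero>\<^bsub>M\<^esub>}" using Smin[of N] t(1) by blast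
    moreover have "m \<in> N" using m clK(1) by (auto simp: N_def)
    ultimately show ?thesis by simp
  qed
  have subU: "submodule (U \<times> {\<zero>\<^bsub>Y\<^esub>}) A ?W" if U: "submodule U A M" for U
    by (rule W.left_submoduleI)
      (use submodule_closed[OF U] in \<open>auto simp: i.N.smult_zero_right\<close>)
  define N where "N U = K <+>\<^bsub>?W\<^esub> (U \<times> {\<zero>\<^bsub>Y\<^esub>})" for U
  have N: "submodule (N U) A ?W" "K \<subseteq> N U" if "submodule U A M" for U
    unfolding N_def using W.submodule_set_add[OF K(1) subU[OF that]] W.set_add_upper[OF K(1) subU[OF that]] by simp_all
  have memN: "(m, \<zero>\<^bsub>Y\<^esub>) \<in> N U \<longleftrightarrow> m \<in> U" if U: "submodule U A M" and m: "m \<in> carrier M" for U m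
  proof
    assume "(m, \<zero>\<^bsub>Y\<^esub>) \<in> N U"
    then obtain k u where ku: "k \<in> K" "u \<in> U" "(m, \<zero>\<^bsub>Y\<^esub>) = k \<oplus>\<^bsub>?W\<^esub> (u, \<zero>\<^bsub>Y\<^esub>)"
      unfolding N_def W.mem_set_add by auto
    obtain k1 k2 where k: "k = (k1, k2)" by (cases k)
    have kc: "k1 \<in> carrier M" "k2 \<in> carrier Y" using ku(1) clK(1) k by auto
    have "k2 = \<zero>\<^bsub>Y\<^esub>" "m = k1 \<oplus>\<^bsub>M\<^esub> u" using ku(3) kc by (simp_all add: k)
    then have "m = u" using K_M[of k1] ku k submodule_closed(1)[OF U] by auto
    then show "m \<in> U" using ku by simp
  next
    assume "m \<in> U"
    then show "(m, \<zero>\<^bsub>Y\<^esub>) \<in> N U" unfolding N_def using W.set_add_upper(2)[OF K(1) subU[OF U]] by auto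
  qed
  have "has_length A (M\<lparr>carrier := carrier M\<rparr>) 4" using len by simp
  then obtain C where C: "C 4 = carrier M" "\<And>i. i < 4 \<Longrightarrow> covers A M (C i) (C (Suc i))"
    unfolding has_length_iff[OF submodule_carrier] by auto
  have sC: "submodule (C i) A M" if "i \<le> 4" for i
    using that C(2)[of i] C(1) by (cases "i = 4") (auto simp: covers_def)
  \<comment> \<open>Otherwise \<open>K\<close> plus the members of a composition series of
    \<open>M\<close>, followed by the whole product, is a chain with five strict steps above
    \<open>K\<close>, dual to five strict steps in a module of length at most four.\<close>
  have "N (carrier M) = carrier ?W"
  proof (rule ccontr)
    assume ne: "N (carrier M) \<noteq> carrier ?W"
    obtain P :: "'a fg_object" and h KP \<Phi> \<Psi> where P: "finite_length (opposite A) P h" "h (carrier P) \<le> 4"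
      "dual_intervals A ?W K (opposite A) P KP \<Phi> \<Psi>"
      using W.ex_dual_intervals[OF quadri K(1) _ K(3) Kmax] tM by auto
    define X where "X i = (if i \<le> 4 then N (C i) else carrier ?W)" for i :: nat
    have "h KP + 5 \<le> h (carrier P)"
    proof (rule dual_intervals_chain[OF P(1,3)])
      fix i :: nat
      show "submodule (X i) A ?W \<and> K \<subseteq> X i" using N[OF sC] clK(1) W.submodule_carrier unfolding X_def by simp
      assume "i < 5"
      then consider "i < 4" | "i = 4" by linarith
      then show "X i \<subset> X (Suc i)"
      proof cases
        case 1
        then have c: "submodule (C i) A M" "submodule (C (Suc i)) A M" "C i \<subset> C (Suc i)"
          using C(2)[OF 1] by (auto simp: covers_def)
        then obtain m where m: "m \<in> C (Suc i)" "m \<notin> C i" by blast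
        have mM: "m \<in> carrier M" using m(1) submodule_closed(1)[OF c(2)] by auto
        have "C i \<times> {\<zero>\<^bsub>Y\<^esub>} \<subseteq> N (C (Suc i))"
          using W.set_add_upper(2)[OF K(1) subU[OF c(2)]] c(3) unfolding N_def by auto
        then have "N (C i) \<subseteq> N (C (Suc i))"
          using W.set_add_least[OF N(1)[OF c(2)] N(2)[OF c(2)]] unfolding N_def[of "C i"] by simp
        moreover have "(m, \<zero>\<^bsub>Y\<^esub>) \<in> N (C (Suc i))" "(m, \<zero>\<^bsub>Y\<^esub>) \<notin> N (C i)"
          using memN[OF c(1) mM] memN[OF c(2) mM] m by simp_all
        ultimately show ?thesis unfolding X_def using 1 by auto
      next
        case 2
        then show ?thesis unfolding X_def using C(1) ne W.submodule_closed(1)[OF N(1)[OF submodule_carrier]] by auto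
      qed
    qed
    then show False using P(2) by simp
  qed
  \<comment> \<open>Every \<open>y\<close> has a partner in \<open>K\<close> because
    \<open>K\<close> and \<open>M\<close> together fill the product, and below only one because
    \<open>K\<close> meets \<open>M\<close> trivially: \<open>K\<close> is the graph of a
    map.\<close>
  have ex: "\<exists>m. (m, y) \<in> K" if y: "y \<in> carrier Y" for y
  proof -
    have "(\<zero>\<^bsub>M\<^esub>, y) \<in> N (carrier M)" using y \<open>N (carrier M) = carrier ?W\<close> by simp
    then obtain k u where ku: "k \<in> K" "u \<in> carrier M" "(\<zero>\<^bsub>M\<^esub>, y) = k \<oplus>\<^bsub>?W\<^esub> (u, \<zero>\<^bsub>Y\<^esub>)"
      unfolding N_def W.mem_set_add by auto
    obtain k1 k2 where k: "k = (k1, k2)" by (cases k)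
    have "k2 \<in> carrier Y" using ku(1) clK(1) k by auto
    then have "y = k2" using ku(3) k by simp
    then show ?thesis using ku k by blast
  qed
  have uniq: "m = m'" if m: "(m, y) \<in> K" "(m', y) \<in> K" for m m' y
  proof -
    have c: "m \<in> carrier M" "m' \<in> carrier M" "y \<in> carrier Y" using m clK(1) by auto
    have "(\<ominus>\<^bsub>A\<^esub> \<one>\<^bsub>A\<^esub>) \<odot>\<^bsub>?W\<^esub> (m', y) \<in> K" using clK(4)[OF _ m(2), of "\<ominus>\<^bsub>A\<^esub> \<one>\<^bsub>A\<^esub>"] by simp
    then have mm: "(\<ominus>\<^bsub>M\<^esub> m', \<ominus>\<^bsub>Y\<^esub> y) \<in> K" using c by (simp add: smult_minus_one i.N.smult_minus_one)
    have "(m \<ominus>\<^bsub>M\<^esub> m', \<zero>\<^bsub>Y\<^esub>) \<in> K" using clK(3)[OF m(1) mm] c by (simp add: a_minus_def i.N.M.r_neg)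
    then show ?thesis using K_M minus_eq_zero_iff c by blast
  qed
  define g where "g y = (SOME m. (m, y) \<in> K)" for y
  have gK: "(g y, y) \<in> K" if "y \<in> carrier Y" for y unfolding g_def using ex[OF that] by (rule someI_ex)
  have g_eq: "g y = m" if "(m, y) \<in> K" for m y using uniq[OF gK that] that clK(1) by auto
  have "g \<in> module_hom A Y M"
  proof (rule module_homI)
    show "\<And>x. x \<in> carrier Y \<Longrightarrow> g x \<in> carrier M" using gK clK(1) by auto
    show "\<And>x y. x \<in> carrier Y \<Longrightarrow> y \<in> carrier Y \<Longrightarrow> g (x \<oplus>\<^bsub>Y\<^esub> y) = g x \<oplus>\<^bsub>M\<^esub> g y"
      using clK(3)[OF gK gK] by (intro g_eq) simp
    show "\<And>a x. a \<in> carrier A \<Longrightarrow> x \<in> carrier Y \<Longrightarrow> g (a \<odot>\<^bsub>Y\<^esub> x) = a \<odot>\<^bsub>M\<^esub> g x"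
      using clK(4)[OF _ gK] by (intro g_eq) simp
  qed
  moreover have "g (i x) = f x" if "x \<in> carrier X" for x
    using g_eq K(2) that unfolding G_def by blast
  ultimately show "\<exists>g\<in>module_hom A Y M. \<forall>x\<in>carrier X. g (i x) = f x" by blast
qed

text \<open>The length of \<open>M\<close> uses up the length of eA, so the duality relates all
  submodules of \<open>M\<close> to all submodules of \<open>P\<close>, exchanging sums and
  intersections. Since \<open>M\<close> is colocal, \<open>V + V'\<close> cannot be all of
  \<open>P\<close>; it is the largest proper submodule, and dually \<open>X \<inter> X'\<close> is
  the smallest nonzero one. Since \<open>M\<close> is not local, \<open>X + X'\<close> is all of
  \<open>M\<close>.\<close>

lemma biserial_of_colocal:
  assumes quadri: "projectives_quadri (opposite A)" and bis: "projectives_biserial (opposite A)"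
    and ind: "indecomposable A M" and len: "has_length A M 4"
    and col: "colocal_module A M" and nloc: "\<not> local_module A M"
  shows "biserial_module A M"
proof -
  obtain hM where hM: "finite_length A M hM" "hM (carrier M) = 4" using ex_finite_length[OF len] by blast
  interpret M: finite_length A M hM by (rule hM(1))
  obtain S where S: "smallest_nonzero_submodule A M S" using col M.colocal_module_iff by blast
  have sS: "submodule S A M" "S \<noteq> {\<zero>\<^bsub>M\<^esub>}" and Smin: "\<And>N. submodule N A M \<Longrightarrow> N \<noteq> {\<zero>\<^bsub>M\<^esub>} \<Longrightarrow> S \<subseteq> N"
    using S by (auto simp: smallest_nonzero_submodule_def)
  obtain t where t: "t \<in> S" "t \<noteq> \<zero>\<^bsub>M\<^esub>" using sS submodule_closed(2)[OF sS(1)] by blast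
  have tM: "t \<in> carrier M" using t submodule_closed(1)[OF sS(1)] by blast
  have tmin: "t \<in> X" if "submodule X A M" "{\<zero>\<^bsub>M\<^esub>} \<subset> X" for X using Smin[OF that(1)] that(2) t(1) by blast
  let ?B = "opposite A"
  obtain P :: "'a fg_object" and h K \<Phi> \<Psi> where P: "projective ?B P" "indecomposable ?B P"
    "finite_length ?B P h" "h (carrier P) \<le> 4" "dual_intervals A M {\<zero>\<^bsub>M\<^esub>} ?B P K \<Phi> \<Psi>"
    using ex_dual_intervals[OF quadri submodule_zero tM _ tmin] t(2) by auto
  interpret P: finite_length ?B P h by (rule P(3))
  note D = dual_intervalsD[OF P(5)]
  have z: "{\<zero>\<^bsub>M\<^esub>} \<subseteq> N" if "submodule N A M" for N using submodule_closed(2)[OF that] by simp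
  have "has_length A (M\<lparr>carrier := carrier M\<rparr>) 4" using len by simp
  then obtain C where C: "C 4 = carrier M" "\<And>i. i < 4 \<Longrightarrow> covers A M (C i) (C (Suc i))"
    unfolding has_length_iff[OF submodule_carrier] by auto
  have sC: "submodule (C i) A M" if "i \<le> 4" for i
    using that C(2)[of i] C(1) by (cases "i = 4") (auto simp: covers_def)
  have "h K + 4 \<le> h (carrier P)"
  proof (rule dual_intervals_chain[OF P(3,5)])
    show "submodule (C i) A M \<and> {\<zero>\<^bsub>M\<^esub>} \<subseteq> C i" if "i \<le> 4" for i using sC[OF that] z by blast
    show "C i \<subset> C (Suc i)" if "i < 4" for i using C(2)[OF that] by (simp add: covers_def)
  qed
  then have "h K = 0" using P(4) by simp
  then have K: "K = {\<zero>\<^bsub>P\<^esub>}" using P.h_eq_0[OF D(1)] by simp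
  have zP: "K \<subseteq> V" if "submodule V ?B P" for V using P.submodule_closed(2)[OF that] K by simp
  have \<Phi>: "submodule (\<Phi> N) ?B P" "\<Psi> (\<Phi> N) = N" if "submodule N A M" for N using D(2,4) z that by simp_all
  have \<Psi>: "submodule (\<Psi> V) A M" "\<Phi> (\<Psi> V) = V" if "submodule V ?B P" for V using D(5,7) zP that by simp_all
  have le: "\<Phi> N' \<subseteq> \<Phi> N \<longleftrightarrow> N \<subseteq> N'" if "submodule N A M" "submodule N' A M" for N N'
    using D(8)[of N N'] D(9)[of "\<Phi> N'" "\<Phi> N"] \<Phi>(2) that by auto
  have \<Phi>0: "\<Phi> {\<zero>\<^bsub>M\<^esub>} = carrier P"
  proof -
    have "\<Phi> (\<Psi> (carrier P)) \<subseteq> \<Phi> {\<zero>\<^bsub>M\<^esub>}" using D(8) z[OF \<Psi>(1)] by simp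
    then show ?thesis using \<Psi>(2) P.submodule_closed(1)[OF \<Phi>(1)[OF submodule_zero]] by auto
  qed
  have \<Phi>1: "\<Phi> (carrier M) = {\<zero>\<^bsub>P\<^esub>}"
  proof -
    have "\<Phi> (carrier M) \<subseteq> \<Phi> (\<Psi> {\<zero>\<^bsub>P\<^esub>})" using D(8) submodule_closed(1)[OF \<Psi>(1)] by simp
    then show ?thesis using \<Psi>(2) P.submodule_closed(2)[OF \<Phi>(1)[OF submodule_carrier]] by auto
  qed
  have inj: "N = N'" if "submodule N A M" "submodule N' A M" "\<Phi> N = \<Phi> N'" for N N'
    using arg_cong[OF that(3), of \<Psi>] unfolding \<Phi>(2)[OF that(1)] \<Phi>(2)[OF that(2)] .
  have "\<not> uniserial ?B P"
  proof
    assume u: "uniserial ?B P"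
    have "{\<zero>\<^bsub>M\<^esub>} \<subset> carrier M" using z[OF submodule_carrier] ind unfolding indecomposable_def by auto
    then obtain Q where Q: "covers A M Q (carrier M)"
      using M.ex_covered_above[OF submodule_zero submodule_carrier] by blast
    then have sQ: "submodule Q A M" "Q \<noteq> carrier M" by (auto simp: covers_def)
    have "N \<subseteq> Q" if N: "submodule N A M" "N \<noteq> carrier M" for N
    proof -
      have "N \<subseteq> Q \<or> Q \<subseteq> N"
        using u \<Phi>(1)[OF N(1)] \<Phi>(1)[OF sQ(1)] le[OF N(1) sQ(1)] le[OF sQ(1) N(1)] unfolding uniserial_def by blast
      then show ?thesis using Q N submodule_closed(1)[OF N(1)] unfolding covers_def by blast
    qed
    then have "largest_proper_submodule A M Q" using sQ by (simp add: largest_proper_submodule_def)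
    then show False using nloc M.local_module_iff by blast
  qed
  then have "biserial_module ?B P" using bis P(1,2) unfolding projectives_biserial_def by blast
  then obtain V V' where V: "submodule V ?B P" "submodule V' ?B P" "\<not> V \<subseteq> V'" "\<not> V' \<subseteq> V"
    and uV: "uniserial ?B (P\<lparr>carrier := V\<rparr>)" "uniserial ?B (P\<lparr>carrier := V'\<rparr>)"
    and sum: "V <+>\<^bsub>P\<^esub> V' = carrier P \<or> largest_proper_submodule ?B P (V <+>\<^bsub>P\<^esub> V')"
    and int: "V \<inter> V' = {\<zero>\<^bsub>P\<^esub>} \<or> smallest_nonzero_submodule ?B P (V \<inter> V')"
    unfolding biserial_module_def by blast
  define X X' where "X = \<Psi> V" and "X' = \<Psi> V'"
  have X: "submodule X A M" "submodule X' A M" "\<Phi> X = V" "\<Phi> X' = V'"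
    unfolding X_def X'_def using \<Psi> V by simp_all
  have inc: "\<not> X \<subseteq> X'" "\<not> X' \<subseteq> X" using le[OF X(1,2)] le[OF X(2,1)] X(3,4) V(3,4) by simp_all
  have "X \<noteq> {\<zero>\<^bsub>M\<^esub>}" "X' \<noteq> {\<zero>\<^bsub>M\<^esub>}" using inc z X(1,2) by auto
  then have "S \<subseteq> X \<inter> X'" using Smin X(1,2) by simp
  have sI: "submodule (X \<inter> X') A M" by (rule submodule_Int[OF X(1,2)])
  have sJ: "submodule (X <+>\<^bsub>M\<^esub> X') A M" by (rule submodule_set_add[OF X(1,2)])
  note upJ = set_add_upper[OF X(1,2)]
  have \<Phi>I: "V <+>\<^bsub>P\<^esub> V' \<subseteq> \<Phi> (X \<inter> X')"
    using D(8)[of "X \<inter> X'" X] D(8)[of "X \<inter> X'" X'] X by (intro P.set_add_least \<Phi>(1) sI) auto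
  have I_nz: "X \<inter> X' \<noteq> {\<zero>\<^bsub>M\<^esub>}" using \<open>S \<subseteq> X \<inter> X'\<close> sS z[OF sS(1)] by auto
  then have \<Phi>I_ne: "\<Phi> (X \<inter> X') \<noteq> carrier P" using inj[OF sI submodule_zero] \<Phi>0 by auto
  have "V <+>\<^bsub>P\<^esub> V' \<noteq> carrier P" using \<Phi>I \<Phi>I_ne P.submodule_closed(1)[OF \<Phi>(1)[OF sI]] by auto
  then have large: "largest_proper_submodule ?B P (V <+>\<^bsub>P\<^esub> V')" using sum by simp
  have Imin: "X \<inter> X' \<subseteq> N" if N: "submodule N A M" "N \<noteq> {\<zero>\<^bsub>M\<^esub>}" for N
  proof -
    have "\<Phi> N \<noteq> carrier P" using inj[OF N(1) submodule_zero] N(2) \<Phi>0 by auto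
    then have "\<Phi> N \<subseteq> V <+>\<^bsub>P\<^esub> V'" using large \<Phi>(1)[OF N(1)] unfolding largest_proper_submodule_def by blast
    then show ?thesis using le[OF sI N(1)] \<Phi>I by blast
  qed
  then have Ismall: "smallest_nonzero_submodule A M (X \<inter> X')"
    using sI I_nz by (simp add: smallest_nonzero_submodule_def)
  \<comment> \<open>A proper sum would force \<open>V \<inter> V'\<close> to be nonzero, hence
    smallest; dually the sum would be the largest proper submodule of \<open>M\<close>, and
    \<open>M\<close> would be local.\<close>
  have J: "X <+>\<^bsub>M\<^esub> X' = carrier M"
  proof (rule ccontr)
    assume ne: "X <+>\<^bsub>M\<^esub> X' \<noteq> carrier M"
    have \<Phi>J: "\<Phi> (X <+>\<^bsub>M\<^esub> X') \<subseteq> V \<inter> V'" using D(8)[OF upJ(1)] D(8)[OF upJ(2)] X by auto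
    have "\<Phi> (X <+>\<^bsub>M\<^esub> X') \<noteq> {\<zero>\<^bsub>P\<^esub>}" using inj[OF sJ submodule_carrier] ne \<Phi>1 by auto
    then have "V \<inter> V' \<noteq> {\<zero>\<^bsub>P\<^esub>}" using \<Phi>J P.submodule_closed(2)[OF \<Phi>(1)[OF sJ]] by auto
    then have small: "smallest_nonzero_submodule ?B P (V \<inter> V')" using int by simp
    have "N \<subseteq> X <+>\<^bsub>M\<^esub> X'" if N: "submodule N A M" "N \<noteq> carrier M" for N
    proof -
      have "\<Phi> N \<noteq> {\<zero>\<^bsub>P\<^esub>}" using inj[OF N(1) submodule_carrier] N(2) \<Phi>1 by auto
      then have "V \<inter> V' \<subseteq> \<Phi> N" using small \<Phi>(1)[OF N(1)] unfolding smallest_nonzero_submodule_def by blast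
      then show ?thesis using le[OF N(1) sJ] \<Phi>J by blast
    qed
    then have "largest_proper_submodule A M (X <+>\<^bsub>M\<^esub> X')" using sJ ne by (simp add: largest_proper_submodule_def)
    then show False using nloc M.local_module_iff by blast
  qed
  \<comment> \<open>Uniseriality of a submodule of \<open>P\<close> dualises to a chain condition
    above \<open>U'\<close>, not below it, so it serves the other submodule: send \<open>Y\<close>
    inside \<open>U\<close> to \<open>Y + U'\<close>. The modular law recovers a nonzero
    \<open>Y\<close>, since \<open>U \<inter> U'\<close> is the smallest nonzero submodule.\<close>
  have uni: "uniserial A (M\<lparr>carrier := U\<rparr>)"
    if U: "submodule U A M" "submodule U' A M" "U \<inter> U' = X \<inter> X'" and uU: "uniserial ?B (P\<lparr>carrier := \<Phi> U'\<rparr>)" for U U'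
    unfolding uniserial_def submodule_restrict_iff[OF U(1)]
  proof (intro allI impI)
    have chain: "N \<subseteq> N' \<or> N' \<subseteq> N" if N: "submodule N A M" "submodule N' A M" "U' \<subseteq> N" "U' \<subseteq> N'" for N N'
    proof -
      have "\<Phi> N \<subseteq> \<Phi> U'" "\<Phi> N' \<subseteq> \<Phi> U'" using D(8) N by simp_all
      then have "\<Phi> N \<subseteq> \<Phi> N' \<or> \<Phi> N' \<subseteq> \<Phi> N"
        using uU \<Phi>(1) N(1,2) U(2) unfolding uniserial_def P.submodule_restrict_iff[OF \<Phi>(1)[OF U(2)]] by blast
      then show ?thesis using le N by blast
    qed
    have cancel: "Y \<subseteq> Y'" if Y: "submodule Y A M" "Y \<subseteq> U" "submodule Y' A M" "Y' \<subseteq> U" "Y' \<noteq> {\<zero>\<^bsub>M\<^esub>}"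
      "Y <+>\<^bsub>M\<^esub> U' \<subseteq> Y' <+>\<^bsub>M\<^esub> U'" for Y Y'
    proof -
      have "Y \<subseteq> U \<inter> (Y' <+>\<^bsub>M\<^esub> U')" using Y set_add_upper(1)[OF Y(1) U(2)] by auto
      also have "\<dots> = Y' <+>\<^bsub>M\<^esub> (U \<inter> U')" by (rule modular_law[OF Y(3) U(2) U(1) Y(4)])
      also have "\<dots> \<subseteq> Y'" using Imin[OF Y(3,5)] U(3) Y(3) by (intro set_add_least) auto
      finally show ?thesis .
    qed
    fix Y Y' assume *: "(submodule Y A M \<and> Y \<subseteq> U) \<and> submodule Y' A M \<and> Y' \<subseteq> U"
    then have Y: "submodule Y A M" "Y \<subseteq> U" "submodule Y' A M" "Y' \<subseteq> U" by simp_all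
    show "Y \<subseteq> Y' \<or> Y' \<subseteq> Y"
    proof (cases "Y = {\<zero>\<^bsub>M\<^esub>} \<or> Y' = {\<zero>\<^bsub>M\<^esub>}")
      case True
      then show ?thesis using z[OF Y(1)] z[OF Y(3)] by auto
    next
      case False
      have "Y <+>\<^bsub>M\<^esub> U' \<subseteq> Y' <+>\<^bsub>M\<^esub> U' \<or> Y' <+>\<^bsub>M\<^esub> U' \<subseteq> Y <+>\<^bsub>M\<^esub> U'"
        using Y U(2) by (intro chain submodule_set_add set_add_upper)
      then show ?thesis using cancel[OF Y] cancel[OF Y(3,4,1,2)] False by auto
    qed
  qed
  have "uniserial A (M\<lparr>carrier := X\<rparr>)" using uni[OF X(1,2)] X(4) uV(2) by simp
  moreover have "uniserial A (M\<lparr>carrier := X'\<rparr>)" using uni[OF X(2,1)] X(3) uV(1) by (simp add: Int_commute)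
  ultimately show ?thesis unfolding biserial_module_def using ind X(1,2) inc J Ismall by blast
qed

end

section \<open>Local modules of length four\<close>

text \<open>The homomorphism theorem in terms of elements. It serves to invert isomorphisms, to move
  a map from one quotient to an isomorphic one, and to define maps on a direct sum.\<close>

lemma ex_factor_hom:
  assumes U: "left_module A U"
    and \<rho>: "\<rho> \<in> module_hom A U T" "\<rho> ` carrier U = carrier T" and \<psi>: "\<psi> \<in> module_hom A U E"
    and ker: "\<And>x y. x \<in> carrier U \<Longrightarrow> y \<in> carrier U \<Longrightarrow> \<rho> x = \<rho> y \<Longrightarrow> \<psi> x = \<psi> y"
  shows "\<exists>\<phi>\<in>module_hom A T E. \<forall>x\<in>carrier U. \<phi> (\<rho> x) = \<psi> x"
proof -
  interpret U: left_module A U by (rule U)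
  have \<rho>h: "\<And>x y. x \<in> carrier U \<Longrightarrow> y \<in> carrier U \<Longrightarrow> \<rho> (x \<oplus>\<^bsub>U\<^esub> y) = \<rho> x \<oplus>\<^bsub>T\<^esub> \<rho> y"
    "\<And>a x. a \<in> carrier A \<Longrightarrow> x \<in> carrier U \<Longrightarrow> \<rho> (a \<odot>\<^bsub>U\<^esub> x) = a \<odot>\<^bsub>T\<^esub> \<rho> x"
    using \<rho>(1) by (auto simp: module_hom_def)
  have \<psi>h: "\<And>x. x \<in> carrier U \<Longrightarrow> \<psi> x \<in> carrier E"
    "\<And>x y. x \<in> carrier U \<Longrightarrow> y \<in> carrier U \<Longrightarrow> \<psi> (x \<oplus>\<^bsub>U\<^esub> y) = \<psi> x \<oplus>\<^bsub>E\<^esub> \<psi> y"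
    "\<And>a x. a \<in> carrier A \<Longrightarrow> x \<in> carrier U \<Longrightarrow> \<psi> (a \<odot>\<^bsub>U\<^esub> x) = a \<odot>\<^bsub>E\<^esub> \<psi> x"
    using \<psi> by (auto simp: module_hom_def)
  define s where "s = inv_into (carrier U) \<rho>"
  have s: "s u \<in> carrier U" "\<rho> (s u) = u" if "u \<in> carrier T" for u
    unfolding s_def using that \<rho>(2) inv_into_into[of u \<rho> "carrier U"] f_inv_into_f[of u \<rho> "carrier U"] by simp_all
  define \<phi> where "\<phi> u = \<psi> (s u)" for u
  have eq: "\<phi> (\<rho> x) = \<psi> x" if x: "x \<in> carrier U" for x
  proof -
    have "\<rho> x \<in> carrier T" using x \<rho>(2) by blast
    then show ?thesis unfolding \<phi>_def using ker[OF s(1) x s(2)] by simp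
  qed
  have "\<phi> \<in> module_hom A T E"
  proof (rule module_homI)
    fix u assume u: "u \<in> carrier T"
    show "\<phi> u \<in> carrier E" unfolding \<phi>_def using \<psi>h(1) s(1)[OF u] .
    fix v assume v: "v \<in> carrier T"
    have "\<phi> (u \<oplus>\<^bsub>T\<^esub> v) = \<phi> (\<rho> (s u \<oplus>\<^bsub>U\<^esub> s v))" using \<rho>h(1) s u v by simp
    also have "\<dots> = \<psi> (s u \<oplus>\<^bsub>U\<^esub> s v)" using s(1) u v by (intro eq) simp
    finally show "\<phi> (u \<oplus>\<^bsub>T\<^esub> v) = \<phi> u \<oplus>\<^bsub>E\<^esub> \<phi> v" unfolding \<phi>_def using \<psi>h(2) s(1) u v by simp
  next
    fix a u assume a: "a \<in> carrier A" and u: "u \<in> carrier T"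
    have "\<phi> (a \<odot>\<^bsub>T\<^esub> u) = \<phi> (\<rho> (a \<odot>\<^bsub>U\<^esub> s u))" using \<rho>h(2) s u a by simp
    also have "\<dots> = \<psi> (a \<odot>\<^bsub>U\<^esub> s u)" using s(1) u a by (intro eq) simp
    finally show "\<phi> (a \<odot>\<^bsub>T\<^esub> u) = a \<odot>\<^bsub>E\<^esub> \<phi> u" unfolding \<phi>_def using \<psi>h(3) s(1) u a by simp
  qed
  then show ?thesis using eq by blast
qed

lemma module_hom_comp:
  assumes "f \<in> module_hom A L M" "g \<in> module_hom A M N"
  shows "(\<lambda>x. g (f x)) \<in> module_hom A L N"
  using assms unfolding module_hom_def by (auto simp: Pi_iff)

lemma projective_module_iso:
  fixes P :: "('a, 'm) module" and M :: "('a, 'n) module"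
  assumes P: "projective A P" and M: "fg_module A M"
    and \<pi>: "\<pi> \<in> module_hom A P M" "bij_betw \<pi> (carrier P) (carrier M)"
  shows "projective A M"
  unfolding projective_def
proof (intro conjI M allI ballI impI)
  fix X Y :: "'a fg_object" and p f
  assume p: "p \<in> module_hom A X Y" and f: "f \<in> module_hom A M Y"
    and *: "fg_module A X \<and> fg_module A Y \<and> p ` carrier X = carrier Y"
  have lP: "left_module A P" using P by (simp add: projective_def fg_module_def)
  obtain g where g: "g \<in> module_hom A P X" "\<forall>x\<in>carrier P. p (g x) = f (\<pi> x)"
    using P[unfolded projective_def, THEN conjunct2, rule_format, OF p module_hom_comp[OF \<pi>(1) f] *] by blast
  have ker: "g x = g y" if "x \<in> carrier P" "y \<in> carrier P" "\<pi> x = \<pi> y" for x y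
    using inj_onD[OF bij_betw_imp_inj_on[OF \<pi>(2)] that(3,1,2)] by simp
  obtain g' where g': "g' \<in> module_hom A M X" "\<forall>x\<in>carrier P. g' (\<pi> x) = g x"
    using ex_factor_hom[OF lP \<pi>(1) bij_betw_imp_surj_on[OF \<pi>(2)] g(1) ker] by blast
  have "p (g' y) = f y" if "y \<in> carrier M" for y
  proof -
    have "y \<in> \<pi> ` carrier P" using that bij_betw_imp_surj_on[OF \<pi>(2)] by simp
    then obtain x where x: "y = \<pi> x" "x \<in> carrier P" by (rule imageE)
    then show ?thesis using bspec[OF g(2) x(2)] bspec[OF g'(2) x(2)] by simp
  qed
  then show "\<exists>g\<in>module_hom A M X. \<forall>x\<in>carrier M. p (g x) = f x"
    by (intro bexI[OF _ g'(1)] ballI)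
qed

section \<open>Biserial modules under isomorphisms\<close>

context module_morphism
begin

context
  assumes bij: "bij_betw f (carrier M) (carrier N)"
begin

lemma bij_image_subset_iff:
  assumes "submodule X A M" "submodule X' A M"
  shows "f ` X \<subseteq> f ` X' \<longleftrightarrow> X \<subseteq> X'"
proof
  assume le: "f ` X \<subseteq> f ` X'"
  show "X \<subseteq> X'"
  proof
    fix x assume x: "x \<in> X"
    then have "x \<in> carrier M" "f x \<in> f ` X'" using le M.submodule_closed(1)[OF assms(1)] by auto
    then show "x \<in> X'"
      using inj_on_image_mem_iff[OF bij_betw_imp_inj_on[OF bij] _ M.submodule_closed(1)[OF assms(2)]] by simp
  qed
qed (rule image_mono)

lemma bij_submodule:
  assumes "submodule Y A N" shows "\<exists>X. submodule X A M \<and> Y = f ` X"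
  using image_pre[of Y] submodule_pre[OF assms] N.submodule_closed(1)[OF assms] bij_betw_imp_surj_on[OF bij]
  by (intro exI[of _ "pre Y"]) simp

lemma bij_image_zero: "f ` {\<zero>\<^bsub>M\<^esub>} = {\<zero>\<^bsub>N\<^esub>}"
  by (simp add: hom_zero)

lemma bij_image_eq_iff:
  assumes "submodule X A M" "submodule X' A M"
  shows "f ` X = f ` X' \<longleftrightarrow> X = X'"
  using bij_image_subset_iff[OF assms] bij_image_subset_iff[OF assms(2,1)] by auto

lemma bij_uniserial:
  assumes X: "submodule X A M" and u: "uniserial A (M\<lparr>carrier := X\<rparr>)"
  shows "uniserial A (N\<lparr>carrier := f ` X\<rparr>)"
  unfolding uniserial_def N.submodule_restrict_iff[OF submodule_image[OF X]]
proof (intro allI impI)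
  fix Y Y' assume "(submodule Y A N \<and> Y \<subseteq> f ` X) \<and> submodule Y' A N \<and> Y' \<subseteq> f ` X"
  then obtain U U' where U: "submodule U A M" "Y = f ` U" "submodule U' A M" "Y' = f ` U'" "f ` U \<subseteq> f ` X" "f ` U' \<subseteq> f ` X"
    using bij_submodule[of Y] bij_submodule[of Y'] by blast
  then have "U \<subseteq> U' \<or> U' \<subseteq> U"
    using u bij_image_subset_iff X unfolding uniserial_def M.submodule_restrict_iff[OF X] by simp
  then show "Y \<subseteq> Y' \<or> Y' \<subseteq> Y" using U by auto
qed

lemma bij_biserial:
  assumes bis: "biserial_module A M" and ind: "indecomposable A N"
  shows "biserial_module A N"
proof -
  obtain V V' where V: "submodule V A M" "submodule V' A M" "\<not> V \<subseteq> V'" "\<not> V' \<subseteq> V"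
    and uV: "uniserial A (M\<lparr>carrier := V\<rparr>)" "uniserial A (M\<lparr>carrier := V'\<rparr>)"
    and sum: "V <+>\<^bsub>M\<^esub> V' = carrier M \<or> largest_proper_submodule A M (V <+>\<^bsub>M\<^esub> V')"
    and int: "V \<inter> V' = {\<zero>\<^bsub>M\<^esub>} \<or> smallest_nonzero_submodule A M (V \<inter> V')"
    using bis unfolding biserial_module_def by blast
  note cV = M.submodule_closed(1)[OF V(1)] M.submodule_closed(1)[OF V(2)]
  have car: "f ` carrier M = carrier N" using bij_betw_imp_surj_on[OF bij] .
  have sI: "submodule (V \<inter> V') A M" and sJ: "submodule (V <+>\<^bsub>M\<^esub> V') A M"
    using M.submodule_Int[OF V(1,2)] M.submodule_set_add[OF V(1,2)] by simp_all
  have I: "f ` V \<inter> f ` V' = f ` (V \<inter> V')"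
    using inj_on_image_Int[OF bij_betw_imp_inj_on[OF bij] cV] by simp
  have J: "f ` V <+>\<^bsub>N\<^esub> f ` V' = f ` (V <+>\<^bsub>M\<^esub> V')" using image_set_add[OF cV] by simp
  have tl: "largest_proper_submodule A N (f ` X)" if X: "largest_proper_submodule A M X" for X
    unfolding largest_proper_submodule_def
  proof (intro conjI allI impI)
    have sX: "submodule X A M" "X \<noteq> carrier M" using X by (simp_all add: largest_proper_submodule_def)
    show "submodule (f ` X) A N" by (rule submodule_image[OF sX(1)])
    show "f ` X \<noteq> carrier N" using bij_image_eq_iff[OF sX(1) M.submodule_carrier] sX(2) car by simp
    fix Y assume Y: "submodule Y A N \<and> Y \<noteq> carrier N"
    then obtain U where U: "submodule U A M" "Y = f ` U" using bij_submodule by blast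
    then have "U \<noteq> carrier M" using Y car by auto
    then show "Y \<subseteq> f ` X" using X U unfolding largest_proper_submodule_def by blast
  qed
  have ts: "smallest_nonzero_submodule A N (f ` X)" if X: "smallest_nonzero_submodule A M X" for X
    unfolding smallest_nonzero_submodule_def
  proof (intro conjI allI impI)
    have sX: "submodule X A M" "X \<noteq> {\<zero>\<^bsub>M\<^esub>}" using X by (simp_all add: smallest_nonzero_submodule_def)
    show "submodule (f ` X) A N" by (rule submodule_image[OF sX(1)])
    show "f ` X \<noteq> {\<zero>\<^bsub>N\<^esub>}" using bij_image_eq_iff[OF sX(1) M.submodule_zero] sX(2) bij_image_zero by simp
    fix Y assume Y: "submodule Y A N \<and> Y \<noteq> {\<zero>\<^bsub>N\<^esub>}"
    then obtain U where U: "submodule U A M" "Y = f ` U" using bij_submodule by blast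
    then have "U \<noteq> {\<zero>\<^bsub>M\<^esub>}" using Y bij_image_zero by auto
    then show "f ` X \<subseteq> Y" using X U unfolding smallest_nonzero_submodule_def by blast
  qed
  have "f ` V <+>\<^bsub>N\<^esub> f ` V' = carrier N \<or> largest_proper_submodule A N (f ` V <+>\<^bsub>N\<^esub> f ` V')"
    unfolding J using sum car tl by metis
  moreover have "f ` V \<inter> f ` V' = {\<zero>\<^bsub>N\<^esub>} \<or> smallest_nonzero_submodule A N (f ` V \<inter> f ` V')"
    unfolding I using int bij_image_zero ts by metis
  moreover have "\<not> f ` V \<subseteq> f ` V'" "\<not> f ` V' \<subseteq> f ` V"
    using bij_image_subset_iff[OF V(1,2)] bij_image_subset_iff[OF V(2,1)] V(3,4) by simp_all
  ultimately show ?thesis unfolding biserial_module_def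
    using ind submodule_image[OF V(1)] submodule_image[OF V(2)] bij_uniserial[OF V(1) uV(1)] bij_uniserial[OF V(2) uV(2)]
    by blast
qed

end

end

section \<open>Covers of local modules by indecomposable projectives\<close>

context artin_algebra_module
begin

text \<open>For \<open>x\<close> outside the largest proper submodule \<open>Q\<close> and a
  primitive \<open>e\<close> with \<open>e x\<close> outside \<open>Q\<close>, the map on Ae sending
  \<open>a\<close> to \<open>a x\<close> has an image that is not inside \<open>Q\<close>, hence all
  of \<open>M\<close>.\<close>

lemma ex_projective_onto_local:
  assumes Q: "largest_proper_submodule A M Q"
  shows "\<exists>(P :: 'a fg_object) \<pi>. projective A P \<and> indecomposable A P \<and> \<pi> \<in> module_hom A P M \<and>
    \<pi> ` carrier P = carrier M"
proof -
  have sQ: "submodule Q A M" "Q \<noteq> carrier M" "\<And>N. submodule N A M \<Longrightarrow> N \<noteq> carrier M \<Longrightarrow> N \<subseteq> Q"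
    using Q by (simp_all add: largest_proper_submodule_def)
  obtain x where x: "x \<in> carrier M" "x \<notin> Q" using sQ submodule_closed(1)[OF sQ(1)] by blast
  obtain e where e: "primitive_idempotent A e" "e \<odot>\<^bsub>M\<^esub> x \<notin> Q"
    using ex_primitive_idempotent[OF alg.artin_algebra_axioms left_module_axioms sQ(1) x] by blast
  obtain P :: "'a fg_object" and \<theta> where P: "left_ideal_module A P e \<theta>" "projective A P" "indecomposable A P"
    using ex_left_ideal_module[OF alg.ring_axioms e(1)] by blast
  interpret P: left_ideal_module A P e \<theta> by (rule P(1))
  let ?\<pi> = "\<lambda>w. \<theta> w \<odot>\<^bsub>M\<^esub> x"
  have hom: "?\<pi> \<in> module_hom A P M" by (rule P.hom_exists[OF left_module_axioms x(1)])
  interpret \<pi>: module_morphism A P M ?\<pi>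
    by (intro module_morphismI P.left_module_axioms left_module_axioms hom)
  have "e \<odot>\<^bsub>M\<^esub> x \<in> ?\<pi> ` carrier P"
    using P.generator by (intro image_eqI[of _ _ P.generator]) simp_all
  then have "\<not> ?\<pi> ` carrier P \<subseteq> Q" using e(2) by blast
  then have "?\<pi> ` carrier P = carrier M" using sQ(3) \<pi>.submodule_image[OF P.submodule_carrier] by blast
  then show ?thesis using P(2,3) hom by blast
qed

text \<open>A composition series of \<open>M\<close> pulls back to four strict steps above the
  kernel, in a projective module of length at most four. So the kernel has height zero.\<close>

lemma ex_projective_iso_local:
  assumes quadri: "projectives_quadri A" and len: "has_length A M 4" and loc: "local_module A M"
  shows "\<exists>(P :: 'a fg_object) \<pi>. projective A P \<and> indecomposable A P \<and> \<pi> \<in> module_hom A P M \<and>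
    bij_betw \<pi> (carrier P) (carrier M)"
proof -
  obtain hM where hM: "finite_length A M hM" "hM (carrier M) = 4" using ex_finite_length[OF len] by blast
  interpret M: finite_length A M hM by (rule hM(1))
  obtain Q where Q: "largest_proper_submodule A M Q" using loc M.local_module_iff by blast
  obtain P :: "'a fg_object" and \<pi> where P: "projective A P" "indecomposable A P" "\<pi> \<in> module_hom A P M"
    "\<pi> ` carrier P = carrier M" using ex_projective_onto_local[OF Q] by blast
  interpret P: lmod A P using P(1) by (simp add: lmod_def projective_def fg_module_def)
  interpret \<pi>: module_morphism A P M \<pi>
    by (intro module_morphismI P.left_module_axioms left_module_axioms P(3))
  obtain n where n: "n \<le> 4" "has_length A P n"
    using quadri P(1,2) unfolding projectives_quadri_def quadri_condition_def Let_def by blast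
  obtain h where h: "finite_length A P h" "h (carrier P) = n" using P.ex_finite_length[OF n(2)] by blast
  interpret P: finite_length A P h by (rule h(1))
  have "has_length A (M\<lparr>carrier := carrier M\<rparr>) 4" using len by simp
  then obtain C where C: "C 0 = {\<zero>\<^bsub>M\<^esub>}" "C 4 = carrier M" "\<And>i. i < 4 \<Longrightarrow> covers A M (C i) (C (Suc i))"
    unfolding has_length_iff[OF submodule_carrier] by auto
  have sC: "submodule (C i) A M" if "i \<le> 4" for i
    using that C(3)[of i] C(2) by (cases "i = 4") (auto simp: covers_def)
  have "h (\<pi>.pre (C 0)) + 4 \<le> h (\<pi>.pre (C 4))"
  proof (rule P.h_less_chain)
    show "submodule (\<pi>.pre (C i)) A P" if "i \<le> 4" for i by (rule \<pi>.submodule_pre[OF sC[OF that]])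
    show "\<pi>.pre (C i) \<subset> \<pi>.pre (C (Suc i))" if "i < 4" for i
      using \<pi>.covers_pre[OF P(4) sC sC, of i "Suc i"] C(3)[OF that] that by (simp add: covers_def)
  qed
  moreover have "h (\<pi>.pre (C 4)) \<le> 4" using P.h_le[OF \<pi>.submodule_pre[OF sC[of 4]]] h(2) n(1) by simp
  ultimately have "h \<pi>.kern = 0" using C(1) \<pi>.kern_eq by simp
  then have "\<pi>.kern = {\<zero>\<^bsub>P\<^esub>}" using P.h_eq_0[OF \<pi>.submodule_kern] by simp
  then have "bij_betw \<pi> (carrier P) (carrier M)" using \<pi>.inj_onI_kern P(4) by (simp add: bij_betw_def)
  then show ?thesis using P by blast
qed

lemma projective_of_local:
  assumes "projectives_quadri A" "fg_module A M" "has_length A M 4" "local_module A M"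
  shows "projective A M"
proof -
  obtain P :: "'a fg_object" and \<pi> where P: "projective A P" "\<pi> \<in> module_hom A P M"
    "bij_betw \<pi> (carrier P) (carrier M)" using ex_projective_iso_local[OF assms(1,3,4)] by blast
  show ?thesis by (rule projective_module_iso[OF P(1) assms(2) P(2,3)])
qed

lemma biserial_of_local:
  assumes quadri: "projectives_quadri A" and bis: "projectives_biserial A" and len: "has_length A M 4"
    and loc: "local_module A M" and ind: "indecomposable A M" and nu: "\<not> uniserial A M"
  shows "biserial_module A M"
proof -
  obtain P :: "'a fg_object" and \<pi> where P: "projective A P" "indecomposable A P" "\<pi> \<in> module_hom A P M"
    "bij_betw \<pi> (carrier P) (carrier M)" using ex_projective_iso_local[OF quadri len loc] by blast
  interpret P: left_module A P using P(1) by (simp add: projective_def fg_module_def)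
  interpret \<pi>: module_morphism A P M \<pi>
    by (intro module_morphismI P.left_module_axioms left_module_axioms P(3))
  have "\<not> uniserial A P"
    using \<pi>.bij_uniserial[OF P(4) P.submodule_carrier] nu bij_betw_imp_surj_on[OF P(4)] by auto
  then have "biserial_module A P" using bis P(1,2) unfolding projectives_biserial_def by blast
  then show ?thesis by (rule \<pi>.bij_biserial[OF P(4) _ ind])
qed

end

section \<open>Modules that are neither local nor colocal\<close>

context finite_length
begin

text \<open>\<open>L\<close> is local with radical \<open>D\<close>, and \<open>D\<close> is both the socle and the radical of \<open>M\<close>.\<close>

definition nonlocal_frame :: "'m set \<Rightarrow> 'm set \<Rightarrow> 'm set \<Rightarrow> 'm set \<Rightarrow> bool" where
  "nonlocal_frame L D T1 T2 \<longleftrightarrow> submodule L A M \<and> h L = 3 \<and> submodule D A M \<and> h D = 2 \<and> D \<subseteq> L \<and>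
     (\<forall>N. submodule N A M \<and> N \<subset> L \<longrightarrow> N \<subseteq> D) \<and>
     covers A M {\<zero>\<^bsub>M\<^esub>} T1 \<and> covers A M {\<zero>\<^bsub>M\<^esub>} T2 \<and> T1 \<inter> T2 = {\<zero>\<^bsub>M\<^esub>} \<and> T1 <+>\<^bsub>M\<^esub> T2 = D \<and>
     (\<forall>T. covers A M {\<zero>\<^bsub>M\<^esub>} T \<longrightarrow> T \<subseteq> D) \<and> (\<forall>m. covers A M m (carrier M) \<longrightarrow> D \<subseteq> m)"

text \<open>Indecomposability forces every simple submodule into every maximal one. A second simple
  submodule exists since \<open>M\<close> is not colocal, a second maximal one since
  \<open>M\<close> is not local. Two of the former span height two, two of the latter meet in height
  two, so both give the same \<open>D\<close>.\<close>

lemma ex_nonlocal_frame: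
  assumes h4: "h (carrier M) = 4" and ind: "indecomposable A M"
    and nloc: "\<not> local_module A M" and ncol: "\<not> colocal_module A M"
  shows "\<exists>L D T1 T2. nonlocal_frame L D T1 T2"
proof -
  have z: "{\<zero>\<^bsub>M\<^esub>} \<subseteq> N" if "submodule N A M" for N using submodule_closed(2)[OF that] by simp
  have top: "N \<subseteq> carrier M" if "submodule N A M" for N using submodule_closed(1)[OF that] .
  have nz: "carrier M \<noteq> {\<zero>\<^bsub>M\<^esub>}" using h4 h_zero by auto
  have dec: "N = {\<zero>\<^bsub>M\<^esub>} \<or> N' = {\<zero>\<^bsub>M\<^esub>}"
    if "submodule N A M" "submodule N' A M" "N <+>\<^bsub>M\<^esub> N' = carrier M" "N \<inter> N' = {\<zero>\<^bsub>M\<^esub>}" for N N'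
    using ind that unfolding indecomposable_def internal_direct_sum_def by blast
  have hmax: "covers A M m (carrier M) \<longleftrightarrow> submodule m A M \<and> h m = 3" for m
    unfolding covers_iff_h using h4 top[of m] by auto
  have hatom: "covers A M {\<zero>\<^bsub>M\<^esub>} T \<longleftrightarrow> submodule T A M \<and> h T = 1" for T
    unfolding covers_iff_h using h_zero z[of T] by auto
  have atom_int: "T \<inter> N = {\<zero>\<^bsub>M\<^esub>}" if T: "covers A M {\<zero>\<^bsub>M\<^esub>} T" and N: "submodule N A M" "\<not> T \<subseteq> N" for T N
  proof -
    have sT: "submodule T A M" using T by (simp add: covers_def)
    have "T \<inter> N = {\<zero>\<^bsub>M\<^esub>} \<or> T \<inter> N = T"
      using T submodule_Int[OF sT N(1)] z[OF submodule_Int[OF sT N(1)]] unfolding covers_def by blast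
    then show ?thesis using N(2) by blast
  qed
  obtain T1 where T1: "covers A M {\<zero>\<^bsub>M\<^esub>} T1" using ex_atom_below[OF submodule_carrier nz] by blast
  then have sT1: "submodule T1 A M" "h T1 = 1" "T1 \<noteq> {\<zero>\<^bsub>M\<^esub>}" using hatom h_zero by auto
  obtain N where N: "submodule N A M" "N \<noteq> {\<zero>\<^bsub>M\<^esub>}" "\<not> T1 \<subseteq> N"
    using ncol colocal_module_iff sT1 unfolding smallest_nonzero_submodule_def by blast
  obtain T2 where T2: "covers A M {\<zero>\<^bsub>M\<^esub>} T2" "T2 \<subseteq> N" using ex_atom_below[OF N(1,2)] by blast
  then have sT2: "submodule T2 A M" "h T2 = 1" using hatom by auto
  have T12: "T1 \<inter> T2 = {\<zero>\<^bsub>M\<^esub>}" using atom_int[OF T1 sT2(1)] N(3) T2(2) by blast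
  define D where "D = T1 <+>\<^bsub>M\<^esub> T2"
  have D: "submodule D A M" unfolding D_def by (rule submodule_set_add[OF sT1(1) sT2(1)])
  have hD: "h D = 2" using h_modular[OF sT1(1) sT2(1)] T12 h_zero sT1 sT2 unfolding D_def by simp
  \<comment> \<open>Otherwise the simple and the maximal submodule would be complements, and
    \<open>M\<close> would decompose.\<close>
  have atom_max: "T \<subseteq> m" if T: "covers A M {\<zero>\<^bsub>M\<^esub>} T" and m: "covers A M m (carrier M)" for T m
  proof (rule ccontr)
    assume n: "\<not> T \<subseteq> m"
    have s: "submodule T A M" "submodule m A M" using T m by (auto simp: covers_def)
    note S = submodule_set_add[OF s] and up = set_add_upper[OF s]
    have "T <+>\<^bsub>M\<^esub> m \<noteq> m" using up n by auto
    then have "T <+>\<^bsub>M\<^esub> m = carrier M" using m S up top[OF S] unfolding covers_def by blast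
    then have "T = {\<zero>\<^bsub>M\<^esub>} \<or> m = {\<zero>\<^bsub>M\<^esub>}" using dec[OF s] atom_int[OF T s(2) n] by simp
    then show False using T m hatom hmax h_zero by auto
  qed
  have Dmax: "D \<subseteq> m" if m: "covers A M m (carrier M)" for m
  proof -
    have "submodule m A M" using m by (simp add: covers_def)
    then show ?thesis unfolding D_def using atom_max[OF T1 m] atom_max[OF T2(1) m] by (intro set_add_least)
  qed
  obtain m1 where m1: "covers A M m1 (carrier M)"
    using ex_covered_above[OF submodule_zero submodule_carrier] nz z[OF submodule_carrier] by blast
  then have sm1: "submodule m1 A M" "h m1 = 3" using hmax by auto
  have two_max: "\<exists>N. submodule N A M \<and> N \<noteq> carrier M \<and> \<not> N \<subseteq> m" if m: "covers A M m (carrier M)" for m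
    using nloc local_module_iff m unfolding largest_proper_submodule_def covers_def by blast
  have max_int: "h (m \<inter> m') = 2" if m: "submodule m A M" "h m = 3" "submodule m' A M" "h m' = 3" "m \<noteq> m'" for m m'
  proof -
    note s = submodule_set_add[OF m(1,3)] and up = set_add_upper[OF m(1,3)]
    have "m \<noteq> m <+>\<^bsub>M\<^esub> m'"
    proof
      assume "m = m <+>\<^bsub>M\<^esub> m'"
      then have "m' \<subseteq> m" using up by simp
      then show False using h_eq[OF m(3,1)] m by simp
    qed
    then have "h m < h (m <+>\<^bsub>M\<^esub> m')" using h_strict[OF m(1) s] up by blast
    then have "h (m <+>\<^bsub>M\<^esub> m') = 4" using h_le[OF s] h4 m by simp
    then show ?thesis using h_modular[OF m(1,3)] m by simp
  qed
  have atoms: "T \<subseteq> D" if T: "covers A M {\<zero>\<^bsub>M\<^esub>} T" for T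
  proof -
    obtain N where N: "submodule N A M" "N \<noteq> carrier M" "\<not> N \<subseteq> m1" using two_max[OF m1] by blast
    then obtain m2 where m2: "N \<subseteq> m2" "covers A M m2 (carrier M)"
      using ex_covered_above[OF N(1) submodule_carrier] top[OF N(1)] by blast
    have sm2: "submodule m2 A M" "h m2 = 3" using m2 hmax by auto
    have "m1 \<noteq> m2" using N m2 by blast
    then have "h (m1 \<inter> m2) = 2" by (rule max_int[OF sm1 sm2])
    then have "D = m1 \<inter> m2"
      using h_eq[OF D submodule_Int[OF sm1(1) sm2(1)]] Dmax[OF m1] Dmax[OF m2(2)] hD by simp
    then show ?thesis using atom_max[OF T m1] atom_max[OF T m2(2)] by simp
  qed
  \<comment> \<open>A submodule of least height outside \<open>m\<close> has all its proper
    submodules inside \<open>m\<close>. Height one is excluded because simple submodules lie in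
    \<open>m\<close>, height four because \<open>M\<close> is not local.\<close>
  have ex_min: "\<exists>L. submodule L A M \<and> \<not> L \<subseteq> m \<and> (\<forall>N. submodule N A M \<and> N \<subset> L \<longrightarrow> N \<subseteq> m) \<and> (h L = 2 \<or> h L = 3)"
    if m: "covers A M m (carrier M)" for m
  proof -
    have sm: "submodule m A M" "m \<subset> carrier M" using m by (auto simp: covers_def)
    let ?P = "\<lambda>L. submodule L A M \<and> \<not> L \<subseteq> m"
    have "\<exists>L. ?P L \<and> (\<forall>N. ?P N \<longrightarrow> h L \<le> h N)"
      by (rule ex_has_least_nat[of ?P "carrier M"]) (use sm(2) in auto)
    then obtain L where L: "submodule L A M" "\<not> L \<subseteq> m" and min: "\<And>N. ?P N \<Longrightarrow> h L \<le> h N" by blast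
    have sub: "N \<subseteq> m" if "submodule N A M" "N \<subset> L" for N
      using min[of N] h_strict[OF that(1) L(1) that(2)] that(1) by linarith
    have "h L \<noteq> 0" using h_eq_0[OF L(1)] L(2) z[OF sm(1)] by auto
    moreover have "h L \<noteq> 1" using atom_max[of L m] m L hatom by blast
    moreover have "h L \<noteq> 4"
    proof
      assume "h L = 4"
      then have "L = carrier M" using h_eq[OF L(1) submodule_carrier top[OF L(1)]] h4 by simp
      then show False using two_max[OF m] sub top by blast
    qed
    moreover have "h L \<le> 4" using h_le[OF L(1)] h4 by simp
    ultimately show ?thesis using L sub by (intro exI[of _ L]) auto
  qed
  \<comment> \<open>A minimal \<open>L1\<close> of height two has to be replaced. The maximal
    submodule \<open>L1 + D\<close> absorbs it, so a minimal \<open>L2\<close> outside that one is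
    taken. If \<open>L2\<close> had height two as well, it would either be a complement of
    \<open>L1\<close>, or \<open>L1 + L2\<close> would have height three, contain \<open>D\<close>
    and coincide with \<open>L1 + D\<close>.\<close>
  have "\<exists>L m. submodule L A M \<and> \<not> L \<subseteq> m \<and> covers A M m (carrier M) \<and>
      (\<forall>N. submodule N A M \<and> N \<subset> L \<longrightarrow> N \<subseteq> m) \<and> h L = 3"
  proof -
    obtain L1 where L1: "submodule L1 A M" "\<not> L1 \<subseteq> m1" "\<forall>N. submodule N A M \<and> N \<subset> L1 \<longrightarrow> N \<subseteq> m1"
      "h L1 = 2 \<or> h L1 = 3" using ex_min[OF m1] by blast
    show ?thesis
    proof (cases "h L1 = 3")
      case True
      then show ?thesis using L1 m1 by blast
    next
      case False
      then have h1: "h L1 = 2" using L1(4) by simp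
      have "L1 \<noteq> {\<zero>\<^bsub>M\<^esub>}" using h1 h_zero by auto
      then obtain T where T: "covers A M {\<zero>\<^bsub>M\<^esub>} T" "T \<subseteq> L1" using ex_atom_below[OF L1(1)] by blast
      have sT: "submodule T A M" "h T = 1" using T(1) hatom by auto
      note sLD = submodule_Int[OF L1(1) D]
      have "h T \<le> h (L1 \<inter> D)" using h_mono[OF sT(1) sLD] T(2) atoms[OF T(1)] by simp
      moreover have "L1 \<inter> D \<subset> L1" using L1(2) Dmax[OF m1] by blast
      then have "h (L1 \<inter> D) < h L1" by (rule h_strict[OF sLD L1(1)])
      ultimately have "h (L1 \<inter> D) = 1" using h1 sT by simp
      define m where "m = L1 <+>\<^bsub>M\<^esub> D"
      have sm: "submodule m A M" unfolding m_def by (rule submodule_set_add[OF L1(1) D])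
      have Lm: "L1 \<subseteq> m" unfolding m_def by (rule set_add_upper[OF L1(1) D])
      have hm: "h m = 3" using h_modular[OF L1(1) D] h1 hD \<open>h (L1 \<inter> D) = 1\<close> unfolding m_def by simp
      have m: "covers A M m (carrier M)" using hmax sm hm by simp
      obtain L2 where L2: "submodule L2 A M" "\<not> L2 \<subseteq> m" "\<forall>N. submodule N A M \<and> N \<subset> L2 \<longrightarrow> N \<subseteq> m"
        "h L2 = 2 \<or> h L2 = 3" using ex_min[OF m] by blast
      have "h L2 \<noteq> 2"
      proof
        assume h2: "h L2 = 2"
        note sI = submodule_Int[OF L1(1) L2(1)] and sJ = submodule_set_add[OF L1(1) L2(1)]
        note up = set_add_upper[OF L1(1) L2(1)]
        have "L1 \<inter> L2 \<subset> L2" using L2(2) Lm by blast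
        then have "h (L1 \<inter> L2) < 2" using h_strict[OF sI L2(1)] h2 by simp
        moreover have "h (L1 \<inter> L2) \<noteq> 0"
        proof
          assume 0: "h (L1 \<inter> L2) = 0"
          then have "h (L1 <+>\<^bsub>M\<^esub> L2) = 4" using h_modular[OF L1(1) L2(1)] h1 h2 by simp
          then have "L1 <+>\<^bsub>M\<^esub> L2 = carrier M" using h_eq[OF sJ submodule_carrier top[OF sJ]] h4 by simp
          then have "L1 = {\<zero>\<^bsub>M\<^esub>} \<or> L2 = {\<zero>\<^bsub>M\<^esub>}" using dec[OF L1(1) L2(1)] 0 h_eq_0[OF sI] by simp
          then show False using h1 h2 h_zero by auto
        qed
        ultimately have "h (L1 \<inter> L2) = 1" by simp
        then have hJ: "h (L1 <+>\<^bsub>M\<^esub> L2) = 3" using h_modular[OF L1(1) L2(1)] h1 h2 by simp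
        then have "D \<subseteq> L1 <+>\<^bsub>M\<^esub> L2" using Dmax hmax sJ by simp
        then have "m \<subseteq> L1 <+>\<^bsub>M\<^esub> L2" unfolding m_def using up by (intro set_add_least sJ)
        then have "m = L1 <+>\<^bsub>M\<^esub> L2" using h_eq[OF sm sJ] hm hJ by simp
        then show False using up L2(2) by simp
      qed
      then show ?thesis using L2 m by blast
    qed
  qed
  then obtain L m where L: "submodule L A M" "\<not> L \<subseteq> m" "covers A M m (carrier M)"
    "\<forall>N. submodule N A M \<and> N \<subset> L \<longrightarrow> N \<subseteq> m" "h L = 3" by blast
  have sm: "submodule m A M" "h m = 3" using L(3) hmax by auto
  have Lmax: "covers A M L (carrier M)" using L(1,5) hmax by simp
  have "L \<noteq> m" using L(2) by blast
  then have "h (L \<inter> m) = 2" by (rule max_int[OF L(1,5) sm])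
  then have "D = L \<inter> m"
    using h_eq[OF D submodule_Int[OF L(1) sm(1)]] Dmax[OF Lmax] Dmax[OF L(3)] hD by simp
  then have "\<forall>N. submodule N A M \<and> N \<subset> L \<longrightarrow> N \<subseteq> D" using L(4) by blast
  then have "nonlocal_frame L D T1 T2"
    unfolding nonlocal_frame_def using L(1,5) D hD Dmax[OF Lmax] T1 T2(1) T12 D_def[symmetric] atoms Dmax by simp
  then show ?thesis by blast
qed

text \<open>The two simple submodules serve as the uniserial ones in the definition of biserial; as
  they meet in zero, \<open>L\<close> has no smallest nonzero submodule.\<close>

lemma nonlocal_frame_astride:
  assumes fr: "nonlocal_frame L D T1 T2"
  shows "largest_proper_submodule A (M\<lparr>carrier := L\<rparr>) D" "astride_biserial A (M\<lparr>carrier := L\<rparr>)"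
proof -
  have L: "submodule L A M" "h L = 3" and D: "submodule D A M" "h D = 2" "D \<subseteq> L"
    and proper: "\<And>N. submodule N A M \<Longrightarrow> N \<subset> L \<Longrightarrow> N \<subseteq> D"
    and T: "covers A M {\<zero>\<^bsub>M\<^esub>} T1" "covers A M {\<zero>\<^bsub>M\<^esub>} T2" "T1 \<inter> T2 = {\<zero>\<^bsub>M\<^esub>}" "T1 <+>\<^bsub>M\<^esub> T2 = D"
    using fr unfolding nonlocal_frame_def by simp_all
  have sT: "submodule T1 A M" "submodule T2 A M" "T1 \<noteq> {\<zero>\<^bsub>M\<^esub>}" "T2 \<noteq> {\<zero>\<^bsub>M\<^esub>}" using T(1,2) by (auto simp: covers_def)
  have TD: "T1 \<subseteq> D" "T2 \<subseteq> D" using set_add_upper[OF sT(1,2)] T(4) by simp_all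
  have z: "{\<zero>\<^bsub>M\<^esub>} \<subseteq> N" if "submodule N A M" for N using submodule_closed(2)[OF that] by simp
  let ?L = "M\<lparr>carrier := L\<rparr>"
  interpret L: finite_length A ?L h by (rule finite_length_submodule[OF L(1)])
  note r = submodule_restrict_iff[OF L(1)]
  have sadd: "X <+>\<^bsub>?L\<^esub> Y = X <+>\<^bsub>M\<^esub> Y" for X Y by (simp add: set_add_def')
  have DL: "D \<noteq> L" using L(2) D(2) by auto
  show large: "largest_proper_submodule A ?L D"
    unfolding largest_proper_submodule_def r using D DL proper by auto
  then have loc: "local_module A ?L" using L.local_module_iff by blast
  have "indecomposable A ?L"
    unfolding indecomposable_def
  proof (intro conjI allI impI)
    show "carrier ?L \<noteq> {\<zero>\<^bsub>?L\<^esub>}" using L(2) h_zero by auto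
    fix N N' assume "internal_direct_sum A ?L N N'"
    then have N: "submodule N A M" "N \<subseteq> L" "submodule N' A M" "N' \<subseteq> L" "N <+>\<^bsub>M\<^esub> N' = L" "N \<inter> N' = {\<zero>\<^bsub>M\<^esub>}"
      by (simp_all add: internal_direct_sum_def r sadd)
    have "N = L \<or> N' = L"
    proof (rule ccontr)
      assume "\<not> (N = L \<or> N' = L)"
      then have "N \<subseteq> D" "N' \<subseteq> D" using proper N by blast+
      then have "L \<subseteq> D" using set_add_least[OF D(1), of N N'] N(5) by simp
      then show False using D(3) DL by blast
    qed
    then show "N = {\<zero>\<^bsub>?L\<^esub>} \<or> N' = {\<zero>\<^bsub>?L\<^esub>}" using N by auto
  qed
  moreover have atom_uni: "uniserial A (?L\<lparr>carrier := T\<rparr>)" if T: "covers A M {\<zero>\<^bsub>M\<^esub>} T" for T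
  proof -
    have sT: "submodule T A M" using T by (simp add: covers_def)
    have sub: "N = {\<zero>\<^bsub>M\<^esub>} \<or> N = T" if "submodule N A M" "N \<subseteq> T" for N
      using T z[OF that(1)] that unfolding covers_def by blast
    have "uniserial A (M\<lparr>carrier := T\<rparr>)"
      unfolding uniserial_def submodule_restrict_iff[OF sT]
    proof (intro allI impI)
      fix N N' assume "(submodule N A M \<and> N \<subseteq> T) \<and> submodule N' A M \<and> N' \<subseteq> T"
      then have N: "submodule N A M" "N \<subseteq> T" "submodule N' A M" "N' \<subseteq> T" by simp_all
      show "N \<subseteq> N' \<or> N' \<subseteq> N" using sub[OF N(1,2)] z[OF N(3)] N(4) by auto
    qed
    then show ?thesis by simp
  qed
  moreover have "\<not> T1 \<subseteq> T2" "\<not> T2 \<subseteq> T1" using T(3) sT by auto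
  ultimately have bis: "biserial_module A ?L"
    unfolding biserial_module_def
    using atom_uni[OF T(1)] atom_uni[OF T(2)] sT TD D(3) T(3,4) large
    by (intro conjI exI[of _ T1] exI[of _ T2]) (simp_all add: r sadd)
  have "\<not> colocal_module A ?L"
  proof
    assume "colocal_module A ?L"
    then obtain S where S: "smallest_nonzero_submodule A ?L S" using L.colocal_module_iff by blast
    then have "S \<subseteq> T1" "S \<subseteq> T2" "S \<noteq> {\<zero>\<^bsub>M\<^esub>}" "submodule S A M"
      using sT TD D(3) unfolding smallest_nonzero_submodule_def r by auto
    then show False using T(3) z[of S] by blast
  qed
  then show "astride_biserial A ?L" using bis loc by (simp add: astride_biserial_def)
qed

text \<open>A homomorphism \<open>f\<close> into a uniserial module that kills exactly one of the two simple summands of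
  the socle has as its kernel the uniserial module of length two that completes \<open>L\<close> to \<open>M\<close>.\<close>

lemma N_shaped_of_hom:
  assumes h4: "h (carrier M) = 4" and ind: "indecomposable A M" and nloc: "\<not> local_module A M"
    and fr: "nonlocal_frame L D T1 T2"
    and E: "left_module A E" "uniserial A E" and f: "f \<in> module_hom A M E"
    and f1: "inj_on f T1" and f2: "\<And>x. x \<in> T2 \<Longrightarrow> f x = \<zero>\<^bsub>E\<^esub>"
  shows "N_shaped A M"
proof -
  have L: "submodule L A M" "h L = 3" and D: "submodule D A M" "h D = 2" "D \<subseteq> L"
    and proper: "\<And>N. submodule N A M \<Longrightarrow> N \<subset> L \<Longrightarrow> N \<subseteq> D"
    and T: "covers A M {\<zero>\<^bsub>M\<^esub>} T1" "covers A M {\<zero>\<^bsub>M\<^esub>} T2" "T1 \<inter> T2 = {\<zero>\<^bsub>M\<^esub>}" "T1 <+>\<^bsub>M\<^esub> T2 = D"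
    and atoms: "\<And>T. covers A M {\<zero>\<^bsub>M\<^esub>} T \<Longrightarrow> T \<subseteq> D" and Dmax: "\<And>m. covers A M m (carrier M) \<Longrightarrow> D \<subseteq> m"
    using fr unfolding nonlocal_frame_def by simp_all
  have sT: "submodule T1 A M" "submodule T2 A M" "T1 \<noteq> {\<zero>\<^bsub>M\<^esub>}" "T2 \<noteq> {\<zero>\<^bsub>M\<^esub>}" using T(1,2) by (auto simp: covers_def)
  have hT: "h T1 = 1" "h T2 = 1" using h_covers[OF T(1)] h_covers[OF T(2)] h_zero by simp_all
  have TD: "T1 \<subseteq> D" "T2 \<subseteq> D" using set_add_upper[OF sT(1,2)] T(4) by simp_all
  have z: "{\<zero>\<^bsub>M\<^esub>} \<subseteq> N" if "submodule N A M" for N using submodule_closed(2)[OF that] by simp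
  have top: "N \<subseteq> carrier M" if "submodule N A M" for N using submodule_closed(1)[OF that] .
  have hmax: "covers A M m (carrier M) \<longleftrightarrow> submodule m A M \<and> h m = 3" for m
    unfolding covers_iff_h using h4 top[of m] by auto
  interpret f: module_morphism A M E f by (rule module_morphismI[OF left_module_axioms E(1) f])
  let ?K = "f.kern"
  have K: "submodule ?K A M" by (rule f.submodule_kern)
  have T2K: "T2 \<subseteq> ?K" using f2 top[OF sT(2)] by (auto simp: f.kern_def)
  have T1K: "T1 \<inter> ?K = {\<zero>\<^bsub>M\<^esub>}"
  proof
    show "T1 \<inter> ?K \<subseteq> {\<zero>\<^bsub>M\<^esub>}"
    proof
      fix x assume "x \<in> T1 \<inter> ?K"
      then have "x \<in> T1" "f x = f \<zero>\<^bsub>M\<^esub>" by (simp_all add: f.kern_def f.hom_zero)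
      then show "x \<in> {\<zero>\<^bsub>M\<^esub>}" using f1 z[OF sT(1)] by (auto dest: inj_onD)
    qed
  qed (use z[OF sT(1)] z[OF K] in blast)
  \<comment> \<open>\<open>D\<close> has height two, and the kernel contains \<open>T2\<close> but
    not \<open>T1\<close>, so it cuts \<open>D\<close> in exactly \<open>T2\<close>.\<close>
  have DK: "D \<inter> ?K = T2"
  proof -
    note s = submodule_Int[OF D(1) K]
    have "D \<inter> ?K \<subset> D" using T1K TD sT(3) by blast
    then have "h (D \<inter> ?K) \<le> h T2" using h_strict[OF s D(1)] D(2) hT by simp
    then show ?thesis using h_eq[OF sT(2) s] T2K TD by simp
  qed
  \<comment> \<open>Submodules above the kernel are determined by their images in the uniserial
    \<open>E\<close>.\<close>
  have chain: "N \<subseteq> N' \<or> N' \<subseteq> N" if N: "submodule N A M" "submodule N' A M" "?K \<subseteq> N" "?K \<subseteq> N'" for N N'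
  proof -
    have "f ` N \<subseteq> f ` N' \<or> f ` N' \<subseteq> f ` N"
      using E(2) f.submodule_image[OF N(1)] f.submodule_image[OF N(2)] unfolding uniserial_def by blast
    moreover have "N = f.pre (f ` N)" "N' = f.pre (f ` N')" using f.pre_image N by auto
    moreover have "f.pre U \<subseteq> f.pre U'" if "U \<subseteq> U'" for U U' using that by (auto simp: f.pre_def)
    ultimately show ?thesis by metis
  qed
  \<comment> \<open>With kernel \<open>T2\<close>, all maximal submodules would lie above the
    kernel, since they contain \<open>D\<close>. Forming a chain, they would coincide, and
    \<open>M\<close> would be local. For the heights three and four, \<open>T1\<close> would lie in
    the kernel.\<close>
  have "h ?K \<noteq> 1"
  proof
    assume "h ?K = 1"
    then have KT: "?K = T2" using h_eq[OF sT(2) K T2K] hT by simp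
    have Lm: "covers A M L (carrier M)" using hmax L by simp
    then have "L \<noteq> carrier M" by (auto simp: covers_def)
    then obtain N where N: "submodule N A M" "N \<noteq> carrier M" "\<not> N \<subseteq> L"
      using nloc local_module_iff L(1) unfolding largest_proper_submodule_def by blast
    then obtain m where m: "N \<subseteq> m" "covers A M m (carrier M)"
      using ex_covered_above[OF N(1) submodule_carrier] top[OF N(1)] by blast
    have sm: "submodule m A M" "h m = 3" using m hmax by auto
    have "?K \<subseteq> m" "?K \<subseteq> L" using KT TD Dmax[OF m(2)] D(3) by auto
    then have "m \<subseteq> L \<or> L \<subseteq> m" using chain[OF sm(1) L(1)] by blast
    then have "m = L" using h_eq[OF sm(1) L(1)] h_eq[OF L(1) sm(1)] sm L by auto
    then show False using N m by blast
  qed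
  moreover have "h ?K \<ge> 1" using h_mono[OF sT(2) K T2K] hT by simp
  moreover have "h ?K \<noteq> 3"
  proof
    assume "h ?K = 3"
    then have "D \<subseteq> ?K" using Dmax hmax K by simp
    then show False using T1K TD sT by blast
  qed
  moreover have "h ?K \<noteq> 4"
  proof
    assume "h ?K = 4"
    then have "?K = carrier M" using h_eq[OF K submodule_carrier top[OF K]] h4 by simp
    then show False using T1K top[OF sT(1)] sT by blast
  qed
  moreover have "h ?K \<le> 4" using h_le[OF K] h4 by simp
  ultimately have hK: "h ?K = 2" by linarith
  \<comment> \<open>A proper submodule of \<open>L\<close> lies in \<open>D\<close>; by its height
    the kernel would equal \<open>D\<close>, although it does not contain \<open>T1\<close>.\<close>
  have KL: "\<not> ?K \<subseteq> L"
  proof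
    assume "?K \<subseteq> L"
    then have "?K \<subset> L" using hK L(2) by auto
    then have "?K \<subseteq> D" by (rule proper[OF K])
    then have "?K = D" using h_eq[OF K D(1)] hK D(2) by simp
    then show False using T1K TD sT by blast
  qed
  note s = submodule_set_add[OF L(1) K] and up = set_add_upper[OF L(1) K]
  have "L \<subset> L <+>\<^bsub>M\<^esub> ?K" using up KL by blast
  then have "h (L <+>\<^bsub>M\<^esub> ?K) = 4" using h_strict[OF L(1) s] L(2) h_le[OF s] h4 by simp
  then have sum: "carrier M = L <+>\<^bsub>M\<^esub> ?K" using h_eq[OF s submodule_carrier top[OF s]] h4 by simp
  have "uniserial A (M\<lparr>carrier := ?K\<rparr>)"
    unfolding uniserial_def submodule_restrict_iff[OF K]
  proof (intro allI impI)
    have sub: "N = {\<zero>\<^bsub>M\<^esub>} \<or> N = T2 \<or> N = ?K" if N: "submodule N A M" "N \<subseteq> ?K" for N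
    proof -
      have "h N \<le> 2" using h_mono[OF N(1) K N(2)] hK by simp
      then consider "h N = 0" | "h N = 1" | "h N = 2" by linarith
      then show ?thesis
      proof cases
        case 1
        then show ?thesis using h_eq_0[OF N(1)] by simp
      next
        case 2
        then have "covers A M {\<zero>\<^bsub>M\<^esub>} N" unfolding covers_iff_h using N(1) z[OF N(1)] h_zero by simp
        then have "N \<subseteq> T2" using atoms N(2) DK by blast
        then show ?thesis using h_eq[OF N(1) sT(2)] 2 hT by simp
      next
        case 3
        then show ?thesis using h_eq[OF N(1) K N(2)] hK by simp
      qed
    qed
    fix N N' assume "(submodule N A M \<and> N \<subseteq> ?K) \<and> submodule N' A M \<and> N' \<subseteq> ?K"
    then have N: "submodule N A M" "N \<subseteq> ?K" "submodule N' A M" "N' \<subseteq> ?K" by simp_all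
    show "N \<subseteq> N' \<or> N' \<subseteq> N"
      using sub[OF N(1,2)] sub[OF N(3,4)] T2K z[OF N(1)] z[OF N(3)] N(2,4) by auto
  qed
  moreover have "has_length A (M\<lparr>carrier := ?K\<rparr>) 2" "has_length A (M\<lparr>carrier := L\<rparr>) 3"
    using has_length_iff_h[OF K] has_length_iff_h[OF L(1)] hK L(2) by simp_all
  ultimately show ?thesis
    unfolding N_shaped_def using ind L(1) K sum nonlocal_frame_astride(2)[OF fr] by blast
qed

text \<open>A sum of two proper submodules is not local, and a smallest nonzero submodule of
  \<open>M\<close> would be one for the summand of length three, which is not colocal. This
  separates the N-shaped case from the other three.\<close>

lemma not_local_colocal_of_N_shaped:
  assumes h4: "h (carrier M) = 4" and N: "N_shaped A M"
  shows "\<not> local_module A M" "\<not> colocal_module A M"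
proof -
  obtain N N' where N: "submodule N A M" "submodule N' A M" "carrier M = N <+>\<^bsub>M\<^esub> N'"
    "astride_biserial A (M\<lparr>carrier := N\<rparr>)" "has_length A (M\<lparr>carrier := N\<rparr>) 3" "has_length A (M\<lparr>carrier := N'\<rparr>) 2"
    using N unfolding N_shaped_def by blast
  have hN: "h N = 3" "h N' = 2" using has_length_iff_h[OF N(1)] has_length_iff_h[OF N(2)] N(5,6) by simp_all
  show "\<not> local_module A M"
  proof
    assume "local_module A M"
    then obtain Q where Q: "largest_proper_submodule A M Q" using local_module_iff by blast
    have "N \<noteq> carrier M" "N' \<noteq> carrier M" using hN h4 by auto
    then have "N \<subseteq> Q" "N' \<subseteq> Q" "submodule Q A M" "Q \<noteq> carrier M" using Q N(1,2) by (auto simp: largest_proper_submodule_def)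
    then show False using set_add_least[of Q N N'] N(3) submodule_closed(1)[of Q] by blast
  qed
  show "\<not> colocal_module A M"
  proof
    assume "colocal_module A M"
    then obtain S where S: "smallest_nonzero_submodule A M S" using colocal_module_iff by blast
    interpret N: finite_length A "M\<lparr>carrier := N\<rparr>" h by (rule finite_length_submodule[OF N(1)])
    have "N \<noteq> {\<zero>\<^bsub>M\<^esub>}" using hN h_zero by auto
    then have "smallest_nonzero_submodule A (M\<lparr>carrier := N\<rparr>) S"
      using S N(1) unfolding smallest_nonzero_submodule_def submodule_restrict_iff[OF N(1)] by simp
    then have "colocal_module A (M\<lparr>carrier := N\<rparr>)" using N.colocal_module_iff by blast
    then show False using N(4) by (simp add: astride_biserial_def)
  qed
qed

lemma local_colocal_of_uniserial:
  assumes nz: "carrier M \<noteq> {\<zero>\<^bsub>M\<^esub>}" and u: "uniserial A M"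
  shows "local_module A M" "colocal_module A M"
proof -
  have chain: "N \<subseteq> N' \<or> N' \<subseteq> N" if "submodule N A M" "submodule N' A M" for N N'
    using u that unfolding uniserial_def by blast
  have lt: "{\<zero>\<^bsub>M\<^esub>} \<subset> carrier M" using nz by auto
  obtain Q where Q: "covers A M Q (carrier M)" using ex_covered_above[OF submodule_zero submodule_carrier lt] by blast
  have sQ: "submodule Q A M" "Q \<noteq> carrier M" using Q by (auto simp: covers_def)
  have "N \<subseteq> Q" if N: "submodule N A M" "N \<noteq> carrier M" for N
    using chain[OF N(1) sQ(1)] Q N submodule_closed(1)[OF N(1)] unfolding covers_def by blast
  then have "largest_proper_submodule A M Q" using sQ by (simp add: largest_proper_submodule_def)
  then show "local_module A M" using local_module_iff by blast
  obtain S where S: "covers A M {\<zero>\<^bsub>M\<^esub>} S" using ex_atom_below[OF submodule_carrier nz] by blast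
  have sS: "submodule S A M" "S \<noteq> {\<zero>\<^bsub>M\<^esub>}" using S by (auto simp: covers_def)
  have "S \<subseteq> N" if N: "submodule N A M" "N \<noteq> {\<zero>\<^bsub>M\<^esub>}" for N
    using chain[OF N(1) sS(1)] S N submodule_closed(2)[OF N(1)] unfolding covers_def by blast
  then have "smallest_nonzero_submodule A M S" using sS by (simp add: smallest_nonzero_submodule_def)
  then show "colocal_module A M" using colocal_module_iff by blast
qed

end

section \<open>Local modules of length three\<close>

text \<open>Condition (b) speaks about the top of the radical of a projective module
  \<open>P\<close>, whereas here a quotient \<open>M\<close> of \<open>P\<close> is given. The point
  is that the kernel of the projection is the radical of the radical of \<open>P\<close>, so that
  this top is isomorphic to \<open>D\<close>. That \<open>P\<close> is biserial is what makes the
  two coincide.\<close>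

lemma (in artin_algebra_module) ex_embedding_into_uniserial_injective:
  assumes quadri: "projectives_quadri A" and bis: "projectives_biserial A"
    and fl: "finite_length A M h" and D: "largest_proper_submodule A M D"
    and T: "covers A M {\<zero>\<^bsub>M\<^esub>} T1" "covers A M {\<zero>\<^bsub>M\<^esub>} T2" "T1 \<inter> T2 = {\<zero>\<^bsub>M\<^esub>}" "T1 <+>\<^bsub>M\<^esub> T2 = D"
  shows "\<exists>T\<in>{T1, T2}. \<exists>(E :: 'a fg_object) \<phi>. injective A E \<and> uniserial A E \<and>
    \<phi> \<in> module_hom A (M\<lparr>carrier := T\<rparr>) E \<and> inj_on \<phi> T"
proof -
  interpret M: finite_length A M h by (rule fl)
  have sT: "submodule T1 A M" "submodule T2 A M" "T1 \<noteq> {\<zero>\<^bsub>M\<^esub>}" "T2 \<noteq> {\<zero>\<^bsub>M\<^esub>}" using T(1,2) by (auto simp: covers_def)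
  have hT: "h T1 = 1" "h T2 = 1" using M.h_covers[OF T(1)] M.h_covers[OF T(2)] M.h_zero by simp_all
  have sD: "submodule D A M" "D \<noteq> carrier M" and Dmax: "\<And>N. submodule N A M \<Longrightarrow> N \<noteq> carrier M \<Longrightarrow> N \<subseteq> D"
    using D by (simp_all add: largest_proper_submodule_def)
  have TD: "T1 \<subseteq> D" "T2 \<subseteq> D" using set_add_upper[OF sT(1,2)] T(4) by simp_all
  have z: "{\<zero>\<^bsub>M\<^esub>} \<subseteq> N" if "submodule N A M" for N using submodule_closed(2)[OF that] by simp
  have inc: "\<not> T1 \<subseteq> T2" "\<not> T2 \<subseteq> T1" using T(3) sT by auto
  have hD: "h D = 2" using M.h_modular[OF sT(1,2)] T(3,4) hT M.h_zero by simp
  have cD: "covers A M T1 D" "covers A M T2 D" unfolding M.covers_iff_h using sT sD TD hT hD by simp_all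
  obtain P :: "'a fg_object" and \<pi> where P: "projective A P" "indecomposable A P" "\<pi> \<in> module_hom A P M"
    and surj: "\<pi> ` carrier P = carrier M" using ex_projective_onto_local[OF D] by blast
  interpret P: lmod A P using P(1) by (simp add: lmod_def projective_def fg_module_def)
  interpret \<pi>: module_morphism A P M \<pi>
    by (intro module_morphismI P.left_module_axioms left_module_axioms P(3))
  have qc: "quadri_condition A P" using quadri P(1,2) by (simp add: projectives_quadri_def)
  then obtain n where n: "has_length A P n" unfolding quadri_condition_def Let_def by blast
  obtain hP where hP: "finite_length A P hP" using P.ex_finite_length[OF n] by blast
  interpret P: finite_length A P hP by (rule hP)
  let ?k = "\<pi>.kern" and ?X1 = "\<pi>.pre T1" and ?X2 = "\<pi>.pre T2"
  note pre = \<pi>.submodule_pre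
  have im: "\<pi> ` \<pi>.pre Y = Y" if "submodule Y A M" for Y
    by (rule \<pi>.image_pre) (use surj submodule_closed(1)[OF that] in simp)
  \<comment> \<open>The parts of a uniserial \<open>N\<close> that lie over \<open>T1\<close> and
    over \<open>T2\<close> are comparable, while \<open>T1\<close> and \<open>T2\<close> are
    not.\<close>
  have not_both: "\<not> (T1 \<subseteq> \<pi> ` N \<and> T2 \<subseteq> \<pi> ` N)"
    if N: "submodule N A P" and u: "uniserial A (P\<lparr>carrier := N\<rparr>)" for N
  proof
    assume *: "T1 \<subseteq> \<pi> ` N \<and> T2 \<subseteq> \<pi> ` N"
    have cN: "N \<subseteq> carrier P" by (rule P.submodule_closed(1)[OF N])
    have eq: "\<pi> ` (\<pi>.pre T \<inter> N) = T" if "T \<subseteq> \<pi> ` N" for T using that cN by (auto simp: \<pi>.pre_def)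
    have "?X1 \<inter> N \<subseteq> ?X2 \<inter> N \<or> ?X2 \<inter> N \<subseteq> ?X1 \<inter> N"
      using u P.submodule_Int[OF pre[OF sT(1)] N] P.submodule_Int[OF pre[OF sT(2)] N]
      unfolding uniserial_def P.submodule_restrict_iff[OF N] by blast
    then have "\<pi> ` (?X1 \<inter> N) \<subseteq> \<pi> ` (?X2 \<inter> N) \<or> \<pi> ` (?X2 \<inter> N) \<subseteq> \<pi> ` (?X1 \<inter> N)" by (elim disj_forward image_mono)
    then show False using eq[of T1] eq[of T2] * inc by simp
  qed
  have "\<not> uniserial A P"
    using not_both[OF P.submodule_carrier] surj submodule_closed(1)[OF sT(1)] submodule_closed(1)[OF sT(2)] by auto
  then have "biserial_module A P" using bis P(1,2) unfolding projectives_biserial_def by blast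
  then obtain V V' where V: "submodule V A P" "submodule V' A P"
    and uV: "uniserial A (P\<lparr>carrier := V\<rparr>)" "uniserial A (P\<lparr>carrier := V'\<rparr>)"
    and sum: "V <+>\<^bsub>P\<^esub> V' = carrier P \<or> largest_proper_submodule A P (V <+>\<^bsub>P\<^esub> V')"
    unfolding biserial_module_def by blast
  define Q where "Q = V <+>\<^bsub>P\<^esub> V'"
  have sQ: "submodule Q A P" unfolding Q_def by (rule P.submodule_set_add[OF V])
  have VQ: "V \<subseteq> Q" "V' \<subseteq> Q" unfolding Q_def by (rule P.set_add_upper[OF V])+
  have imD: "\<pi> ` N \<subseteq> D" if N: "submodule N A P" and u: "uniserial A (P\<lparr>carrier := N\<rparr>)" for N
  proof (rule Dmax[OF \<pi>.submodule_image[OF N]])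
    show "\<pi> ` N \<noteq> carrier M"
      using not_both[OF N u] submodule_closed(1)[OF sT(1)] submodule_closed(1)[OF sT(2)] by auto
  qed
  have imQ: "\<pi> ` Q = \<pi> ` V <+>\<^bsub>M\<^esub> \<pi> ` V'"
    unfolding Q_def by (rule \<pi>.image_set_add) (rule P.submodule_closed(1)[OF V(1)] P.submodule_closed(1)[OF V(2)])+
  have imQD: "\<pi> ` Q \<subseteq> D" unfolding imQ using imD[OF V(1) uV(1)] imD[OF V(2) uV(2)] by (rule set_add_least[OF sD(1)])
  have "Q \<noteq> carrier P"
  proof
    assume "Q = carrier P"
    then show False using imQD surj sD(2) submodule_closed(1)[OF sD(1)] by auto
  qed
  then have large: "largest_proper_submodule A P Q" using sum by (simp add: Q_def)
  have QD: "Q = \<pi>.pre D"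
  proof
    have "\<pi>.pre D \<noteq> carrier P" using im[OF sD(1)] surj sD(2) by auto
    then show "\<pi>.pre D \<subseteq> Q" using large pre[OF sD(1)] by (simp add: largest_proper_submodule_def)
    show "Q \<subseteq> \<pi>.pre D" using imQD P.submodule_closed(1)[OF sQ] by (auto simp: \<pi>.pre_def)
  qed
  have radP: "rad A P = Q" by (rule P.rad_eq_largest(1)[OF large])
  let ?Q = "P\<lparr>carrier := Q\<rparr>"
  interpret Q: finite_length A ?Q hP by (rule P.finite_length_submodule[OF sQ])
  have sX: "submodule ?X1 A P" "submodule ?X2 A P" using pre sT by simp_all
  have cX: "covers A P ?X1 Q" "covers A P ?X2 Q" "covers A P ?k ?X1" "covers A P ?k ?X2"
    unfolding QD \<pi>.kern_eq using \<pi>.covers_pre[OF surj] cD T sT sD(1) by simp_all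
  have X12: "?X1 \<inter> ?X2 = ?k" using T(3) by (auto simp: \<pi>.kern_eq \<pi>.pre_def)
  \<comment> \<open>The images of \<open>V\<close> and \<open>V'\<close> span \<open>D\<close>, of
    height two, and neither is all of \<open>D\<close>; so both have height one and they meet in
    zero.\<close>
  have hV: "h (\<pi> ` V) = 1 \<and> h (\<pi> ` V') = 1 \<and> \<pi> ` V \<inter> \<pi> ` V' = {\<zero>\<^bsub>M\<^esub>}"
  proof -
    note s = \<pi>.submodule_image[OF V(1)] \<pi>.submodule_image[OF V(2)]
    have le: "h (\<pi> ` N) \<le> 1" if N: "submodule N A P" and u: "uniserial A (P\<lparr>carrier := N\<rparr>)" for N
    proof -
      have "\<pi> ` N \<noteq> D" using not_both[OF N u] TD by blast
      then have "h (\<pi> ` N) < h D" using M.h_strict[OF \<pi>.submodule_image[OF N] sD(1)] imD[OF N u] by blast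
      then show ?thesis using hD by simp
    qed
    have "\<pi> ` Q = D" using im[OF sD(1)] QD by simp
    then have "h (\<pi> ` V <+>\<^bsub>M\<^esub> \<pi> ` V') = 2" using imQ hD by simp
    moreover note M.h_modular[OF s] le[OF V(1) uV(1)] le[OF V(2) uV(2)]
    ultimately have "h (\<pi> ` V) = 1 \<and> h (\<pi> ` V') = 1 \<and> h (\<pi> ` V \<inter> \<pi> ` V') = 0" by linarith
    then show ?thesis using M.h_eq_0[OF submodule_Int[OF s]] by simp
  qed
  have radQ: "rad A ?Q = ?k"
  proof
    show "rad A ?Q \<subseteq> ?k"
      unfolding rad_def Q.maximal_submodule_iff P.covers_restrict[OF sQ] using cX(1,2) X12 by auto
    \<comment> \<open>If \<open>N\<close> is not inside \<open>Y\<close>, then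
      \<open>Y \<inter> N\<close> has height one less than \<open>N\<close>, and
      \<open>?k \<inter> N\<close> is proper in \<open>N\<close>. In the uniserial \<open>N\<close>
      the two are comparable, so the kernel part lies in \<open>Y\<close>.\<close>
    have kern_le: "?k \<inter> N \<subseteq> Y"
      if Y: "covers A P Y Q" and N: "submodule N A P" "N \<subseteq> Q" "h (\<pi> ` N) = 1" and u: "uniserial A (P\<lparr>carrier := N\<rparr>)" for Y N
    proof (cases "N \<subseteq> Y")
      case False
      have sY: "submodule Y A P" "Y \<subseteq> Q" "hP Q = Suc (hP Y)" using Y unfolding P.covers_iff_h by auto
      note sI = P.submodule_Int[OF sY(1) N(1)] and skN = P.submodule_Int[OF \<pi>.submodule_kern N(1)]
      note sJ = P.submodule_set_add[OF sY(1) N(1)] and up = P.set_add_upper[OF sY(1) N(1)]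
      have "Y <+>\<^bsub>P\<^esub> N \<subseteq> Q" using sY(2) N(2) by (rule P.set_add_least[OF sQ])
      moreover have "Y <+>\<^bsub>P\<^esub> N \<noteq> Y" using up False by auto
      ultimately have "Y <+>\<^bsub>P\<^esub> N = Q" using Y sJ up unfolding covers_def by blast
      then have hN: "hP N = Suc (hP (Y \<inter> N))" using P.h_modular[OF sY(1) N(1)] sY(3) by simp
      have "?k \<inter> N \<noteq> N"
      proof
        assume "?k \<inter> N = N"
        then have "\<pi> ` N \<subseteq> {\<zero>\<^bsub>M\<^esub>}" by (auto simp: \<pi>.kern_def)
        then have "h (\<pi> ` N) \<le> 0" using M.h_mono[OF \<pi>.submodule_image[OF N(1)] submodule_zero] M.h_zero by simp
        then show False using N(3) by simp
      qed
      then have k: "hP (?k \<inter> N) < hP N" using P.h_strict[OF skN N(1)] by blast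
      have "?k \<inter> N \<subseteq> Y \<inter> N \<or> Y \<inter> N \<subseteq> ?k \<inter> N"
        using u sI skN unfolding uniserial_def P.submodule_restrict_iff[OF N(1)] by blast
      then show ?thesis
      proof
        assume "Y \<inter> N \<subseteq> ?k \<inter> N"
        then have "Y \<inter> N = ?k \<inter> N" using P.h_eq[OF sI skN] k hN by simp
        then show ?thesis by blast
      qed blast
    qed blast
    \<comment> \<open>For an element \<open>v + w\<close> of the kernel, \<open>\<pi> v\<close> is
      the negative of \<open>\<pi> w\<close> and lies in both images, which meet in zero; so
      \<open>v\<close> and \<open>w\<close> are in the kernel separately.\<close>
    have "?k \<subseteq> Y" if Y: "covers A P Y Q" for Y
    proof
      fix x assume x: "x \<in> ?k"
      have "?k \<subseteq> Q" using cX(1,3) unfolding covers_def by blast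
      then have "x \<in> V <+>\<^bsub>P\<^esub> V'" using x Q_def by blast
      then obtain v w where vw: "v \<in> V" "w \<in> V'" "x = v \<oplus>\<^bsub>P\<^esub> w" by (auto simp: P.mem_set_add)
      have c: "v \<in> carrier P" "w \<in> carrier P" using vw P.submodule_closed(1) V by auto
      have "\<pi> v \<oplus>\<^bsub>M\<^esub> \<pi> w = \<zero>\<^bsub>M\<^esub>" using x vw c by (simp add: \<pi>.kern_def \<pi>.hom_add)
      then have "\<pi> v = \<zero>\<^bsub>M\<^esub> \<ominus>\<^bsub>M\<^esub> \<pi> w" using c add_diff_cancel[of "\<pi> v" "\<pi> w"] by simp
      moreover have "\<zero>\<^bsub>M\<^esub> \<ominus>\<^bsub>M\<^esub> \<pi> w \<in> \<pi> ` V'"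
        using vw(2) submodule_closed(2)[OF \<pi>.submodule_image[OF V(2)]]
        by (intro submodule_minus[OF \<pi>.submodule_image[OF V(2)]]) auto
      ultimately have "\<pi> v \<in> \<pi> ` V'" by simp
      then have "\<pi> v \<in> \<pi> ` V \<inter> \<pi> ` V'" using imageI[OF vw(1)] by blast
      then have v0: "\<pi> v = \<zero>\<^bsub>M\<^esub>" using hV by blast
      then have "\<pi> w = \<zero>\<^bsub>M\<^esub>" using \<open>\<pi> v \<oplus>\<^bsub>M\<^esub> \<pi> w = \<zero>\<^bsub>M\<^esub>\<close> c by simp
      then have "v \<in> ?k \<inter> V" "w \<in> ?k \<inter> V'" using v0 vw c by (simp_all add: \<pi>.kern_def)
      then have "v \<in> Y" "w \<in> Y" using kern_le[OF Y V(1) VQ(1) _ uV(1)] kern_le[OF Y V(2) VQ(2) _ uV(2)] hV by auto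
      moreover have "submodule Y A P" using Y by (simp add: covers_def)
      ultimately show "x \<in> Y" using P.submodule_closed(3)[of Y v w] vw(3) by simp
    qed
    moreover have "?k \<subseteq> Q" using cX(1,3) unfolding covers_def by blast
    ultimately show "?k \<subseteq> rad A ?Q"
      unfolding rad_def Q.maximal_submodule_iff P.covers_restrict[OF sQ] by auto
  qed
  have skQ: "submodule ?k A ?Q" unfolding P.submodule_restrict_iff[OF sQ]
    using \<pi>.submodule_kern cX(1,3) unfolding covers_def by blast
  interpret q: quotient_projection A ?Q ?k
    by (simp add: quotient_projection_def quotient_projection_axioms_def skQ Q.left_module_axioms)
  let ?T = "quot_module ?Q ?k" and ?q = "q.q"
  interpret T: lmod A ?T by (simp add: lmod_def q.q.N.left_module_axioms)
  have topQ: "top_module A ?Q = ?T" by (simp add: top_module_def radQ)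
  have sXQ: "submodule ?X1 A ?Q" "submodule ?X2 A ?Q"
    unfolding P.submodule_restrict_iff[OF sQ] using cX(1,2) sX unfolding covers_def by blast+
  have kX: "?k \<subseteq> ?X1" "?k \<subseteq> ?X2" using cX(3,4) unfolding covers_def by blast+
  have simple: "simple_module A (?T\<lparr>carrier := ?q ` X\<rparr>)" if X: "submodule X A ?Q" "covers A P ?k X" for X
  proof -
    have sub: "submodule (?q ` X) A ?T" by (rule q.q.submodule_image[OF X(1)])
    have "q.q.pre {\<zero>\<^bsub>?T\<^esub>} = ?k" using q.q.kern_eq q.q_kern by simp
    moreover have "q.q.pre (?q ` X) = X"
      using q.q.pre_image[OF X(1)] q.q_kern X(2) by (simp add: covers_def psubset_eq)
    moreover have "covers A ?Q ?k X"
      using X P.covers_restrict[OF sQ] P.submodule_restrict_iff[OF sQ] by simp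
    ultimately have "covers A ?T {\<zero>\<^bsub>?T\<^esub>} (?q ` X)"
      using q.q.covers_pre[OF q.q_surj q.q.N.submodule_zero sub] by simp
    then show ?thesis using T.simple_submodule_iff[OF sub] by simp
  qed
  have "internal_direct_sum A ?T (?q ` ?X1) (?q ` ?X2)"
    unfolding internal_direct_sum_def
  proof (intro conjI q.q.submodule_image sXQ)
    have c: "?X1 \<subseteq> carrier ?Q" "?X2 \<subseteq> carrier ?Q" using Q.submodule_closed(1) sXQ by blast+
    note up = Q.set_add_upper[OF sXQ]
    have "?X1 <+>\<^bsub>?Q\<^esub> ?X2 \<subseteq> Q" using Q.submodule_closed(1)[OF Q.submodule_set_add[OF sXQ]] by simp
    moreover have "\<not> ?X2 \<subseteq> ?X1" using im[OF sT(1)] im[OF sT(2)] inc(2) by (metis image_mono)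
    then have "?X1 <+>\<^bsub>?Q\<^esub> ?X2 \<noteq> ?X1" using up by auto
    ultimately have "?X1 <+>\<^bsub>?Q\<^esub> ?X2 = Q"
      using cX(1) up(1) Q.submodule_set_add[OF sXQ] P.submodule_restrict_iff[OF sQ] unfolding covers_def by blast
    then show "?q ` ?X1 <+>\<^bsub>?T\<^esub> ?q ` ?X2 = carrier ?T"
      using q.q.image_set_add[OF c] q.q_surj by simp
    have "?q ` ?X1 \<inter> ?q ` ?X2 = ?q ` ?k" using q.q.image_Int[OF sXQ] q.q_kern kX X12 by simp
    also have "\<dots> = {\<zero>\<^bsub>?T\<^esub>}"
    proof -
      have "?q x = \<zero>\<^bsub>?T\<^esub>" if "x \<in> ?k" for x using that q.q_kern by (auto simp: q.q.kern_def)
      then show ?thesis using P.submodule_closed(2)[OF \<pi>.submodule_kern] by auto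
    qed
    finally show "?q ` ?X1 \<inter> ?q ` ?X2 = {\<zero>\<^bsub>?T\<^esub>}" .
  qed
  \<comment> \<open>Condition (b), applied to the decomposition of the top of the radical induced by
    \<open>T1\<close> and \<open>T2\<close>.\<close>
  then have "uniserial_envelope A (?T\<lparr>carrier := ?q ` ?X1\<rparr>) \<or> uniserial_envelope A (?T\<lparr>carrier := ?q ` ?X2\<rparr>)"
    using qc simple[OF sXQ(1) cX(3)] simple[OF sXQ(2) cX(4)]
    unfolding quadri_condition_def Let_def radP topQ by blast
  moreover have "\<exists>(E :: 'a fg_object) \<phi>. injective A E \<and> uniserial A E \<and>
      \<phi> \<in> module_hom A (M\<lparr>carrier := T\<rparr>) E \<and> inj_on \<phi> T"
    if sT: "submodule T A M" and sXQ: "submodule (\<pi>.pre T) A ?Q"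
      and env: "uniserial_envelope A (?T\<lparr>carrier := ?q ` \<pi>.pre T\<rparr>)" for T
  proof -
    let ?X = "\<pi>.pre T"
    obtain E :: "'a fg_object" and i where E: "injective A E" "uniserial A E"
      "i \<in> module_hom A (?T\<lparr>carrier := ?q ` ?X\<rparr>) E" "inj_on i (?q ` ?X)"
      using env unfolding uniserial_envelope_def injective_envelope_def by auto
    have sX: "submodule ?X A P" by (rule pre[OF sT])
    have XQ: "x \<in> Q" if "x \<in> ?X" for x using Q.submodule_closed(1)[OF sXQ] that by auto
    have XP: "x \<in> carrier P" if "x \<in> ?X" for x using that by (simp add: \<pi>.pre_def)
    have q_add: "?q (x \<oplus>\<^bsub>P\<^esub> y) = ?q x \<oplus>\<^bsub>?T\<^esub> ?q y" if "x \<in> Q" "y \<in> Q" for x y using q.q.hom_add[of x y] that by simp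
    have q_smult: "?q (a \<odot>\<^bsub>P\<^esub> x) = a \<odot>\<^bsub>?T\<^esub> ?q x" if "a \<in> carrier A" "x \<in> Q" for a x using q.q.hom_smult[of a x] that by simp
    \<comment> \<open>On the preimage of \<open>T\<close>, the maps \<open>?q\<close> and
      \<open>\<pi>\<close> have the same fibres, so the embedding of the simple part of the top can
      be moved to \<open>T\<close>.\<close>
    have q_eq: "?q x = ?q y \<longleftrightarrow> \<pi> x = \<pi> y" if "x \<in> ?X" "y \<in> ?X" for x y
    proof -
      have "?q x = ?q y \<longleftrightarrow> x \<ominus>\<^bsub>?Q\<^esub> y \<in> ?k" using q.q_eq_iff[of x y] XQ that by simp
      also have "\<dots> \<longleftrightarrow> x \<ominus>\<^bsub>P\<^esub> y \<in> ?k"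
      proof -
        have "x \<ominus>\<^bsub>?Q\<^esub> y = x \<ominus>\<^bsub>P\<^esub> y"
        proof -
          have xy: "x \<ominus>\<^bsub>?Q\<^esub> y \<in> Q" "(x \<ominus>\<^bsub>?Q\<^esub> y) \<oplus>\<^bsub>P\<^esub> y = x"
            using Q.minus_add_cancel[of x y] Q.M.minus_closed[of x y] XQ that by simp_all
          then have "x \<ominus>\<^bsub>?Q\<^esub> y \<in> carrier P" using P.submodule_closed(1)[OF sQ] by auto
          then show ?thesis using P.add_diff_cancel[of "x \<ominus>\<^bsub>?Q\<^esub> y" y] xy(2) XP[OF that(2)] by simp
        qed
        then show ?thesis by simp
      qed
      also have "\<dots> \<longleftrightarrow> \<pi> x = \<pi> y"
        using XP that by (simp add: \<pi>.kern_def \<pi>.hom_minus minus_eq_zero_iff)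
      finally show ?thesis .
    qed
    have lX: "left_module A (P\<lparr>carrier := ?X\<rparr>)" by (rule P.left_module_submodule[OF sX])
    have \<pi>h: "\<pi> \<in> module_hom A (P\<lparr>carrier := ?X\<rparr>) (M\<lparr>carrier := T\<rparr>)"
      by (rule module_homI) (simp_all add: \<pi>.hom_add \<pi>.hom_smult \<pi>.pre_def)
    have \<psi>h: "(\<lambda>x. i (?q x)) \<in> module_hom A (P\<lparr>carrier := ?X\<rparr>) E"
    proof (rule module_homI)
      have ih: "\<And>u. u \<in> ?q ` ?X \<Longrightarrow> i u \<in> carrier E"
        "\<And>u v. u \<in> ?q ` ?X \<Longrightarrow> v \<in> ?q ` ?X \<Longrightarrow> i (u \<oplus>\<^bsub>?T\<^esub> v) = i u \<oplus>\<^bsub>E\<^esub> i v"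
        "\<And>a u. a \<in> carrier A \<Longrightarrow> u \<in> ?q ` ?X \<Longrightarrow> i (a \<odot>\<^bsub>?T\<^esub> u) = a \<odot>\<^bsub>E\<^esub> i u"
        using E(3) by (auto simp: module_hom_def)
      show "\<And>x. x \<in> carrier (P\<lparr>carrier := ?X\<rparr>) \<Longrightarrow> i (?q x) \<in> carrier E" using ih(1) by simp
      show "\<And>x y. x \<in> carrier (P\<lparr>carrier := ?X\<rparr>) \<Longrightarrow> y \<in> carrier (P\<lparr>carrier := ?X\<rparr>) \<Longrightarrow>
          i (?q (x \<oplus>\<^bsub>P\<lparr>carrier := ?X\<rparr>\<^esub> y)) = i (?q x) \<oplus>\<^bsub>E\<^esub> i (?q y)"
        using ih(2) q_add XQ by simp
      show "\<And>a x. a \<in> carrier A \<Longrightarrow> x \<in> carrier (P\<lparr>carrier := ?X\<rparr>) \<Longrightarrow>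
          i (?q (a \<odot>\<^bsub>P\<lparr>carrier := ?X\<rparr>\<^esub> x)) = a \<odot>\<^bsub>E\<^esub> i (?q x)"
        using ih(3) q_smult XQ by simp
    qed
    have "\<exists>\<phi>\<in>module_hom A (M\<lparr>carrier := T\<rparr>) E. \<forall>x\<in>carrier (P\<lparr>carrier := ?X\<rparr>). \<phi> (\<pi> x) = i (?q x)"
    proof (rule ex_factor_hom[OF lX \<pi>h _ \<psi>h])
      show "\<pi> ` carrier (P\<lparr>carrier := ?X\<rparr>) = carrier (M\<lparr>carrier := T\<rparr>)" using im[OF sT] by simp
      fix x y assume "x \<in> carrier (P\<lparr>carrier := ?X\<rparr>)" "y \<in> carrier (P\<lparr>carrier := ?X\<rparr>)" "\<pi> x = \<pi> y"
      then have "?q x = ?q y" using q_eq[of x y] by simp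
      then show "i (?q x) = i (?q y)" by simp
    qed
    then obtain \<phi> where \<phi>: "\<phi> \<in> module_hom A (M\<lparr>carrier := T\<rparr>) E" "\<And>x. x \<in> ?X \<Longrightarrow> \<phi> (\<pi> x) = i (?q x)"
      by auto
    have "inj_on \<phi> T"
    proof (rule inj_onI)
      fix s t assume "s \<in> T" "t \<in> T" and eq: "\<phi> s = \<phi> t"
      then have "s \<in> \<pi> ` ?X" "t \<in> \<pi> ` ?X" using im[OF sT] by simp_all
      then obtain x y where xy: "x \<in> ?X" "y \<in> ?X" "s = \<pi> x" "t = \<pi> y" by blast
      then have "i (?q x) = i (?q y)" using eq \<phi>(2) by simp
      then have "?q x = ?q y" using inj_onD[OF E(4)] xy by blast
      then show "s = t" using q_eq xy by simp
    qed
    then show ?thesis using E(1,2) \<phi>(1) by blast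
  qed
  ultimately show ?thesis using sT(1,2) sXQ by blast
qed

section \<open>The classification\<close>

text \<open>Bridges the gap of types to the definition of \<open>injective\<close>: \<open>M\<close>
  and \<open>D\<close> are replaced by copies among the test objects, and both the inclusion and
  \<open>\<phi>\<close> are moved to the copies.\<close>

lemma injective_extends:
  fixes M :: "('a, 'm) module" and E :: "('a, 'n) module"
  assumes E: "injective A E" and M: "fg_module A M" and D: "submodule D A M" "fg_module A (M\<lparr>carrier := D\<rparr>)"
    and \<phi>: "\<phi> \<in> module_hom A (M\<lparr>carrier := D\<rparr>) E"
  shows "\<exists>f\<in>module_hom A M E. \<forall>x\<in>D. f x = \<phi> x"
proof -
  interpret left_module A M using M by (simp add: fg_module_def)
  have lD: "left_module A (M\<lparr>carrier := D\<rparr>)" using D(2) by (simp add: fg_module_def)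
  have DM: "D \<subseteq> carrier M" by (rule submodule_closed(1)[OF D(1)])
  obtain M' :: "'a fg_object" and \<alpha> where M': "fg_module A M'" "\<alpha> \<in> module_iso A M M'"
    using ex_isomorphic_fg_object[OF M] by blast
  obtain D' :: "'a fg_object" and \<delta> where D': "fg_module A D'" "\<delta> \<in> module_iso A (M\<lparr>carrier := D\<rparr>) D'"
    using ex_isomorphic_fg_object[OF D(2)] by blast
  have \<alpha>: "\<alpha> \<in> module_hom A M M'" "inj_on \<alpha> (carrier M)"
    using M'(2) by (simp_all add: module_iso_def bij_betw_def)
  have \<delta>: "\<delta> \<in> module_hom A (M\<lparr>carrier := D\<rparr>) D'" "inj_on \<delta> D" "\<delta> ` D = carrier D'"
    using D'(2) by (simp_all add: module_iso_def bij_betw_def)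
  have \<alpha>D: "\<alpha> \<in> module_hom A (M\<lparr>carrier := D\<rparr>) M'"
    by (rule module_homI) (use \<alpha>(1) DM in \<open>auto simp: module_hom_def subset_iff\<close>)
  have \<delta>_eq: "x = y" if "x \<in> D" "y \<in> D" "\<delta> x = \<delta> y" for x y by (rule inj_onD[OF \<delta>(2) that(3,1,2)])
  have "\<exists>i\<in>module_hom A D' M'. \<forall>x\<in>carrier (M\<lparr>carrier := D\<rparr>). i (\<delta> x) = \<alpha> x"
  proof (rule ex_factor_hom[OF lD \<delta>(1) _ \<alpha>D])
    show "\<delta> ` carrier (M\<lparr>carrier := D\<rparr>) = carrier D'" using \<delta>(3) by simp
    fix x y assume "x \<in> carrier (M\<lparr>carrier := D\<rparr>)" "y \<in> carrier (M\<lparr>carrier := D\<rparr>)" "\<delta> x = \<delta> y"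
    then have "x = y" using \<delta>_eq[of x y] by simp
    then show "\<alpha> x = \<alpha> y" by simp
  qed
  then obtain i where i: "i \<in> module_hom A D' M'" "\<And>x. x \<in> D \<Longrightarrow> i (\<delta> x) = \<alpha> x" by auto
  have "\<exists>\<phi>'\<in>module_hom A D' E. \<forall>x\<in>carrier (M\<lparr>carrier := D\<rparr>). \<phi>' (\<delta> x) = \<phi> x"
  proof (rule ex_factor_hom[OF lD \<delta>(1) _ \<phi>])
    show "\<delta> ` carrier (M\<lparr>carrier := D\<rparr>) = carrier D'" using \<delta>(3) by simp
    fix x y assume "x \<in> carrier (M\<lparr>carrier := D\<rparr>)" "y \<in> carrier (M\<lparr>carrier := D\<rparr>)" "\<delta> x = \<delta> y"
    then have "x = y" using \<delta>_eq[of x y] by simp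
    then show "\<phi> x = \<phi> y" by simp
  qed
  then obtain \<phi>' where \<phi>': "\<phi>' \<in> module_hom A D' E" "\<And>x. x \<in> D \<Longrightarrow> \<phi>' (\<delta> x) = \<phi> x" by auto
  have "inj_on i (carrier D')"
  proof (rule inj_onI)
    fix u v assume "u \<in> carrier D'" "v \<in> carrier D'" and eq: "i u = i v"
    then have "u \<in> \<delta> ` D" "v \<in> \<delta> ` D" using \<delta>(3) by simp_all
    then obtain x y where xy: "x \<in> D" "y \<in> D" "u = \<delta> x" "v = \<delta> y" by blast
    then have "\<alpha> x = \<alpha> y" using eq i(2) by simp
    then have "x = y" using inj_onD[OF \<alpha>(2)] xy(1,2) DM by blast
    then show "u = v" using xy by simp
  qed
  then have "fg_module A D' \<and> fg_module A M' \<and> inj_on i (carrier D')" using D'(1) M'(1) by simp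
  from E[unfolded injective_def, THEN conjunct2, rule_format, OF i(1) \<phi>'(1) this]
  obtain g where g: "g \<in> module_hom A M' E" "\<forall>u\<in>carrier D'. g (i u) = \<phi>' u" by blast
  have "g (\<alpha> x) = \<phi> x" if "x \<in> D" for x
  proof -
    have "\<delta> x \<in> carrier D'" using \<delta>(3) that by blast
    then show ?thesis using bspec[OF g(2), of "\<delta> x"] i(2)[OF that] \<phi>'(2)[OF that] by simp
  qed
  then show ?thesis using module_hom_comp[OF \<alpha>(1) g(1)] by (intro bexI[of _ "\<lambda>x. g (\<alpha> x)"] ballI)
qed

text \<open>Induction on the height: generators of a submodule covered by \<open>N\<close> and one
  further element generate \<open>N\<close>. It makes \<open>D\<close> an object of
  \<open>mod A\<close>, as the extension of maps from \<open>D\<close> demands.\<close>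

lemma (in finite_length) finitely_generated_submodule:
  assumes "submodule N A M" shows "finitely_generated A (M\<lparr>carrier := N\<rparr>)"
proof -
  have "\<exists>X. finite X \<and> X \<subseteq> N \<and> (\<forall>U. submodule U A M \<and> X \<subseteq> U \<longrightarrow> N \<subseteq> U)"
    using assms
  proof (induction "h N" arbitrary: N rule: less_induct)
    case less
    show ?case
    proof (cases "N = {\<zero>\<^bsub>M\<^esub>}")
      case True
      then show ?thesis using submodule_closed(2) by (intro exI[of _ "{}"]) auto
    next
      case False
      then have "{\<zero>\<^bsub>M\<^esub>} \<subset> N" using submodule_closed(2)[OF less.prems] by auto
      then obtain Z where Z: "covers A M Z N" using ex_covered_above[OF submodule_zero less.prems] by blast
      then have sZ: "submodule Z A M" "Z \<subset> N" by (auto simp: covers_def)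
      have "h Z < h N" using h_covers[OF Z] by simp
      then obtain X where X: "finite X" "X \<subseteq> Z" "\<And>U. submodule U A M \<Longrightarrow> X \<subseteq> U \<Longrightarrow> Z \<subseteq> U"
        using less.hyps sZ(1) by metis
      obtain x where x: "x \<in> N" "x \<notin> Z" using sZ by blast
      have "N \<subseteq> U" if U: "submodule U A M" "insert x X \<subseteq> U" for U
      proof -
        have "Z \<subseteq> N \<inter> U" using X(3)[OF U(1)] U(2) sZ by blast
        moreover have "N \<inter> U \<noteq> Z" using x U(2) by blast
        ultimately have "N \<inter> U = N" using Z submodule_Int[OF less.prems U(1)] unfolding covers_def by blast
        then show ?thesis by blast
      qed
      then show ?thesis using X(1,2) x sZ by (intro exI[of _ "insert x X"]) auto
    qed
  qed
  then obtain X where X: "finite X" "X \<subseteq> N" "\<forall>U. submodule U A M \<and> X \<subseteq> U \<longrightarrow> N \<subseteq> U"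
    by (elim exE conjE)
  have "submodule_span A (M\<lparr>carrier := N\<rparr>) X = N"
  proof
    show "submodule_span A (M\<lparr>carrier := N\<rparr>) X \<subseteq> N"
      unfolding submodule_span_def by (rule Inter_lower) (use X(2) assms in \<open>simp add: submodule_restrict_iff\<close>)
    show "N \<subseteq> submodule_span A (M\<lparr>carrier := N\<rparr>) X"
      unfolding submodule_span_def by (rule Inter_greatest) (use X(3) assms in \<open>simp add: submodule_restrict_iff\<close>)
  qed
  then show ?thesis unfolding finitely_generated_def using X(1,2) by (intro exI[of _ X]) simp
qed

text \<open>Addition maps the external product onto the sum, and as the summands meet in zero, the
  first entry can be read off; so \<open>\<phi>\<close> after the first projection factors through
  addition.\<close>

lemma (in finite_length) ex_hom_on_sum:
  assumes T: "submodule T A M" "submodule T' A M" "T \<inter> T' = {\<zero>\<^bsub>M\<^esub>}"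
    and E: "left_module A E" and \<phi>: "\<phi> \<in> module_hom A (M\<lparr>carrier := T\<rparr>) E"
  shows "\<exists>\<psi>\<in>module_hom A (M\<lparr>carrier := T <+>\<^bsub>M\<^esub> T'\<rparr>) E. (\<forall>x\<in>T. \<psi> x = \<phi> x) \<and> (\<forall>y\<in>T'. \<psi> y = \<zero>\<^bsub>E\<^esub>)"
proof -
  note cT = submodule_closed[OF T(1)] and cT' = submodule_closed[OF T(2)]
  let ?U = "prod_module (M\<lparr>carrier := T\<rparr>) (M\<lparr>carrier := T'\<rparr>)"
  have lT: "left_module A (M\<lparr>carrier := T\<rparr>)" and lT': "left_module A (M\<lparr>carrier := T'\<rparr>)"
    using left_module_submodule T by simp_all
  interpret \<phi>: module_morphism A "M\<lparr>carrier := T\<rparr>" E \<phi> by (rule module_morphismI[OF lT E \<phi>])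
  have lU: "left_module A ?U" by (rule left_module_prod_module[OF lT lT'])
  have cc: "x \<in> carrier M" if "x \<in> T \<or> x \<in> T'" for x using that cT(1) cT'(1) by blast
  let ?\<rho> = "\<lambda>(x, y). x \<oplus>\<^bsub>M\<^esub> y"
  have \<rho>: "?\<rho> \<in> module_hom A ?U (M\<lparr>carrier := T <+>\<^bsub>M\<^esub> T'\<rparr>)"
    by (rule module_homI) (auto simp: mem_set_add cc M.a_ac smult_r_distr)
  have surj: "?\<rho> ` carrier ?U = carrier (M\<lparr>carrier := T <+>\<^bsub>M\<^esub> T'\<rparr>)"
    by (auto simp: mem_set_add image_iff; blast)
  have \<psi>: "(\<lambda>(x, y). \<phi> x) \<in> module_hom A ?U E"
    by (rule module_homI) (use \<phi>.hom_closed \<phi>.hom_add \<phi>.hom_smult in auto)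
  have uniq: "x = x'" if "x \<in> T" "y \<in> T'" "x' \<in> T" "y' \<in> T'" "x \<oplus>\<^bsub>M\<^esub> y = x' \<oplus>\<^bsub>M\<^esub> y'" for x y x' y'
  proof -
    have c: "x \<in> carrier M" "y \<in> carrier M" "x' \<in> carrier M" "y' \<in> carrier M" using that cc by simp_all
    have cm: "congruent_mod T' (u \<oplus>\<^bsub>M\<^esub> v) u" if "u \<in> carrier M" "v \<in> T'" for u v
      using that cc[of v] add_diff_cancel[of v u] M.a_comm[of u v] by (simp add: congruent_mod_def)
    have "congruent_mod T' x x'"
      using congruent_mod_trans[OF T(2) congruent_mod_sym[OF T(2) cm[OF c(1) that(2)]]]
        cm[OF c(3) that(4)] that(5) by simp
    then have "x \<ominus>\<^bsub>M\<^esub> x' \<in> T'" by (simp add: congruent_mod_def)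
    moreover have "x \<ominus>\<^bsub>M\<^esub> x' \<in> T" by (rule submodule_minus[OF T(1) that(1,3)])
    ultimately have "x \<ominus>\<^bsub>M\<^esub> x' = \<zero>\<^bsub>M\<^esub>" using T(3) by blast
    then show ?thesis using minus_eq_zero_iff c by simp
  qed
  have "\<exists>\<psi>\<in>module_hom A (M\<lparr>carrier := T <+>\<^bsub>M\<^esub> T'\<rparr>) E. \<forall>u\<in>carrier ?U. \<psi> (?\<rho> u) = (\<lambda>(x, y). \<phi> x) u"
  proof (rule ex_factor_hom[OF lU \<rho> surj \<psi>])
    fix u v assume uv: "u \<in> carrier ?U" "v \<in> carrier ?U" "?\<rho> u = ?\<rho> v"
    obtain x y x' y' where "u = (x, y)" "v = (x', y')" by (cases u, cases v)
    then show "(\<lambda>(x, y). \<phi> x) u = (\<lambda>(x, y). \<phi> x) v" using uv uniq[of x y x' y'] by simp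
  qed
  then obtain \<psi>' where \<psi>': "\<psi>' \<in> module_hom A (M\<lparr>carrier := T <+>\<^bsub>M\<^esub> T'\<rparr>) E"
    "\<And>x y. x \<in> T \<Longrightarrow> y \<in> T' \<Longrightarrow> \<psi>' (x \<oplus>\<^bsub>M\<^esub> y) = \<phi> x" by auto
  have "\<psi>' x = \<phi> x" if "x \<in> T" for x using \<psi>'(2)[OF that cT'(2)] cc that by simp
  moreover have "\<psi>' y = \<zero>\<^bsub>E\<^esub>" if "y \<in> T'" for y using \<psi>'(2)[OF cT(2) that] cc that \<phi>.hom_zero by simp
  ultimately show ?thesis using \<psi>'(1) by blast
qed

lemma (in artin_algebra_module) N_shaped_of_nonlocal_noncolocal:
  assumes quadri: "projectives_quadri A" and bis: "projectives_biserial A"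
    and fg: "fg_module A M" and ind: "indecomposable A M" and len: "has_length A M 4"
    and nloc: "\<not> local_module A M" and ncol: "\<not> colocal_module A M"
  shows "N_shaped A M"
proof -
  obtain h where h: "finite_length A M h" "h (carrier M) = 4" using ex_finite_length[OF len] by blast
  interpret M: finite_length A M h by (rule h(1))
  obtain L D T1 T2 where fr: "M.nonlocal_frame L D T1 T2" using M.ex_nonlocal_frame[OF h(2) ind nloc ncol] by blast
  have L: "submodule L A M" and D: "submodule D A M" "D \<subseteq> L"
    and T: "covers A M {\<zero>\<^bsub>M\<^esub>} T1" "covers A M {\<zero>\<^bsub>M\<^esub>} T2" "T1 \<inter> T2 = {\<zero>\<^bsub>M\<^esub>}" "T1 <+>\<^bsub>M\<^esub> T2 = D"
    using fr unfolding M.nonlocal_frame_def by simp_all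
  have sT: "submodule T1 A M" "submodule T2 A M" using T(1,2) by (auto simp: covers_def)
  have TL: "T1 \<subseteq> L" "T2 \<subseteq> L" using set_add_upper[OF sT] T(4) D(2) by auto
  let ?L = "M\<lparr>carrier := L\<rparr>"
  interpret L: artin_algebra_module R A ?L
    by (simp add: artin_algebra_module_def alg.artin_algebra_axioms lmod_submodule[OF L])
  have sadd: "X <+>\<^bsub>?L\<^esub> Y = X <+>\<^bsub>M\<^esub> Y" for X Y by (simp add: set_add_def')
  have "\<exists>T\<in>{T1, T2}. \<exists>(E :: 'a fg_object) \<phi>. injective A E \<and> uniserial A E \<and>
      \<phi> \<in> module_hom A (?L\<lparr>carrier := T\<rparr>) E \<and> inj_on \<phi> T"
    by (rule L.ex_embedding_into_uniserial_injective[OF quadri bis M.finite_length_submodule[OF L]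
          M.nonlocal_frame_astride(1)[OF fr]])
      (use T TL in \<open>simp_all add: covers_restrict[OF L] sadd\<close>)
  then obtain T and E :: "'a fg_object" and \<phi> where *: "T \<in> {T1, T2}" "injective A E" "uniserial A E"
    "\<phi> \<in> module_hom A (M\<lparr>carrier := T\<rparr>) E" "inj_on \<phi> T" by auto
  \<comment> \<open>Stated for either order of the two simple summands, because condition (b) does
    not tell which envelope is uniserial.\<close>
  have main: "N_shaped A M"
    if fr: "M.nonlocal_frame L D T T'" and inj: "injective A E" and uni: "uniserial A E"
      and \<phi>: "\<phi> \<in> module_hom A (M\<lparr>carrier := T\<rparr>) E" "inj_on \<phi> T" for T T' and E :: "'a fg_object" and \<phi>
  proof -
    have T: "covers A M {\<zero>\<^bsub>M\<^esub>} T" "covers A M {\<zero>\<^bsub>M\<^esub>} T'" "T \<inter> T' = {\<zero>\<^bsub>M\<^esub>}" "T <+>\<^bsub>M\<^esub> T' = D"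
      using fr unfolding M.nonlocal_frame_def by simp_all
    have sT: "submodule T A M" "submodule T' A M" using T(1,2) by (auto simp: covers_def)
    have TD: "T \<subseteq> D" "T' \<subseteq> D" using set_add_upper[OF sT] T(4) by simp_all
    have lE: "left_module A E" using inj by (simp add: injective_def fg_module_def)
    obtain \<psi> where \<psi>: "\<psi> \<in> module_hom A (M\<lparr>carrier := D\<rparr>) E" "\<forall>x\<in>T. \<psi> x = \<phi> x" "\<forall>y\<in>T'. \<psi> y = \<zero>\<^bsub>E\<^esub>"
      using M.ex_hom_on_sum[OF sT T(3) lE \<phi>(1)] T(4) by auto
    have fgD: "fg_module A (M\<lparr>carrier := D\<rparr>)"
      using M.finitely_generated_submodule[OF D(1)] left_module_submodule[OF D(1)] by (simp add: fg_module_def)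
    obtain f where f: "f \<in> module_hom A M E" "\<forall>x\<in>D. f x = \<psi> x"
      using injective_extends[OF inj fg D(1) fgD \<psi>(1)] by blast
    have "f x = \<phi> x" if "x \<in> T" for x using f(2) \<psi>(2) TD that by auto
    then have "inj_on f T" using \<phi>(2) by (simp add: inj_on_def)
    moreover have "f y = \<zero>\<^bsub>E\<^esub>" if "y \<in> T'" for y using f(2) \<psi>(3) TD that by auto
    ultimately show ?thesis by (rule M.N_shaped_of_hom[OF h(2) ind nloc fr lE uni f(1)])
  qed
  have "T2 <+>\<^bsub>M\<^esub> T1 = D" using T(4) set_add_commute[OF sT] by simp
  then have fr': "M.nonlocal_frame L D T2 T1"
    using fr unfolding M.nonlocal_frame_def by (simp add: Int_commute)
  show ?thesis
  proof (cases "T = T1")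
    case True
    then show ?thesis using main[OF fr *(2,3)] *(4,5) by simp
  next
    case False
    then have "T = T2" using *(1) by simp
    then show ?thesis using main[OF fr' *(2,3)] *(4,5) by simp
  qed
qed

theorem theorem4p2p3:
  fixes R :: "('r, 'x) ring_scheme" and A :: "('r, 'a) module" and M :: "('a, 'm) module"
  assumes "quadri_biserial_algebra R A"
    and "fg_module A M" and "indecomposable A M" and "has_length A M 4"
  shows "\<exists>!i. i < 4 \<and>
    [N_shaped A M,
     astride_biserial A M \<and> projective A M,
     coastride_biserial A M \<and> injective A M,
     projective A M \<and> injective A M \<and> (uniserial A M \<or> lozenge A M)] ! i"
proof -
  have alg: "artin_algebra R A" and bis: "projectives_biserial A" "projectives_biserial (opposite A)"
    and quadri: "projectives_quadri A" "projectives_quadri (opposite A)"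
    using assms(1) by (simp_all add: quadri_biserial_algebra_def biserial_algebra_def)
  interpret artin_algebra_module R A M
    using alg assms(2) by (simp add: artin_algebra_module_def lmod_def fg_module_def)
  obtain h where h: "finite_length A M h" "h (carrier M) = 4" using ex_finite_length[OF assms(4)] by blast
  interpret M: finite_length A M h by (rule h(1))
  have nz: "carrier M \<noteq> {\<zero>\<^bsub>M\<^esub>}" using assms(3) by (simp add: indecomposable_def)
  have inj: "injective A M" if "colocal_module A M"
    using that M.colocal_module_iff injective_of_colocal[OF quadri(2) assms(2,4)] by blast
  have proj: "projective A M" if "local_module A M"
    using projective_of_local[OF quadri(1) assms(2,4) that] .
  have bis_local: "biserial_module A M" if "local_module A M" "\<not> uniserial A M"
    by (rule biserial_of_local[OF quadri(1) bis(1) assms(4) that(1) assms(3) that(2)])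
  have uni: "local_module A M \<and> colocal_module A M" if "uniserial A M"
    using M.local_colocal_of_uniserial[OF nz that] by simp
  \<comment> \<open>Each of the four cases is equivalent to one combination of being local and being
    colocal, so that existence and uniqueness of the index become propositional.\<close>
  have 0: "N_shaped A M \<longleftrightarrow> \<not> local_module A M \<and> \<not> colocal_module A M"
    using M.not_local_colocal_of_N_shaped[OF h(2)]
      N_shaped_of_nonlocal_noncolocal[OF quadri(1) bis(1) assms(2,3,4)] by blast
  have 1: "astride_biserial A M \<and> projective A M \<longleftrightarrow> local_module A M \<and> \<not> colocal_module A M"
    using bis_local uni proj unfolding astride_biserial_def by blast
  have 2: "coastride_biserial A M \<and> injective A M \<longleftrightarrow> \<not> local_module A M \<and> colocal_module A M"
    using biserial_of_colocal[OF quadri(2) bis(2) assms(3,4)] inj unfolding coastride_biserial_def by blast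
  \<comment> \<open>A uniserial module is both local and colocal; a local and colocal one that is
    not uniserial is biserial, hence diamond, and by its length a lozenge.\<close>
  have 3: "projective A M \<and> injective A M \<and> (uniserial A M \<or> lozenge A M) \<longleftrightarrow>
      local_module A M \<and> colocal_module A M"
    using bis_local uni proj inj assms(4) unfolding lozenge_def diamond_biserial_def by blast
  have lt: "i < 4 \<longleftrightarrow> i = 0 \<or> i = 1 \<or> i = 2 \<or> i = 3" for i :: nat by auto
  have "i < 4 \<and> [\<not> local_module A M \<and> \<not> colocal_module A M, local_module A M \<and> \<not> colocal_module A M,
      \<not> local_module A M \<and> colocal_module A M, local_module A M \<and> colocal_module A M] ! i \<longleftrightarrow>
      i = (if local_module A M then if colocal_module A M then 3 else 1 else if colocal_module A M then 2 else 0)"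
    for i :: nat
    unfolding lt by (cases "local_module A M"; cases "colocal_module A M") auto
  then show ?thesis unfolding 0 1 2 3 by simp
qed

end
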